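(* Let $L$ be an even lattice of odd rank $g>1$ with determinant $\Delta$, write $|\Delta|=2N$, and let $L'$ be its dual lattice. Let $\alpha,\beta\in L'/L$ and let $m,n$ be integers satisfying $\frac m{2\Delta}\in\mathbb Z+q(\alpha)$ and $\frac n{2\Delta}\in\mathbb Z+q(\beta)$. Suppose that $(-1)^{(g-1)/2}m$ is a fundamental discriminant, and put $m_L=(-4)^{(g-1)/2}m$. Then for any $v\in\mathbb Z$ and any integer $c\geq1$ we have $$\sum_{u\mid(v,c)}\left(\frac{m_L}u\right)\sqrt{\frac uc}\;S_{\alpha\frac vu,\beta}\left(\frac{mv^2}{u^2},n,\frac cu\right)=\frac{i^{-\sigma}}{\sqrt{2N}}\sum_{\substack{\ell\bmod 2Nc\\ \frac\ell\Delta\equiv\langle\alpha,\beta\rangle\,(1)}}\xi_{\alpha,\beta}(\ell,m,n,c)\,e_{\Delta c}(\ell v),$$ where $u$ runs over positive divisors. Furthermore, for all such $\ell,m,n,c$ (with $\frac\ell\Delta\equiv\langle\alpha,\beta\rangle \pmod 1$) we have $$\xi_{\alpha,\beta}(\ell,m,n,c)\ll_L1,$$ with an implied constant depending only on $L$.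
   Context: Lattices. An even lattice $L$ of rank $g$ is a free $\mathbb Z$-module of rank $g$ with a nondegenerate symmetric bilinear form $\langle\cdot,\cdot\rangle:L\times L\to\mathbb Z$ such that $\langle x,x\rangle\in2\mathbb Z$ for all $x$; put $q(x)=\frac12\langle x,x\rangle$, and extend both to $L\otimes\mathbb Q$. The dual lattice is $L'=\{x\in L\otimes\mathbb Q:\langle x,y\rangle\in\mathbb Z\ \forall y\in L\}$. $\Delta$ is the determinant of a Gram matrix of $L$ (possibly negative), so $|L'/L|=|\Delta|$; $\Delta$ is even when $g$ is odd, so $N\in\mathbb Z^+$. On $L'/L$, $q$ and $\langle\cdot,\cdot\rangle$ are well defined modulo $1$. $(b^+,b^-)$ is the signature of $L$, $g=b^++b^-$. Notation. $e_c(x)=e^{2\pi ix/c}$; $i^s=e^{\pi is/2}$ for real $s$; $(x,y,\dots)$ is the gcd (with $(0,c)=c$); $\left(\frac\cdot\cdot\right)$ is the Kronecker symbol. Fundamental discriminant: an integer $D$ such that either $D\equiv1\pmod 4$ is squarefree (including $D=1$), or $4\mid D$ with $D/4\equiv2,3\pmod4$ squarefree. Weil representation coefficients. For $\gamma=\begin{pmatrix}a&b\\c&d\end{pmatrix}\in\mathrm{SL}_2(\mathbb Z)$ with $c>0$ let $\tilde\gamma=(\gamma,\sqrt{cz+d})$ be its lift to the metaplectic group (principal branch), and $$\rho_{\alpha\beta}(\tilde\gamma)=\frac{i^{(b^--b^+)/2}}{c^{(b^++b^-)/2}\sqrt{|L'/L|}}\sum_{r\in L/cL}e_c\big(aq(\alpha+r)-\langle\beta,\alpha+r\rangle+dq(\beta)\big)$$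 (computed with any representatives of $\alpha,\beta$ in $L'$). Kloosterman sums. Fix a half-integer $k$ ($2k\in\mathbb Z$) with $\sigma:=k+\frac12(b^--b^+)\in\mathbb Z$. For $c\in\mathbb Z^+$, $\frac{m}{2\Delta}\in\mathbb Z+q(\alpha)$ and $\frac{n}{2\Delta}\in\mathbb Z+q(\beta)$, $$S_{\alpha,\beta}(m,n,c)=e^{-\pi ik/2}\sum_{d\in(\mathbb Z/c\mathbb Z)^\times}\overline{\rho_{\alpha\beta}(\tilde\gamma)}\,e_{2\Delta c}(ma+nd),$$ where $\gamma=\begin{pmatrix}a&b\\c&d\end{pmatrix}\in\mathrm{SL}_2(\mathbb Z)$ is any matrix with bottom row $(c\ d)$; the sum does not depend on the choices made. The function $\xi_{\alpha,\beta}$. Let $\ell\in\mathbb Z$ with $\frac\ell\Delta\equiv\langle\alpha,\beta\rangle\pmod1$. Choose representatives of $\alpha,\beta$ in $L'$ and define the integers $\tilde m=\frac m{2\Delta}-q(\alpha)$, $\tilde\ell=\frac\ell\Delta-\langle\alpha,\beta\rangle$, $\tilde n=\frac n{2\Delta}-q(\beta)$. For a prime $p$ and $j\ge0$ let $\mathcal N(p^j)$ be the number of pairs $(x,y)$, $x\in\mathbb Z/p^j\mathbb Z$, $y\in L/p^jL$, with $$\tilde mx^2-\langle\alpha,y\rangle x-q(y)+\langle\beta,y\rangle-\tilde\ell x+\tilde n\equiv0\pmod{p^j}.$$ For each prime $p$ define $\nu$ by $p^\nu\parallel2\Delta$, and for odd $p$ put $p^*=\left(\frac{-1}p\right)p$.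 For $\lambda\ge1$: (1) If $p$ is odd and $(m,\Delta,p)=1$ then $$\xi_{\alpha,\beta}(\ell,m,n,p^\lambda)=\begin{cases}\left(\frac{m_L}{p^\lambda}\right)&\text{if }p\nmid m\text{ and }\ell^2\equiv mn\pmod{p^{\lambda+\nu}},\\[2pt]\left(\frac{m_L/p^*}{p^\lambda}\right)\left(\frac{p^*}{(\ell^2-mn)/p^\lambda}\right)&\text{if }p\mid m\text{ and }\ell^2\equiv mn\pmod{p^\lambda},\\0&\text{otherwise.}\end{cases}$$ (2) If $p=2$, or if $p$ is odd and $(m,\Delta,p)>1$, then $$\xi_{\alpha,\beta}(\ell,m,n,p^\lambda)=\begin{cases}p^{-\lambda\frac{g+1}2}\left(\mathcal N(p^\lambda)-p^g\mathcal N(p^{\lambda-1})\right)&\text{if }\ell^2\equiv mn\pmod{2Np^{2\lfloor\lambda/2\rfloor}},\\0&\text{otherwise.}\end{cases}$$ Extend multiplicatively in $c$: $\xi_{\alpha,\beta}(\ell,m,n,c)=\prod_{p^\lambda\parallel c}\xi_{\alpha,\beta}(\ell,m,n,p^\lambda)$, with value $1$ at $c=1$. *)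

theory Defs
  imports "HOL-Analysis.Analysis" "HOL-Number_Theory.Number_Theory"
    "HOL-Computational_Algebra.Squarefree"
begin

section \<open>Arithmetic preliminaries\<close>

text \<open>The Kronecker symbol \<open>(a / n)\<close> for arbitrary integers, with the usual conventions at
  \<open>p = 2\<close>, at the unit \<open>-1\<close>, and at \<open>n = 0\<close>.\<close>

definition kronecker_prime :: "int \<Rightarrow> int \<Rightarrow> int" where
  "kronecker_prime a p =
     (if p = 2 then (if even a then 0 else if a mod 8 = 1 \<or> a mod 8 = 7 then 1 else - 1)
      else Legendre a p)"

definition kronecker :: "int \<Rightarrow> int \<Rightarrow> int" where
  "kronecker a n =
     (if n = 0 then (if \<bar>a\<bar> = 1 then 1 else 0)
      else (if n < 0 \<and> a < 0 then - 1 else 1) *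
           (\<Prod>p\<in>prime_factors n. kronecker_prime a p ^ multiplicity p n))"

definition fundamental_discriminant :: "int \<Rightarrow> bool" where
  "fundamental_discriminant D \<longleftrightarrow>
     (D mod 4 = 1 \<and> squarefree D) \<or>
     (4 dvd D \<and> ((D div 4) mod 4 = 2 \<or> (D div 4) mod 4 = 3) \<and> squarefree (D div 4))"

text \<open>\<open>e_frac c x = exp (2 \<pi> i x / c)\<close>; the index \<open>c\<close> may be negative.\<close>

definition e_frac :: "int \<Rightarrow> rat \<Rightarrow> complex" where
  "e_frac c x = exp (2 * of_real pi * \<i> * of_real (of_rat x / of_int c))"

definition i_pow :: "real \<Rightarrow> complex" where
  "i_pow s = exp (of_real pi * \<i> * of_real s / 2)"

section \<open>Even lattices\<close>

text \<open>A free \<open>\<int>\<close>-module of rank \<open>g\<close> is \<open>\<int>\<^sup>g\<close> after the choice of a basis, so the lattice is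
  \<open>L = int ^ 'n\<close> with \<open>g = CARD('n)\<close> and an arbitrary form \<open>B\<close>; \<open>L \<otimes> \<rat>\<close> is \<open>rat ^ 'n\<close>.
  Biadditivity is the same as \<open>\<int>\<close>-bilinearity.\<close>

definition even_lattice :: "(int ^ 'n \<Rightarrow> int ^ 'n \<Rightarrow> int) \<Rightarrow> bool" where
  "even_lattice B \<longleftrightarrow>
     (\<forall>x y z. B (x + y) z = B x z + B y z) \<and>
     (\<forall>x y z. B x (y + z) = B x y + B x z) \<and>
     (\<forall>x y. B x y = B y x) \<and>
     (\<forall>x. (\<forall>y. B x y = 0) \<longrightarrow> x = 0) \<and>
     (\<forall>x. even (B x x))"

definition lat_det :: "(int ^ 'n \<Rightarrow> int ^ 'n \<Rightarrow> int) \<Rightarrow> int" where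
  "lat_det B = det (\<chi> i j. B (axis i 1) (axis j 1))"

text \<open>The bilinear extension of the form to \<open>L \<otimes> F\<close>; used with \<open>F = \<rat>\<close> and, for the signature,
  with \<open>F = \<real>\<close>.\<close>

definition ext_form ::
    "(int ^ 'n \<Rightarrow> int ^ 'n \<Rightarrow> int) \<Rightarrow> 'f::field_char_0 ^ 'n \<Rightarrow> 'f ^ 'n \<Rightarrow> 'f" where
  "ext_form B x y = (\<Sum>i\<in>UNIV. \<Sum>j\<in>UNIV. x $ i * y $ j * of_int (B (axis i 1) (axis j 1)))"

definition ext_quad :: "(int ^ 'n \<Rightarrow> int ^ 'n \<Rightarrow> int) \<Rightarrow> rat ^ 'n \<Rightarrow> rat" where
  "ext_quad B x = ext_form B x x / 2"

definition emb :: "int ^ 'n \<Rightarrow> rat ^ 'n" where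
  "emb y = (\<chi> i. of_int (y $ i))"

definition dual_lattice :: "(int ^ 'n \<Rightarrow> int ^ 'n \<Rightarrow> int) \<Rightarrow> (rat ^ 'n) set" where
  "dual_lattice B = {x. \<forall>y. ext_form B x (emb y) \<in> \<int>}"

definition disc_group :: "(int ^ 'n \<Rightarrow> int ^ 'n \<Rightarrow> int) \<Rightarrow> (rat ^ 'n) set set" where
  "disc_group B =
     dual_lattice B // {(x, y). x \<in> dual_lattice B \<and> y \<in> dual_lattice B \<and> x - y \<in> range emb}"

text \<open>The signature \<open>(b\<^sup>+, b\<^sup>-)\<close>: the maximal dimensions of a positive and of a negative definite
  subspace of \<open>L \<otimes> \<real>\<close>.\<close>

definition b_plus :: "(int ^ 'n \<Rightarrow> int ^ 'n \<Rightarrow> int) \<Rightarrow> nat" where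
  "b_plus B = Max {dim V | V :: (real ^ 'n) set.
     subspace V \<and> (\<forall>x\<in>V. x \<noteq> 0 \<longrightarrow> ext_form B x x > 0)}"

definition b_minus :: "(int ^ 'n \<Rightarrow> int ^ 'n \<Rightarrow> int) \<Rightarrow> nat" where
  "b_minus B = Max {dim V | V :: (real ^ 'n) set.
     subspace V \<and> (\<forall>x\<in>V. x \<noteq> 0 \<longrightarrow> ext_form B x x < 0)}"

text \<open>A system of representatives of \<open>L / cL\<close>.\<close>

definition reps_mod :: "int \<Rightarrow> (int ^ 'n) set" where
  "reps_mod c = {y. \<forall>i. 0 \<le> y $ i \<and> y $ i < c}"

section \<open>Weil representation and Kloosterman sums\<close>

text \<open>From here on, elements \<open>\<alpha>\<close>, \<open>\<beta>\<close> of \<open>L' / L\<close> are given by representatives in the dual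
  lattice.\<close>

definition weil_coeff ::
    "(int ^ 'n \<Rightarrow> int ^ 'n \<Rightarrow> int) \<Rightarrow> rat ^ 'n \<Rightarrow> rat ^ 'n \<Rightarrow> int ^ 2 ^ 2 \<Rightarrow> complex" where
  "weil_coeff B \<alpha> \<beta> \<gamma> =
     (let a = \<gamma> $ 1 $ 1; c = \<gamma> $ 2 $ 1; d = \<gamma> $ 2 $ 2 in
      i_pow ((real (b_minus B) - real (b_plus B)) / 2) /
      of_real (of_int c powr (real (b_plus B + b_minus B) / 2) * sqrt (real (card (disc_group B)))) *
      (\<Sum>r\<in>reps_mod c.
         e_frac c (of_int a * ext_quad B (\<alpha> + emb r) - ext_form B \<beta> (\<alpha> + emb r)
                   + of_int d * ext_quad B \<beta>)))"

definition some_SL2 :: "int \<Rightarrow> int \<Rightarrow> int ^ 2 ^ 2" where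
  "some_SL2 c d = (SOME \<gamma>. det \<gamma> = 1 \<and> \<gamma> $ 2 $ 1 = c \<and> \<gamma> $ 2 $ 2 = d)"

definition sigma_wt :: "(int ^ 'n \<Rightarrow> int ^ 'n \<Rightarrow> int) \<Rightarrow> real \<Rightarrow> real" where
  "sigma_wt B k = k + (real (b_minus B) - real (b_plus B)) / 2"

definition kloosterman ::
    "(int ^ 'n \<Rightarrow> int ^ 'n \<Rightarrow> int) \<Rightarrow> real \<Rightarrow> rat ^ 'n \<Rightarrow> rat ^ 'n \<Rightarrow> int \<Rightarrow> int \<Rightarrow> int \<Rightarrow> complex" where
  "kloosterman B k \<alpha> \<beta> m n c =
     exp (- of_real pi * \<i> * of_real k / 2) *
     (\<Sum>d\<in>{d. 0 \<le> d \<and> d < c \<and> coprime d c}.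
        cnj (weil_coeff B \<alpha> \<beta> (some_SL2 c d)) *
        e_frac (2 * lat_det B * c) (of_int (m * (some_SL2 c d $ 1 $ 1) + n * d)))"

section \<open>The function \<open>\<xi>\<close>\<close>

definition m_L :: "(int ^ 'n \<Rightarrow> int ^ 'n \<Rightarrow> int) \<Rightarrow> int \<Rightarrow> int" where
  "m_L B m = (- 4) ^ ((CARD('n) - 1) div 2) * m"

text \<open>The congruence below has an integral left-hand side whenever
  \<open>m / (2\<Delta>) \<in> \<int> + q(\<alpha>)\<close>, \<open>l / \<Delta> \<in> \<int> + \<langle>\<alpha>, \<beta>\<rangle>\<close> and \<open>n / (2\<Delta>) \<in> \<int> + q(\<beta>)\<close>; being
  divisible by \<open>M\<close> is expressed by integrality of its quotient by \<open>M\<close>.\<close>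

definition N_count ::
    "(int ^ 'n \<Rightarrow> int ^ 'n \<Rightarrow> int) \<Rightarrow> rat ^ 'n \<Rightarrow> rat ^ 'n \<Rightarrow> int \<Rightarrow> int \<Rightarrow> int \<Rightarrow> int \<Rightarrow> nat" where
  "N_count B \<alpha> \<beta> l m n M =
     (let mt = of_int m / of_int (2 * lat_det B) - ext_quad B \<alpha>;
          lt = of_int l / of_int (lat_det B) - ext_form B \<alpha> \<beta>;
          nt = of_int n / of_int (2 * lat_det B) - ext_quad B \<beta>
      in card {(x, y). x \<in> {0..<M} \<and> y \<in> reps_mod M \<and>
           (mt * (of_int x)\<^sup>2 - ext_form B \<alpha> (emb y) * of_int x - ext_quad B (emb y)
             + ext_form B \<beta> (emb y) - lt * of_int x + nt) / of_int M \<in> \<int>})"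

text \<open>Here \<open>p\<close> is a prime, \<open>\<lambda> \<ge> 1\<close> is called \<open>j\<close>, and \<open>2N = |\<Delta>|\<close>.\<close>

definition xi_prime_power ::
    "(int ^ 'n \<Rightarrow> int ^ 'n \<Rightarrow> int) \<Rightarrow> rat ^ 'n \<Rightarrow> rat ^ 'n \<Rightarrow> int \<Rightarrow> int \<Rightarrow> int \<Rightarrow> int \<Rightarrow> nat \<Rightarrow> real" where
  "xi_prime_power B \<alpha> \<beta> l m n p j =
     (let \<Delta> = lat_det B;
          \<nu> = multiplicity p (2 * \<Delta>);
          ps = kronecker (- 1) p * p;
          g = CARD('n)
      in if odd p \<and> gcd m (gcd \<Delta> p) = 1 then
           (if \<not> p dvd m \<and> [l\<^sup>2 = m * n] (mod p ^ (j + \<nu>)) then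
              of_int (kronecker (m_L B m) (p ^ j))
            else if p dvd m \<and> [l\<^sup>2 = m * n] (mod p ^ j) then
              of_int (kronecker (m_L B m div ps) (p ^ j) * kronecker ps ((l\<^sup>2 - m * n) div p ^ j))
            else 0)
         else
           (if [l\<^sup>2 = m * n] (mod \<bar>\<Delta>\<bar> * p ^ (2 * (j div 2))) then
              of_int p powr (- (real j * (real g + 1) / 2)) *
              (real (N_count B \<alpha> \<beta> l m n (p ^ j)) -
               of_int p ^ g * real (N_count B \<alpha> \<beta> l m n (p ^ (j - 1))))
            else 0))"

definition xi ::
    "(int ^ 'n \<Rightarrow> int ^ 'n \<Rightarrow> int) \<Rightarrow> rat ^ 'n \<Rightarrow> rat ^ 'n \<Rightarrow> int \<Rightarrow> int \<Rightarrow> int \<Rightarrow> int \<Rightarrow> real" where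
  "xi B \<alpha> \<beta> l m n c =
     (\<Prod>p\<in>prime_factors c. xi_prime_power B \<alpha> \<beta> l m n p (multiplicity p c))"

definition admissible ::
    "(int ^ 'n \<Rightarrow> int ^ 'n \<Rightarrow> int) \<Rightarrow> rat ^ 'n \<Rightarrow> rat ^ 'n \<Rightarrow> int \<Rightarrow> int \<Rightarrow> bool" where
  "admissible B \<alpha> \<beta> m n \<longleftrightarrow>
     \<alpha> \<in> dual_lattice B \<and> \<beta> \<in> dual_lattice B \<and>
     of_int m / of_int (2 * lat_det B) - ext_quad B \<alpha> \<in> \<int> \<and>
     of_int n / of_int (2 * lat_det B) - ext_quad B \<beta> \<in> \<int> \<and>
     fundamental_discriminant ((- 1) ^ ((CARD('n) - 1) div 2) * m)"

definition l_cong ::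
    "(int ^ 'n \<Rightarrow> int ^ 'n \<Rightarrow> int) \<Rightarrow> rat ^ 'n \<Rightarrow> rat ^ 'n \<Rightarrow> int \<Rightarrow> bool" where
  "l_cong B \<alpha> \<beta> l \<longleftrightarrow> of_int l / of_int (lat_det B) - ext_form B \<alpha> \<beta> \<in> \<int>"

end

theory Submission
  imports Defs
begin

text \<open>
  Write \<open>l = \<Delta> (t + \<langle>\<alpha>, \<beta>\<rangle>)\<close> and let \<open>F\<^sub>t (x, y)\<close> be the integral quadratic polynomial whose zeros
  define \<open>\<N>\<close>. After unfolding the Kloosterman sums, orthogonality of the characters in \<open>t\<close>
  reduces the identity to \<open>\<xi> = c\<^sup>-\<^sup>1 \<Sum>u | c. (m\<^sub>L / u) (c / u)\<^sup>-\<^sup>h T\<^sub>t (c / u)\<close>, where \<open>2h = g + 1\<close> and \<open>T\<^sub>t (C)\<close>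
  is the sum of \<open>e\<^sub>C (d F\<^sub>t (x, y))\<close> over units \<open>d\<close> and over \<open>x\<close>, \<open>y\<close> modulo \<open>C\<close>. Both sides are multiplicative
  in \<open>c\<close>. The quadratic part of \<open>F\<^sub>t\<close> has determinant \<open>- m\<close>, and at a point whose gradient is divisible
  by \<open>P\<close> one has \<open>(l\<^sup>2 - m n) / \<Delta> \<equiv> - 2 m F\<^sub>t\<close> modulo \<open>P\<^sup>2\<close>. Hence for odd \<open>p\<close> not dividing \<open>m\<close> the polynomial is
  a unimodular form plus a constant, its Gauss sum is \<open>(m\<^sub>L / p)\<^sup>j p\<^sup>j\<^sup>h\<close>, and the sum over \<open>u\<close> telescopes.
  If \<open>p\<close> divides \<open>m\<close> but not \<open>\<Delta>\<close>, the sum over \<open>y\<close> is a unimodular Gauss sum of odd rank and a Legendre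
  twisted sum over \<open>d\<close> remains. In the other cases \<open>(m\<^sub>L / p) = 0\<close>, only \<open>T\<^sub>t (p\<^sup>j)\<close> survives, and stationary
  phase shows that it vanishes unless the congruence in the definition of \<open>\<xi>\<close> holds. The bound
  is Weyl's: the kernel of the quadratic part modulo \<open>p\<^sup>j\<close> is killed by \<open>m\<close>, and \<open>p\<^sup>4\<close> does not divide \<open>m\<close>.
\<close>

section \<open>Additive characters and Ramanujan sums\<close>

text \<open>Over the rationals the polynomial is \<open>(m x^2 - 2 l x + n) / (2 \<Delta>) -
  q(\<beta> - x \<alpha> - y)\<close>. Its quadratic part has a determinant free of \<Delta>, so an
  odd prime dividing \<Delta> is harmless as long as it does not divide \<open>m\<close>. The
  critical point \<open>x = l / m\<close>, \<open>y = \<beta> - x \<alpha>\<close> acquires no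
  denominators beyond \<open>m\<close>, and the critical value is
  \<open>-(l^2 - m n) / (2 m \<Delta>)\<close>; this is how congruences for \<open>l^2 - m n\<close>
  enter \<xi>. The number \<open>g + 1\<close> of variables is even, so a unimodular Gauss sum does
  not depend on the unit \<open>d\<close>, and only squares of one-variable Gauss sums have to be
  known. Rank greater than 1 makes \<open>m_L\<close> even and puts 2 among the primes with
  vanishing symbol. The exponent 4 is forced by the prime 2: a fundamental discriminant can be
  divisible by 8, but not by 16. The Weil coefficients are normalised by the signature and by the
  order of \<open>L' / L\<close>, both taken from their definitions; identifying them with the rank
  and with the absolute value of \<Delta> requires Sylvester's argument and a diagonalisation of the
  Gram matrix over the integers.\<close>

definition ee :: "rat \<Rightarrow> complex" where
  "ee x = cis (2 * pi * of_rat x)"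

text \<open>For integral \<open>z\<close> the value has period \<open>M\<close>, so equalities of
  exponentials become divisibility statements. \<open>ee\<close> remains for the rational values of
  the form on the dual lattice.\<close>

definition ec :: "int \<Rightarrow> int \<Rightarrow> complex" where
  "ec M z = ee (of_int z / of_int M)"

lemma ee_add: "ee (x + y) = ee x * ee y"
  by (simp add: ee_def of_rat_add distrib_left cis_mult)

lemma ee_0 [simp]: "ee 0 = 1"
  by (simp add: ee_def)

lemma ee_minus: "ee (- x) = cnj (ee x)"
  by (simp add: ee_def of_rat_minus cis_cnj)

lemma norm_ee [simp]: "norm (ee x) = 1"
  by (simp add: ee_def)

lemma ee_Ints:
  assumes "x \<in> \<int>"
  shows "ee x = 1"
proof -
  obtain k where "x = of_int k" using assms by (auto elim: Ints_cases)
  then show ?thesis by (simp add: ee_def cis_multiple_2pi)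
qed

lemma e_frac_ee: "e_frac c x = ee (x / of_int c)"
  by (simp add: e_frac_def ee_def cis_conv_exp of_rat_divide mult.commute mult.left_commute)

lemma ec_add: "ec M (x + y) = ec M x * ec M y"
  by (simp add: ec_def add_divide_distrib ee_add)

lemma ec_0 [simp]: "ec M 0 = 1"
  by (simp add: ec_def)

lemma ec_minus: "ec M (- x) = cnj (ec M x)"
  by (simp add: ec_def flip: ee_minus)

lemma ec_diff: "ec M (x - y) = ec M x * cnj (ec M y)"
  using ec_add[of M x "-y"] by (simp add: ec_minus)

lemma norm_ec [simp]: "norm (ec M z) = 1"
  by (simp add: ec_def)

lemma ec_1 [simp]: "ec 1 z = 1"
  by (simp add: ec_def ee_Ints)

lemma ec_eq_1_if_dvd:
  assumes "M dvd z"
  shows "ec M z = 1"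
proof -
  obtain k where "z = M * k" using assms by blast
  then show ?thesis by (cases "M = 0") (simp_all add: ec_def ee_Ints)
qed

lemma ec_eq_1_iff:
  assumes "M > 0"
  shows "ec M z = 1 \<longleftrightarrow> M dvd z"
proof
  assume "ec M z = 1"
  then have "cis (2 * pi * (of_int z / of_int M)) = 1"
    by (simp add: ec_def ee_def of_rat_divide)
  then have "cos (2 * pi * (of_int z / of_int M)) = 1"
    by (simp add: complex_eq_iff)
  then obtain n :: int where "2 * pi * (of_int z / of_int M) = n * 2 * pi"
    using cos_one_2pi_int by auto
  then have "of_int z = (of_int n * of_int M :: real)"
    using assms by (simp add: field_simps)
  then have "z = n * M"
    by (metis of_int_eq_iff of_int_mult)
  then show "M dvd z" by simp
qed (rule ec_eq_1_if_dvd)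

lemma ec_dvd_diff: "M dvd x - y \<Longrightarrow> ec M x = ec M y"
  using ec_add[of M "x - y" y] by (simp add: ec_eq_1_if_dvd)

lemma ec_scale: "k \<noteq> 0 \<Longrightarrow> ec (k * M) (k * z) = ec M z"
  by (simp add: ec_def)

section \<open>Reindexing sums over a complete residue system\<close>

lemma dvd_mod_minus [simp]: "(M::int) dvd x mod M - x"
  by (simp add: mod_eq_dvd_iff [symmetric])

lemma dvd_diff_trans: "(M::int) dvd x - y \<Longrightarrow> M dvd y - z \<Longrightarrow> M dvd x - z"
  using dvd_add[of M "x - y" "y - z"] by simp

lemma mod_eqI: "(M::int) dvd x - y \<Longrightarrow> 0 \<le> y \<Longrightarrow> y < M \<Longrightarrow> x mod M = y"
  using mod_eq_dvd_iff[of x M y] by simp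

text \<open>The map \<open>\<phi>\<close> has to be invertible only modulo \<open>M\<close>, with
  \<open>\<psi>\<close> as inverse; reducing modulo \<open>M\<close> restores the representatives.
  Translations and multiplication by units are the two instances used.\<close>

lemma sum_residues_bij:
  fixes f :: "int \<Rightarrow> 'b::comm_monoid_add"
  assumes M: "M > 0" and f: "\<And>x y. M dvd x - y \<Longrightarrow> f x = f y"
    and \<phi>: "\<And>x y. M dvd x - y \<Longrightarrow> M dvd \<phi> x - \<phi> y"
    and \<psi>: "\<And>x y. M dvd x - y \<Longrightarrow> M dvd \<psi> x - \<psi> y"
    and inv: "\<And>x. M dvd \<psi> (\<phi> x) - x" "\<And>x. M dvd \<phi> (\<psi> x) - x"
  shows "(\<Sum>x\<in>{0..<M}. f (\<phi> x)) = (\<Sum>x\<in>{0..<M}. f x)"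
proof (rule sum.reindex_bij_witness[where i = "\<lambda>x. \<psi> x mod M" and j = "\<lambda>x. \<phi> x mod M"])
  fix x assume x: "x \<in> {0..<M}"
  have "M dvd \<psi> (\<phi> x mod M) - \<psi> (\<phi> x)" by (rule \<psi>) simp
  then have "M dvd \<psi> (\<phi> x mod M) - x" using inv(1) by (rule dvd_diff_trans)
  then show "\<psi> (\<phi> x mod M) mod M = x" using x by (intro mod_eqI) auto
  have "M dvd \<phi> (\<psi> x mod M) - \<phi> (\<psi> x)" by (rule \<phi>) simp
  then have "M dvd \<phi> (\<psi> x mod M) - x" using inv(2) by (rule dvd_diff_trans)
  then show "\<phi> (\<psi> x mod M) mod M = x" using x by (intro mod_eqI) auto
  show "f (\<phi> x mod M) = f (\<phi> x)" by (rule f) simp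
qed (use M in auto)

lemma sum_residues_shift:
  fixes f :: "int \<Rightarrow> 'b::comm_monoid_add"
  assumes "M > 0" "\<And>x y. M dvd x - y \<Longrightarrow> f x = f y"
  shows "(\<Sum>x\<in>{0..<M}. f (x + a)) = (\<Sum>x\<in>{0..<M}. f x)"
  using assms by (intro sum_residues_bij[where \<psi> = "\<lambda>x. x - a"]) auto

lemma sum_residues_unit:
  fixes f :: "int \<Rightarrow> 'b::comm_monoid_add"
  assumes M: "M > 0" "\<And>x y. M dvd x - y \<Longrightarrow> f x = f y" and a: "coprime a M"
  shows "(\<Sum>x\<in>{0..<M}. f (a * x)) = (\<Sum>x\<in>{0..<M}. f x)"
proof -
  obtain b where "[a * b = 1] (mod M)" using a cong_solve_coprime_int by blast
  then have b: "M dvd a * b - 1" by (simp add: cong_iff_dvd_diff)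
  have *: "M dvd b * (a * x) - x" "M dvd a * (b * x) - x" for x
    using dvd_mult2[OF b, of x] by (simp_all add: algebra_simps)
  show ?thesis
    by (rule sum_residues_bij[where \<psi> = "\<lambda>x. b * x"])
      (use M * in \<open>auto simp flip: right_diff_distrib\<close>)
qed

text \<open>Replacing \<open>x\<close> by \<open>x + 1\<close> permutes the residues and multiplies
  the sum by \<open>ec M z\<close>, so the sum vanishes unless this factor is 1.\<close>

lemma sum_ec:
  assumes M: "M > 0"
  shows "(\<Sum>x\<in>{0..<M}. ec M (x * z)) = (if M dvd z then of_int M else 0)"
proof (cases "M dvd z")
  case True
  then show ?thesis using M by (simp add: ec_eq_1_if_dvd)
next
  case False
  let ?S = "\<Sum>x\<in>{0..<M}. ec M (x * z)"
  have "?S = (\<Sum>x\<in>{0..<M}. ec M ((x + 1) * z))"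
    using M by (intro sum_residues_shift[symmetric] ec_dvd_diff)
      (auto simp flip: left_diff_distrib)
  also have "\<dots> = ec M z * ?S"
    unfolding sum_distrib_left distrib_right ec_add mult_1 by (simp add: mult.commute)
  finally have "(1 - ec M z) * ?S = 0" by (simp add: algebra_simps)
  moreover have "ec M z \<noteq> 1" using False M by (simp add: ec_eq_1_iff)
  ultimately show ?thesis using False by simp
qed

text \<open>Literally the index set in the definition of \<open>kloosterman\<close>, so that it can
  be folded there. For \<open>c = 1\<close> it contains 0.\<close>

definition units_mod :: "int \<Rightarrow> int set" where
  "units_mod c = {d. 0 \<le> d \<and> d < c \<and> coprime d c}"

lemma units_mod_altdef: "units_mod c = {d\<in>{0..<c}. coprime d c}"
  by (auto simp: units_mod_def)

lemma finite_units_mod [simp]: "finite (units_mod c)"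
  by (rule finite_subset[of _ "{0..<c}"]) (auto simp: units_mod_def)

lemma units_mod_1 [simp]: "units_mod 1 = {0}"
  by (auto simp: units_mod_def)

lemma coprime_dvd_diff:
  fixes x y M :: int
  assumes "M dvd x - y"
  shows "coprime x M \<longleftrightarrow> coprime y M"
  using assms by (intro coprime_cong_cong_left) (simp add: cong_iff_dvd_diff)

lemma sum_units_unit:
  fixes f :: "int \<Rightarrow> 'b::comm_monoid_add"
  assumes M: "M > 0" and f: "\<And>x y. M dvd x - y \<Longrightarrow> f x = f y" and a: "coprime a M"
  shows "(\<Sum>x\<in>units_mod M. f (a * x)) = (\<Sum>x\<in>units_mod M. f x)"
proof -
  let ?g = "\<lambda>x. if coprime x M then f x else 0"
  have "(\<Sum>x\<in>units_mod M. f (a * x)) = (\<Sum>x\<in>{0..<M}. ?g (a * x))"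
    unfolding units_mod_altdef using a by (subst sum.inter_filter) simp_all
  also have "\<dots> = (\<Sum>x\<in>{0..<M}. ?g x)"
    by (rule sum_residues_unit) (use assms coprime_dvd_diff in auto)
  also have "\<dots> = (\<Sum>x\<in>units_mod M. f x)"
    unfolding units_mod_altdef by (subst sum.inter_filter) simp_all
  finally show ?thesis .
qed

section \<open>Ramanujan sums\<close>

definition ramanujan :: "int \<Rightarrow> int \<Rightarrow> complex" where
  "ramanujan M z = (\<Sum>d\<in>units_mod M. ec M (d * z))"

lemma ramanujan_cong: "M dvd x - y \<Longrightarrow> ramanujan M x = ramanujan M y"
  unfolding ramanujan_def
  by (intro sum.cong ec_dvd_diff) (auto simp flip: right_diff_distrib)

lemma ramanujan_1 [simp]: "ramanujan 1 z = 1"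
  by (simp add: ramanujan_def)

lemma coprime_prime_right_iff:
  fixes p :: int
  assumes p: "prime p"
  shows "coprime d p \<longleftrightarrow> \<not> p dvd d"
proof
  show "\<not> p dvd d" if "coprime d p"
    using that p by (metis coprime_common_divisor dvd_refl not_prime_unit)
  show "coprime d p" if "\<not> p dvd d"
    using prime_imp_coprime[OF p that] by (simp add: coprime_commute)
qed

lemma multiples_of_prime:
  fixes p :: int
  assumes "prime p"
  shows "{d\<in>{0..<p ^ Suc k}. p dvd d} = (\<lambda>x. p * x) ` {0..<p ^ k}"
proof -
  have p: "p > 0" using assms by (simp add: prime_gt_0_int)
  show ?thesis using p by (auto simp: image_iff dvd_def zero_le_mult_iff)
qed

text \<open>The units are all residues without the multiples of \<open>p\<close>, and those
  multiples contribute a complete sum to the modulus \<open>p ^ k\<close>.\<close>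

lemma ramanujan_prime_power:
  fixes p :: int
  assumes p: "prime p"
  shows "ramanujan (p ^ Suc k) z =
    (if p ^ Suc k dvd z then of_int (p ^ Suc k) else 0) - (if p ^ k dvd z then of_int (p ^ k) else 0)"
proof -
  have p0: "p > 0" using p by (simp add: prime_gt_0_int)
  let ?M = "p ^ Suc k"
  have M: "?M > 0" using p0 by simp
  have units: "units_mod ?M = {0..<?M} - {d\<in>{0..<?M}. p dvd d}"
  proof -
    have "coprime d ?M \<longleftrightarrow> \<not> p dvd d" for d
      by (simp only: coprime_power_right_iff coprime_prime_right_iff[OF p]) simp
    then show ?thesis unfolding units_mod_altdef by blast
  qed
  have "ramanujan ?M z = (\<Sum>d\<in>{0..<?M}. ec ?M (d * z)) - (\<Sum>d\<in>{d\<in>{0..<?M}. p dvd d}. ec ?M (d * z))"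
    unfolding ramanujan_def units by (rule sum_diff) auto
  also have "(\<Sum>d\<in>{d\<in>{0..<?M}. p dvd d}. ec ?M (d * z)) = (\<Sum>x\<in>{0..<p ^ k}. ec ?M (p * x * z))"
    unfolding multiples_of_prime[OF p] using p0 by (subst sum.reindex) (auto intro: inj_onI)
  also have "\<dots> = (\<Sum>x\<in>{0..<p ^ k}. ec (p ^ k) (x * z))"
    using p0 by (simp add: mult.assoc ec_scale)
  also have "\<dots> = (if p ^ k dvd z then of_int (p ^ k) else 0)"
    using p0 by (intro sum_ec) simp
  finally show ?thesis by (simp only: sum_ec[OF M])
qed

lemma bezout_pair:
  fixes a b :: int
  assumes "coprime a b"
  obtains a' b' where "a * a' + b * b' = 1"
  using assms by (metis bezout_int coprime_imp_gcd_eq_1 mult.commute)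

text \<open>With \<open>d = b d1 + a d2\<close> the fraction \<open>d / (a b)\<close> splits into
  \<open>d1 / a + d2 / b\<close>. The pair is recovered from \<open>d\<close> by multiplying with
  the inverse \<open>b'\<close> of \<open>b\<close> modulo \<open>a\<close> and with the inverse
  \<open>a'\<close> of \<open>a\<close> modulo \<open>b\<close>.\<close>

lemma ramanujan_mult:
  assumes a: "a > 0" and b: "b > 0" and ab: "coprime a b"
  shows "ramanujan (a * b) z = ramanujan a z * ramanujan b z"
proof -
  obtain a' b' where bz: "a * a' + b * b' = 1" using ab by (rule bezout_pair)
  have "b * b' - 1 = a * (- a')" "a * a' - 1 = b * (- b')" using bz by (simp_all add: algebra_simps)
  then have b1: "a dvd b * b' - 1" and a1: "b dvd a * a' - 1" by (metis dvd_triv_left)+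
  have "ramanujan a z * ramanujan b z = (\<Sum>(d1, d2)\<in>units_mod a \<times> units_mod b. ec a (d1 * z) * ec b (d2 * z))"
    by (simp add: ramanujan_def sum_product sum.cartesian_product)
  also have "\<dots> = (\<Sum>d\<in>units_mod (a * b). ec (a * b) (d * z))"
  proof (rule sum.reindex_bij_witness[where
        i = "\<lambda>d. (b' * d mod a, a' * d mod b)" and j = "\<lambda>(d1, d2). (b * d1 + a * d2) mod (a * b)"])
    fix dd assume "dd \<in> units_mod a \<times> units_mod b"
    then obtain d1 d2 where dd: "dd = (d1, d2)" and d1: "0 \<le> d1" "d1 < a" "coprime d1 a"
      and d2: "0 \<le> d2" "d2 < b" "coprime d2 b" by (auto simp: units_mod_def)
    define D where "D = (b * d1 + a * d2) mod (a * b)"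
    have dd_ab: "a * b dvd D - (b * d1 + a * d2)" unfolding D_def by (rule dvd_mod_minus)
    then obtain k where "D - (b * d1 + a * d2) = a * b * k" by (elim dvdE)
    then have k: "D = b * d1 + a * d2 + a * b * k" by linarith
    have da: "a dvd D - b * d1" by (simp add: k)
    have db: "b dvd D - a * d2" by (simp add: k)
    have "b' * D - d1 = b' * (D - b * d1) + (b * b' - 1) * d1" by (simp add: algebra_simps)
    then have "a dvd b' * D - d1" using da b1 by simp
    then have e1: "b' * D mod a = d1" using d1 by (intro mod_eqI)
    have "a' * D - d2 = a' * (D - a * d2) + (a * a' - 1) * d2" by (simp add: algebra_simps)
    then have "b dvd a' * D - d2" using db a1 by simp
    then have e2: "a' * D mod b = d2" using d2 by (intro mod_eqI)
    show "(\<lambda>d. (b' * d mod a, a' * d mod b)) ((\<lambda>(d1, d2). (b * d1 + a * d2) mod (a * b)) dd) = dd"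
      using e1 e2 by (simp add: dd D_def [symmetric])
    have D_nn: "0 \<le> D" "D < a * b" using a b by (simp_all add: D_def)
    have "coprime (b * d1) a" using d1 ab by (simp add: coprime_commute)
    then have "coprime D a" using coprime_dvd_diff[OF da] by simp
    moreover have "coprime (a * d2) b" using d2 ab by simp
    then have "coprime D b" using coprime_dvd_diff[OF db] by simp
    ultimately show "(\<lambda>(d1, d2). (b * d1 + a * d2) mod (a * b)) dd \<in> units_mod (a * b)"
      using a b by (simp add: dd units_mod_def D_nn D_def [symmetric])
    have "ec (a * b) (D * z) = ec (a * b) ((b * d1 + a * d2) * z)"
      using dd_ab by (intro ec_dvd_diff) (auto simp flip: left_diff_distrib)
    also have "(b * d1 + a * d2) * z = b * (d1 * z) + a * (d2 * z)" by (simp add: algebra_simps)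
    also have "ec (a * b) \<dots> = ec (b * a) (b * (d1 * z)) * ec (a * b) (a * (d2 * z))"
      by (simp add: ec_add mult.commute)
    also have "\<dots> = ec a (d1 * z) * ec b (d2 * z)"
      using a b by (simp add: ec_scale)
    finally show "ec (a * b) ((\<lambda>(d1, d2). (b * d1 + a * d2) mod (a * b)) dd * z) =
        (case dd of (d1, d2) \<Rightarrow> ec a (d1 * z) * ec b (d2 * z))"
      by (simp add: dd D_def [symmetric])
  next
    fix d assume d: "d \<in> units_mod (a * b)"
    then have d': "0 \<le> d" "d < a * b" "coprime d a" "coprime d b" by (auto simp: units_mod_def)
    have cb: "coprime b' a"
      using coprime_dvd_diff[OF b1] by simp
    have ca: "coprime a' b"
      using coprime_dvd_diff[OF a1] by simp
    show "(b' * d mod a, a' * d mod b) \<in> units_mod a \<times> units_mod b"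
      using a b d' ca cb by (simp add: units_mod_def)
    have "a * b dvd b * (b' * d mod a) + a * (a' * d mod b) - d"
    proof -
      have "b * (b' * d mod a) = b * (b' * d) - b * (a * (b' * d div a))"
        by (simp add: minus_mult_div_eq_mod [symmetric] right_diff_distrib)
      moreover have "a * (a' * d mod b) = a * (a' * d) - a * (b * (a' * d div b))"
        by (simp add: minus_mult_div_eq_mod [symmetric] right_diff_distrib)
      moreover have "b * (b' * d) + a * (a' * d) = d" using bz by (metis add.commute distrib_right mult.assoc mult_1)
      ultimately have "b * (b' * d mod a) + a * (a' * d mod b) - d = (a * b) * (- (b' * d div a) - (a' * d div b))"
        by (simp add: algebra_simps)
      then show ?thesis by simp
    qed
    then have "(b * (b' * d mod a) + a * (a' * d mod b)) mod (a * b) = d"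
      using d' by (intro mod_eqI)
    then show "(\<lambda>(d1, d2). (b * d1 + a * d2) mod (a * b)) (b' * d mod a, a' * d mod b) = d" by simp
  qed
  finally show ?thesis unfolding ramanujan_def by (rule sym)
qed

section \<open>Sums over residue vectors\<close>

lemma reps_modI: "(\<And>i. 0 \<le> X $ i \<and> X $ i < M) \<Longrightarrow> X \<in> reps_mod M"
  by (simp add: reps_mod_def)

lemma reps_modD: "X \<in> reps_mod M \<Longrightarrow> 0 \<le> X $ i" "X \<in> reps_mod M \<Longrightarrow> X $ i < M"
  by (simp_all add: reps_mod_def)

lemma bij_betw_reps_PiE:
  "bij_betw (\<lambda>X::int ^ 'k. vec_nth X) (reps_mod M) (PiE UNIV (\<lambda>_. {0..<M}))"
  by (rule bij_betw_byWitness[where f' = vec_lambda]) (auto simp: reps_mod_def)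

lemma finite_reps_mod [simp]: "finite (reps_mod M :: (int ^ 'k) set)"
  using bij_betw_finite[OF bij_betw_reps_PiE, of M] by (simp add: finite_PiE)

lemma sum_reps_prod:
  fixes f :: "'k::finite \<Rightarrow> int \<Rightarrow> 'c::comm_semiring_1"
  shows "(\<Sum>X\<in>reps_mod M. \<Prod>i\<in>UNIV. f i (X $ i)) = (\<Prod>i\<in>UNIV. \<Sum>x\<in>{0..<M}. f i x)"
proof -
  have "(\<Prod>i\<in>UNIV. \<Sum>x\<in>{0..<M}. f i x) = (\<Sum>g\<in>PiE UNIV (\<lambda>_. {0..<M}). \<Prod>i\<in>UNIV. f i (g i))"
    by (rule prod_sum_PiE) auto
  also have "\<dots> = (\<Sum>X\<in>reps_mod M. \<Prod>i\<in>UNIV. f i (X $ i))"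
    by (rule sum.reindex_bij_betw[OF bij_betw_reps_PiE, symmetric])
  finally show ?thesis by simp
qed

lemma card_reps_mod:
  assumes "M \<ge> 0"
  shows "card (reps_mod M :: (int ^ 'k) set) = nat M ^ CARD('k)"
  using bij_betw_same_card[OF bij_betw_reps_PiE, where M1 = M] assms by (simp add: card_PiE)

lemma reps_mod_1 [simp]: "(reps_mod 1 :: (int ^ 'k) set) = {0}"
proof -
  have "X = 0" if "X \<in> reps_mod 1" for X :: "int ^ 'k"
    using reps_modD[OF that] unfolding vec_eq_iff by (metis int_one_le_iff_zero_less linorder_not_less order_antisym_conv zero_index)
  then show ?thesis by (auto intro!: reps_modI)
qed

definition vdvd :: "int \<Rightarrow> int ^ 'k \<Rightarrow> bool" where
  "vdvd M X \<longleftrightarrow> (\<forall>i. M dvd X $ i)"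

definition vmod :: "int \<Rightarrow> int ^ 'k \<Rightarrow> int ^ 'k" where
  "vmod M X = (\<chi> i. X $ i mod M)"

lemma vdvd_iff: "vdvd M X \<longleftrightarrow> (\<exists>Y. X = M *s Y)"
proof
  assume "vdvd M X"
  then have "X = M *s (\<chi> i. X $ i div M)" by (simp add: vdvd_def vec_eq_iff)
  then show "\<exists>Y. X = M *s Y" by blast
qed (auto simp: vdvd_def)

lemma vdvd_vmod [simp]: "vdvd M (vmod M X - X)"
  by (simp add: vdvd_def vmod_def)

lemma vmod_in_reps [simp]: "M > 0 \<Longrightarrow> vmod M X \<in> reps_mod M"
  by (simp add: vmod_def reps_mod_def)

lemma vmod_eqI: "vdvd M (X - Y) \<Longrightarrow> Y \<in> reps_mod M \<Longrightarrow> vmod M X = Y"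
  by (auto simp: vdvd_def vmod_def reps_mod_def vec_eq_iff intro!: mod_eqI)

lemma vdvd_add: "vdvd M X \<Longrightarrow> vdvd M Y \<Longrightarrow> vdvd M (X + Y)"
  by (simp add: vdvd_def)

lemma vdvd_diff_trans: "vdvd M (X - Y) \<Longrightarrow> vdvd M (Y - Z) \<Longrightarrow> vdvd M (X - Z)"
  using vdvd_add[of M "X - Y" "Y - Z"] by simp

lemma vdvd_0 [simp]: "vdvd M 0"
  by (simp add: vdvd_def)

lemma sum_reps_bij:
  fixes f :: "int ^ 'k \<Rightarrow> 'b::comm_monoid_add" and \<phi> \<psi> :: "int ^ 'k \<Rightarrow> int ^ 'k"
  assumes M: "M > 0" and f: "\<And>x y. vdvd M (x - y) \<Longrightarrow> f x = f y"
    and \<phi>: "\<And>x y. vdvd M (x - y) \<Longrightarrow> vdvd M (\<phi> x - \<phi> y)"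
    and \<psi>: "\<And>x y. vdvd M (x - y) \<Longrightarrow> vdvd M (\<psi> x - \<psi> y)"
    and inv: "\<And>x. vdvd M (\<psi> (\<phi> x) - x)" "\<And>x. vdvd M (\<phi> (\<psi> x) - x)"
  shows "(\<Sum>x\<in>reps_mod M. f (\<phi> x)) = (\<Sum>x\<in>reps_mod M. f x)"
proof (rule sum.reindex_bij_witness[where i = "\<lambda>x. vmod M (\<psi> x)" and j = "\<lambda>x. vmod M (\<phi> x)"])
  fix x :: "int ^ 'k" assume x: "x \<in> reps_mod M"
  have "vdvd M (\<psi> (vmod M (\<phi> x)) - \<psi> (\<phi> x))" by (rule \<psi>) simp
  then have "vdvd M (\<psi> (vmod M (\<phi> x)) - x)" using inv(1) by (rule vdvd_diff_trans)
  then show "vmod M (\<psi> (vmod M (\<phi> x))) = x" using x by (rule vmod_eqI)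
  have "vdvd M (\<phi> (vmod M (\<psi> x)) - \<phi> (\<psi> x))" by (rule \<phi>) simp
  then have "vdvd M (\<phi> (vmod M (\<psi> x)) - x)" using inv(2) by (rule vdvd_diff_trans)
  then show "vmod M (\<phi> (vmod M (\<psi> x))) = x" using x by (rule vmod_eqI)
  show "f (vmod M (\<phi> x)) = f (\<phi> x)" by (rule f) simp
qed (use M in auto)

lemma sum_reps_shift:
  fixes f :: "int ^ 'k \<Rightarrow> 'b::comm_monoid_add"
  assumes "M > 0" "\<And>x y. vdvd M (x - y) \<Longrightarrow> f x = f y"
  shows "(\<Sum>x\<in>reps_mod M. f (x + a)) = (\<Sum>x\<in>reps_mod M. f x)"
  using assms by (intro sum_reps_bij[where \<psi> = "\<lambda>x. x - a"]) auto

lemma sum_reps_unit: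
  fixes f :: "int ^ 'k \<Rightarrow> 'b::comm_monoid_add"
  assumes M: "M > 0" "\<And>x y. vdvd M (x - y) \<Longrightarrow> f x = f y" and a: "coprime a M"
  shows "(\<Sum>x\<in>reps_mod M. f (a *s x)) = (\<Sum>x\<in>reps_mod M. f x)"
proof -
  obtain b where "[a * b = 1] (mod M)" using a cong_solve_coprime_int by blast
  then have b: "M dvd a * b - 1" by (simp add: cong_iff_dvd_diff)
  have *: "M dvd b * (a * x) - x" "M dvd a * (b * x) - x" for x
    using dvd_mult2[OF b, of x] by (simp_all add: algebra_simps)
  show ?thesis
    by (rule sum_reps_bij[where \<psi> = "\<lambda>x. b *s x"])
      (use M * in \<open>auto simp: vdvd_def mult.assoc simp flip: right_diff_distrib\<close>)
qed

text \<open>Chinese remainder theorem in every coordinate: \<open>b * b'\<close> is 1 modulo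
  \<open>a\<close> and 0 modulo \<open>b\<close>, and \<open>a * a'\<close> is the complementary
  idempotent, so their combination glues two residue vectors.\<close>

lemma sum_reps_crt:
  fixes f g :: "int ^ 'k \<Rightarrow> 'b::comm_semiring_1"
  assumes a: "a > 0" and b: "b > 0" and ab: "coprime a b"
    and f: "\<And>x y. vdvd a (x - y) \<Longrightarrow> f x = f y"
    and g: "\<And>x y. vdvd b (x - y) \<Longrightarrow> g x = g y"
  shows "(\<Sum>x\<in>reps_mod (a * b). f x * g x) = (\<Sum>x\<in>reps_mod a. f x) * (\<Sum>x\<in>reps_mod b. g x)"
proof -
  obtain a' b' where bz: "a * a' + b * b' = 1" using ab by (rule bezout_pair)
  have "(\<Sum>x\<in>reps_mod (a * b). f x * g x) = (\<Sum>(x, y)\<in>reps_mod a \<times> reps_mod b. f x * g y)"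
  proof (rule sum.reindex_bij_witness[where
        j = "\<lambda>x. (vmod a x, vmod b x)" and i = "\<lambda>(x, y). vmod (a * b) ((b * b') *s x + (a * a') *s y)"])
    fix x :: "int ^ 'k" assume x: "x \<in> reps_mod (a * b)"
    show "(vmod a x, vmod b x) \<in> reps_mod a \<times> reps_mod b" using a b by simp
    show "(case (vmod a x, vmod b x) of (x, y) \<Rightarrow> f x * g y) = f x * g x"
      using f[of "vmod a x" x] g[of "vmod b x" x] by simp
    have "a * b dvd b * b' * (x $ i mod a) + a * a' * (x $ i mod b) - x $ i" for i
    proof -
      have 1: "x $ i mod a = x $ i - a * (x $ i div a)" "x $ i mod b = x $ i - b * (x $ i div b)"
        by (simp_all add: minus_mult_div_eq_mod)
      have "b * b' * (x $ i mod a) + a * a' * (x $ i mod b) - x $ i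
          = (a * a' + b * b') * x $ i - x $ i - a * b * (b' * (x $ i div a) + a' * (x $ i div b))"
        unfolding 1 by (simp add: algebra_simps)
      then show ?thesis by (simp add: bz)
    qed
    then show "(case (vmod a x, vmod b x) of (x, y) \<Rightarrow> vmod (a * b) ((b * b') *s x + (a * a') *s y)) = x"
      unfolding prod.case by (intro vmod_eqI x) (simp add: vdvd_def vmod_def)
  next
    fix xy :: "(int ^ 'k) \<times> (int ^ 'k)" assume xy: "xy \<in> reps_mod a \<times> reps_mod b"
    obtain x y where xy': "xy = (x, y)" "x \<in> reps_mod a" "y \<in> reps_mod b" using xy by auto
    let ?z = "vmod (a * b) ((b * b') *s x + (a * a') *s y)"
    show "(case xy of (x, y) \<Rightarrow> vmod (a * b) ((b * b') *s x + (a * a') *s y)) \<in> reps_mod (a * b)"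
      using a b by (simp add: xy')
    have *: "a * b dvd ?z $ i - (b * b' * x $ i + a * a' * y $ i)" for i
      by (simp add: vmod_def)
    have "a dvd ?z $ i - x $ i" for i
    proof (rule dvd_diff_trans)
      show "a dvd ?z $ i - (b * b' * x $ i + a * a' * y $ i)" using *[of i] by (rule dvd_mult_left)
      have "b * b' * x $ i + a * a' * y $ i - x $ i = (a * a' + b * b') * x $ i - x $ i + a * (a' * (y $ i - x $ i))"
        by (simp add: algebra_simps)
      then show "a dvd b * b' * x $ i + a * a' * y $ i - x $ i" by (simp add: bz)
    qed
    then have 1: "vmod a ?z = x" using xy' by (intro vmod_eqI) (simp_all add: vdvd_def)
    have "b dvd ?z $ i - y $ i" for i
    proof (rule dvd_diff_trans)
      show "b dvd ?z $ i - (b * b' * x $ i + a * a' * y $ i)" using *[of i] by (rule dvd_mult_right)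
      have "b * b' * x $ i + a * a' * y $ i - y $ i = (a * a' + b * b') * y $ i - y $ i + b * (b' * (x $ i - y $ i))"
        by (simp add: algebra_simps)
      then show "b dvd b * b' * x $ i + a * a' * y $ i - y $ i" by (simp add: bz)
    qed
    then have 2: "vmod b ?z = y" using xy' by (intro vmod_eqI) (simp_all add: vdvd_def)
    show "(vmod a (case xy of (x, y) \<Rightarrow> vmod (a * b) ((b * b') *s x + (a * a') *s y)),
           vmod b (case xy of (x, y) \<Rightarrow> vmod (a * b) ((b * b') *s x + (a * a') *s y))) = xy"
      using 1 2 by (simp add: xy')
  qed
  also have "\<dots> = (\<Sum>x\<in>reps_mod a. f x) * (\<Sum>x\<in>reps_mod b. g x)"
    by (simp add: sum_product sum.cartesian_product)
  finally show ?thesis .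
qed

section \<open>Residues modulo a product written in two digits\<close>

lemma digit_bounds:
  fixes a b x y :: int
  assumes "0 \<le> x" "x < a" "0 \<le> y" "y < b"
  shows "0 \<le> x + a * y" "x + a * y < a * b" "(x + a * y) mod a = x" "(x + a * y) div a = y"
proof -
  have "a * (y + 1) \<le> a * b" using assms by (intro mult_left_mono) auto
  then show "x + a * y < a * b" using assms by (simp add: distrib_left)
  show "0 \<le> x + a * y" using assms by simp
  show "(x + a * y) mod a = x" "(x + a * y) div a = y" using assms by simp_all
qed

lemma digit_bounds':
  fixes a b z :: int
  assumes "0 \<le> z" "z < a * b" "a > 0"
  shows "0 \<le> z div a" "z div a < b"
proof -
  show "0 \<le> z div a" using assms by (simp add: pos_imp_zdiv_nonneg_iff)
  show "z div a < b"
  proof (rule ccontr)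
    assume "\<not> z div a < b"
    then have "a * b \<le> a * (z div a)" using assms by simp
    also have "\<dots> \<le> z" using assms by (metis minus_mod_eq_mult_div pos_mod_sign diff_le_self le_add_same_cancel1 diff_add_cancel)
    finally show False using assms by simp
  qed
qed
  
lemma sum_residues_digits:
  fixes f :: "int \<Rightarrow> 'b::comm_monoid_add"
  assumes "a > 0"
  shows "(\<Sum>z\<in>{0..<a * b}. f z) = (\<Sum>x\<in>{0..<a}. \<Sum>y\<in>{0..<b}. f (x + a * y))"
proof -
  have "(\<Sum>z\<in>{0..<a * b}. f z) = (\<Sum>(x, y)\<in>{0..<a} \<times> {0..<b}. f (x + a * y))"
    by (rule sum.reindex_bij_witness[where j = "\<lambda>z. (z mod a, z div a)" and i = "\<lambda>(x, y). x + a * y"])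
      (use assms in \<open>auto simp: digit_bounds digit_bounds'\<close>)
  then show ?thesis by (simp add: sum.cartesian_product)
qed

lemma sum_residues_lift:
  fixes f :: "int \<Rightarrow> complex"
  assumes a: "a > 0" "b > 0" and f: "\<And>x y. a dvd x - y \<Longrightarrow> f x = f y"
  shows "(\<Sum>z\<in>{0..<a * b}. f z) = of_int b * (\<Sum>z\<in>{0..<a}. f z)"
proof -
  have "f (x + a * y) = f x" for x y by (rule f) simp
  then show ?thesis using a by (simp add: sum_residues_digits sum_distrib_left)
qed

lemma sum_reps_lift:
  fixes f :: "int ^ 'k \<Rightarrow> complex"
  assumes a: "a > 0" and b: "b > 0" and f: "\<And>x y. vdvd a (x - y) \<Longrightarrow> f x = f y"
  shows "(\<Sum>z\<in>reps_mod (a * b). f z) = of_int b ^ CARD('k) * (\<Sum>z\<in>reps_mod a. f z)"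
proof -
  have "(\<Sum>z\<in>reps_mod (a * b). f z) = (\<Sum>(x, y)\<in>reps_mod a \<times> (reps_mod b :: (int ^ 'k) set). f x)"
    by (rule sum.reindex_bij_witness[where j = "\<lambda>z. (vmod a z, \<chi> i. z $ i div a)"
          and i = "\<lambda>(x, y). x + a *s y"])
      (use a in \<open>auto simp: digit_bounds digit_bounds' vmod_def reps_mod_def vec_eq_iff vdvd_def
         intro!: f simp: pos_imp_zdiv_nonneg_iff\<close>)
  also have "\<dots> = (\<Sum>x\<in>reps_mod a. of_nat (card (reps_mod b :: (int ^ 'k) set)) * f x)"
    by (simp add: sum.cartesian_product [symmetric])
  finally show ?thesis using b by (simp add: card_reps_mod sum_distrib_left)
qed

section \<open>Vectors with one additional coordinate\<close>

definition vcons :: "int \<Rightarrow> int ^ 'n::finite \<Rightarrow> int ^ ('n option)" where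
  "vcons x y = (\<chi> i. case i of None \<Rightarrow> x | Some j \<Rightarrow> y $ j)"

definition vtail :: "int ^ ('n::finite option) \<Rightarrow> int ^ 'n" where
  "vtail X = (\<chi> j. X $ Some j)"

lemma vcons_None [simp]: "vcons x y $ None = x" and vcons_Some [simp]: "vcons x y $ Some j = y $ j"
  by (simp_all add: vcons_def)

lemma vtail_nth [simp]: "vtail X $ j = X $ Some j"
  by (simp add: vtail_def)

lemma vtail_vcons [simp]: "vtail (vcons x y) = y"
  by (simp add: vec_eq_iff)

lemma vcons_vtail [simp]: "vcons (X $ None) (vtail X) = X"
  by (simp add: vec_eq_iff vcons_def split: option.split)

lemma vtail_add [simp]: "vtail (X + Y) = vtail X + vtail Y"
  and vtail_smult [simp]: "vtail (c *s X) = c *s vtail X"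
  by (simp_all add: vec_eq_iff)

lemma vcons_in_reps_iff: "vcons x y \<in> reps_mod M \<longleftrightarrow> x \<in> {0..<M} \<and> y \<in> reps_mod M"
  by (auto simp: reps_mod_def vcons_def split: option.splits)

lemma bij_betw_vcons:
  "bij_betw (\<lambda>(x, y). vcons x y) ({0..<M} \<times> reps_mod M) (reps_mod M :: (int ^ ('n::finite option)) set)"
proof (rule bij_betw_byWitness[where f' = "\<lambda>X. (X $ None, vtail X)"])
  show "(\<lambda>X. (X $ None, vtail X)) ` reps_mod M \<subseteq> {0..<M} \<times> (reps_mod M :: (int ^ 'n::finite) set)"
    by (auto simp: reps_mod_def)
qed (auto simp: vcons_in_reps_iff)

lemma sum_reps_vcons:
  "(\<Sum>X\<in>reps_mod M. f X) = (\<Sum>x\<in>{0..<M}. \<Sum>y\<in>(reps_mod M :: (int ^ 'n::finite) set). f (vcons x y))"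
  by (subst sum.reindex_bij_betw[OF bij_betw_vcons, symmetric])
    (simp add: sum.cartesian_product split_beta)

section \<open>Quadratic polynomials\<close>

text \<open>The lattice form is only assumed biadditive, so homogeneity over the integers has to be
  derived once and for all.\<close>

lemma additive_smult:
  fixes f :: "int ^ 'k \<Rightarrow> int"
  assumes f: "\<And>x y. f (x + y) = f x + f y"
  shows "f (c *s x) = c * f x"
proof -
  have 0: "f 0 = 0" using f[of 0 0] by simp
  have neg: "f (- x) = - f x" for x using f[of x "- x"] 0 by simp
  have nat: "f (int n *s x) = int n * f x" for n
    by (induction n) (simp_all add: 0 f vector_sadd_rdistrib algebra_simps)
  show ?thesis
  proof (cases "c \<ge> 0")
    case True
    then show ?thesis using nat[of "nat c"] by simp
  next
    case False
    then have "c *s x = - (int (nat (- c)) *s x)" by (simp add: vec_eq_iff)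
    then show ?thesis using False nat[of "nat (- c)"] neg by simp
  qed
qed

lemma additive_basis:
  fixes f :: "int ^ 'k \<Rightarrow> int"
  assumes f: "\<And>x y. f (x + y) = f x + f y"
  shows "f x = (\<Sum>i\<in>UNIV. x $ i * f (axis i 1))"
proof -
  have 0: "f 0 = 0" using f[of 0 0] by simp
  have s: "f (sum g A) = (\<Sum>i\<in>A. f (g i))" if "finite A" for g and A :: "'k set"
    using that by (induction A rule: finite_induct) (simp_all add: f 0)
  have "f x = f (\<Sum>i\<in>UNIV. x $ i *s axis i 1)" by (simp only: basis_expansion)
  also have "\<dots> = (\<Sum>i\<in>UNIV. x $ i * f (axis i 1))"
    by (simp add: s additive_smult[of f, OF f])
  finally show ?thesis .
qed

text \<open>\<open>Q\<close> is a parameter of its own, tied to the polar form by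
  \<open>2 * Q X = Bf X X\<close>, so that no halving occurs and the prime 2 is treated like the
  others.\<close>

locale quad_poly =
  fixes Bf :: "int ^ 'k \<Rightarrow> int ^ 'k \<Rightarrow> int" and Q b :: "int ^ 'k \<Rightarrow> int" and n0 :: int
  assumes Bf_add_left: "Bf (X + Y) Z = Bf X Z + Bf Y Z"
    and Bf_sym: "Bf X Y = Bf Y X"
    and Bf_Q: "2 * Q X = Bf X X"
    and b_add: "b (X + Y) = b X + b Y"
begin

definition F :: "int ^ 'k \<Rightarrow> int" where
  "F X = Q X + b X + n0"

text \<open>The derivative of \<open>F\<close> at \<open>X\<close> in the direction
  \<open>H\<close>. A critical point modulo \<open>M\<close> is a point at which it is divisible by
  \<open>M\<close> in all directions.\<close>

definition grad :: "int ^ 'k \<Rightarrow> int ^ 'k \<Rightarrow> int" where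
  "grad X H = Bf X H + b H"

text \<open>The exponential sum of the overview with the sum over the units \<open>d\<close> already
  carried out; \<open>T_altdef\<close> gives the order of summation with \<open>d\<close>
  outside.\<close>

definition T :: "int \<Rightarrow> complex" where
  "T C = (\<Sum>X\<in>reps_mod C. ramanujan C (F X))"

definition N :: "int \<Rightarrow> nat" where
  "N C = card {X\<in>reps_mod C. C dvd F X}"

lemma Bf_add_right: "Bf Z (X + Y) = Bf Z X + Bf Z Y"
  using Bf_add_left Bf_sym by metis

lemma Bf_smult_left: "Bf (c *s X) Y = c * Bf X Y"
  using additive_smult[of "\<lambda>X. Bf X Y"] Bf_add_left by simp

lemma Bf_smult_right: "Bf Y (c *s X) = c * Bf Y X"
  using Bf_smult_left Bf_sym by metis

lemma b_smult: "b (c *s X) = c * b X"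
  using b_add by (rule additive_smult)

lemma Q_add: "Q (X + Y) = Q X + Q Y + Bf X Y"
proof -
  have "2 * Q (X + Y) = 2 * (Q X + Q Y + Bf X Y)"
    unfolding Bf_Q Bf_add_left Bf_add_right distrib_left using Bf_sym[of X Y] by simp
  then show ?thesis by simp
qed

lemma Q_smult: "Q (c *s X) = c\<^sup>2 * Q X"
proof -
  have "2 * Q (c *s X) = 2 * (c\<^sup>2 * Q X)"
    unfolding Bf_Q Bf_smult_left Bf_smult_right
    using Bf_Q[of X] by (simp add: power2_eq_square mult_ac)
  then show ?thesis by simp
qed

lemma F_add: "F (X + H) = F X + grad X H + Q H"
  by (simp add: F_def grad_def Q_add b_add)

lemma grad_add: "grad X (H + K) = grad X H + grad X K"
  by (simp add: grad_def Bf_add_right b_add)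

lemma grad_smult: "grad X (c *s H) = c * grad X H"
  by (simp add: grad_def Bf_smult_right b_smult algebra_simps)

lemma F_cong:
  assumes "vdvd C (X - Y)"
  shows "C dvd F X - F Y"
proof -
  obtain H where "X - Y = C *s H" using assms by (auto simp: vdvd_iff)
  then have "X = Y + C *s H" by (simp add: algebra_simps)
  then show ?thesis by (simp add: F_add grad_smult Q_smult power2_eq_square)
qed

lemma ramanujan_F_cong: "a dvd C \<Longrightarrow> vdvd C (X - Y) \<Longrightarrow> ramanujan a (F X) = ramanujan a (F Y)"
  by (intro ramanujan_cong dvd_trans[OF _ F_cong])

lemma ec_F_cong: "vdvd C (X - Y) \<Longrightarrow> ec C (d * F X) = ec C (d * F Y)"
  by (intro ec_dvd_diff) (simp add: right_diff_distrib [symmetric] F_cong)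

lemma T_1 [simp]: "T 1 = 1"
  by (simp add: T_def)

lemma T_altdef: "T C = (\<Sum>d\<in>units_mod C. \<Sum>X\<in>reps_mod C. ec C (d * F X))"
  unfolding T_def ramanujan_def by (rule sum.swap)

lemma T_mult:
  assumes "a > 0" "b' > 0" "coprime a b'"
  shows "T (a * b') = T a * T b'"
proof -
  have "T (a * b') = (\<Sum>X\<in>reps_mod (a * b'). ramanujan a (F X) * ramanujan b' (F X))"
    using assms by (simp add: T_def ramanujan_mult)
  also have "\<dots> = T a * T b'"
    unfolding T_def by (rule sum_reps_crt) (use assms ramanujan_F_cong[OF dvd_refl] in auto)
  finally show ?thesis .
qed

text \<open>Explains the difference of counting functions in clause (2) of the definition of \<xi>:
  with \<open>g + 1\<close> variables the right-hand side is \<open>p ^ Suc j\<close> times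
  \<open>N (p ^ Suc j) - p ^ g * N (p ^ j)\<close>.\<close>

lemma T_prime_power:
  fixes p :: int
  assumes p: "prime p"
  shows "T (p ^ Suc j) = of_int (p ^ Suc j) * (of_nat (N (p ^ Suc j)))
    - of_int (p ^ j) * of_int p ^ CARD('k) * of_nat (N (p ^ j))"
proof -
  have p0: "p > 0" using p by (simp add: prime_gt_0_int)
  have *: "(\<Sum>X\<in>reps_mod (p ^ i). if p ^ i dvd F X then of_int (p ^ i) else 0)
      = of_int (p ^ i) * (of_nat (N (p ^ i)) :: complex)" for i
    unfolding N_def by (subst sum.inter_filter [symmetric]) simp_all
  have "T (p ^ Suc j) = (\<Sum>X\<in>reps_mod (p ^ Suc j). if p ^ Suc j dvd F X then of_int (p ^ Suc j) else 0)
      - (\<Sum>X\<in>reps_mod (p ^ Suc j). if p ^ j dvd F X then of_int (p ^ j) else 0)"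
    unfolding T_def ramanujan_prime_power[OF p] by (rule sum_subtractf)
  also have "(\<Sum>X\<in>reps_mod (p ^ Suc j). if p ^ j dvd F X then of_int (p ^ j) else 0)
      = (\<Sum>X\<in>reps_mod (p ^ j * p). if p ^ j dvd F X then complex_of_int (p ^ j) else 0)"
    by (simp add: mult.commute)
  \<comment> \<open>The condition depends on \<open>X\<close> modulo \<open>p ^ j\<close> only, and
    each class has \<open>p ^ CARD('k)\<close> lifts.\<close>
  also have "\<dots> = of_int p ^ CARD('k) * (\<Sum>X\<in>reps_mod (p ^ j). if p ^ j dvd F X then of_int (p ^ j) else 0)"
  proof (rule sum_reps_lift)
    fix X Y :: "int ^ 'k" assume "vdvd (p ^ j) (X - Y)"
    then have "p ^ j dvd F X - F Y" by (rule F_cong)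
    then have "p ^ j dvd F X \<longleftrightarrow> p ^ j dvd F Y" by (metis dvd_diff_commute dvd_diff_right_iff dvd_diff_left_iff)
    then show "(if p ^ j dvd F X then complex_of_int (p ^ j) else 0) = (if p ^ j dvd F Y then of_int (p ^ j) else 0)"
      by simp
  qed (use p0 in auto)
  finally show ?thesis unfolding * by simp
qed

lemma sum_linear_character:
  assumes M: "M > 0" and h: "\<And>X Y. h (X + Y) = h X + h Y"
  shows "(\<Sum>H\<in>reps_mod M. ec M (h (H :: int ^ 'k))) =
    (if \<forall>H. M dvd h H then of_int M ^ CARD('k) else 0)"
proof (cases "\<forall>H. M dvd h H")
  case True
  then show ?thesis using M by (simp add: ec_eq_1_if_dvd card_reps_mod)
next
  case False
  then obtain K where K: "\<not> M dvd h K" by auto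
  let ?S = "\<Sum>H\<in>reps_mod M. ec M (h H)"
  have "?S = (\<Sum>H\<in>reps_mod M. ec M (h (H + K)))"
  proof (rule sum_reps_shift[symmetric])
    fix X Y :: "int ^ 'k" assume "vdvd M (X - Y)"
    then obtain Z where "X - Y = M *s Z" by (auto simp: vdvd_iff)
    then have "X = Y + M *s Z" by (simp add: algebra_simps)
    then have "h X - h Y = M * h Z" using additive_smult[of h, OF h] by (simp add: h)
    then show "ec M (h X) = ec M (h Y)" by (intro ec_dvd_diff) simp
  qed (fact M)
  also have "\<dots> = ec M (h K) * ?S"
    by (simp add: h ec_add sum_distrib_left mult.commute)
  finally have "(1 - ec M (h K)) * ?S = 0" by (simp add: algebra_simps)
  moreover have "ec M (h K) \<noteq> 1" using K M by (simp add: ec_eq_1_iff)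
  ultimately have "?S = 0" by simp
  then show ?thesis using False by (simp only: if_False)
qed

text \<open>Stationary phase: a shift of \<open>X\<close> by \<open>p ^ \<mu> *s H\<close> changes
  \<open>F\<close> linearly modulo \<open>p ^ j\<close>. Averaging over \<open>H\<close> kills every
  \<open>X\<close> whose derivative is not divisible by the complementary power of \<open>p\<close>,
  so a nonzero sum must have a surviving \<open>X\<close>.\<close>

lemma T_prime_power_nonzeroD:
  fixes p :: int
  assumes p: "prime p" and nz: "T (p ^ j) \<noteq> 0" and j: "j \<ge> 1"
  obtains X where "\<And>H. p ^ (j div 2) dvd grad X H" "p ^ (j - 1) dvd F X"
proof -
  have p0: "p > 0" using p by (simp add: prime_gt_0_int)
  \<comment> \<open>\<open>\<mu>\<close> is \<open>j / 2\<close> rounded up, so that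
    \<open>2 * \<mu> \<ge> j\<close> removes the quadratic term; \<open>f\<close> is
    \<open>j / 2\<close> rounded down, and \<open>\<mu> + f = j\<close>.\<close>
  define f \<mu> M where "f = j div 2" and "\<mu> = j - j div 2" and "M = p ^ j"
  have M: "M > 0" and Mdef: "M = p ^ \<mu> * p ^ f" using p0 by (simp_all add: M_def \<mu>_def f_def flip: power_add)
  have crit: "(\<Sum>H\<in>reps_mod M. ec M (d * (p ^ \<mu> * grad X H))) =
      (if \<forall>H. p ^ f dvd grad X H then of_int M ^ CARD('k) else 0)" if "coprime d M" for d X
  proof -
    have "M dvd d * (p ^ \<mu> * grad X H) \<longleftrightarrow> p ^ f dvd grad X H" for H
    proof -
      have "M dvd d * (p ^ \<mu> * grad X H) \<longleftrightarrow> M dvd p ^ \<mu> * grad X H"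
        using that by (simp add: coprime_dvd_mult_right_iff coprime_commute)
      also have "\<dots> \<longleftrightarrow> p ^ f dvd grad X H" using p0 by (simp add: Mdef)
      finally show ?thesis .
    qed
    then show ?thesis
      using sum_linear_character[OF M, of "\<lambda>H. d * (p ^ \<mu> * grad X H)"]
      by (simp add: grad_add distrib_left)
  qed
  have shift: "M dvd F (X + p ^ \<mu> *s H) - (F X + p ^ \<mu> * grad X H)" for X H
  proof -
    have "M dvd p ^ (\<mu> * 2)" unfolding M_def by (rule le_imp_power_dvd) (simp add: \<mu>_def)
    then show ?thesis by (simp add: F_add grad_smult Q_smult power_mult)
  qed
  have inner: "(\<Sum>H\<in>reps_mod M. ramanujan M (F (X + p ^ \<mu> *s H))) =
      of_int M ^ CARD('k) * (if \<forall>H. p ^ f dvd grad X H then ramanujan M (F X) else 0)" for X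
  proof -
    have "(\<Sum>H\<in>reps_mod M. ramanujan M (F (X + p ^ \<mu> *s H)))
      = (\<Sum>H\<in>reps_mod M. \<Sum>d\<in>units_mod M. ec M (d * F X) * ec M (d * (p ^ \<mu> * grad X H)))"
    proof (rule sum.cong[OF refl])
      fix H
      have "ramanujan M (F (X + p ^ \<mu> *s H)) = ramanujan M (F X + p ^ \<mu> * grad X H)"
        using shift by (rule ramanujan_cong)
      then show "ramanujan M (F (X + p ^ \<mu> *s H)) =
          (\<Sum>d\<in>units_mod M. ec M (d * F X) * ec M (d * (p ^ \<mu> * grad X H)))"
        by (simp add: ramanujan_def distrib_left ec_add)
    qed
    also have "\<dots> = (\<Sum>d\<in>units_mod M. ec M (d * F X) * (\<Sum>H\<in>reps_mod M. ec M (d * (p ^ \<mu> * grad X H))))"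
      by (subst sum.swap) (simp add: sum_distrib_left)
    also have "\<dots> = (\<Sum>d\<in>units_mod M. ec M (d * F X) * (if \<forall>H. p ^ f dvd grad X H then of_int M ^ CARD('k) else 0))"
      by (intro sum.cong refl) (simp add: crit units_mod_def)
    also have "\<dots> = of_int M ^ CARD('k) * (if \<forall>H. p ^ f dvd grad X H then ramanujan M (F X) else 0)"
      by (simp add: ramanujan_def sum_distrib_left mult.commute)
    finally show ?thesis .
  qed
  \<comment> \<open>Every shift reproduces the same complete sum, so the sum over all
    \<open>H\<close> is a positive multiple of \<open>T M\<close>.\<close>
  have "of_nat (card (reps_mod M :: (int ^ 'k) set)) * T M
      = (\<Sum>H\<in>(reps_mod M :: (int ^ 'k) set). \<Sum>X\<in>reps_mod M. ramanujan M (F (X + p ^ \<mu> *s H)))"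
    unfolding T_def using sum_reps_shift[OF M, of "\<lambda>X. ramanujan M (F X)"] ramanujan_F_cong[OF dvd_refl]
    by simp
  also have "\<dots> = (\<Sum>X\<in>reps_mod M. of_int M ^ CARD('k) * (if \<forall>H. p ^ f dvd grad X H then ramanujan M (F X) else 0))"
    by (subst sum.swap) (simp only: inner)
  finally have "(\<Sum>X\<in>reps_mod M. of_int M ^ CARD('k) * (if \<forall>H. p ^ f dvd grad X H then ramanujan M (F X) else 0)) \<noteq> 0"
    using nz M by (metis M_def card_reps_mod less_le mult_eq_0_iff of_int_0_eq_iff of_nat_0_less_iff of_nat_eq_0_iff of_nat_power of_int_of_nat_eq power_not_zero nat_eq_iff less_le_not_le)
  then obtain X where X: "(if \<forall>H. p ^ f dvd grad X H then ramanujan M (F X) else 0) \<noteq> 0"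
    by (rule sum.not_neutral_contains_not_neutral) auto
  then have 1: "\<forall>H. p ^ f dvd grad X H" and 2: "ramanujan M (F X) \<noteq> 0" by (auto split: if_splits)
  obtain i where i: "j = Suc i" using j by (cases j) auto
  \<comment> \<open>A Ramanujan sum to the modulus \<open>p ^ Suc i\<close> can be nonzero only at
    multiples of \<open>p ^ i\<close>; hence the loss of one power in the conclusion.\<close>
  have "p ^ i dvd F X"
  proof (rule ccontr)
    assume *: "\<not> p ^ i dvd F X"
    then have "\<not> p ^ Suc i dvd F X" by (metis dvd_mult_right power_Suc)
    then show False using 2 * unfolding M_def i ramanujan_prime_power[OF p] by simp
  qed
  then show ?thesis using that[of X] 1 by (simp add: f_def i)
qed

text \<open>Weyl differencing.\<close>

lemma norm_quadratic_sum_bound: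
  assumes M: "M > 0" and d: "coprime d M"
  shows "(norm (\<Sum>X\<in>reps_mod M. ec M (d * F X)))\<^sup>2
    \<le> real_of_int M ^ CARD('k) * real (card {H\<in>reps_mod M. \<forall>X. M dvd Bf X H})"
proof -
  let ?f = "\<lambda>X. ec M (d * F X)" and ?S = "\<Sum>X\<in>reps_mod M. ec M (d * F X)"
  have "cnj ?S * ?S = (\<Sum>X\<in>reps_mod M. cnj (?f X) * (\<Sum>Y\<in>reps_mod M. ?f Y))"
    by (simp add: sum_distrib_right)
  also have "\<dots> = (\<Sum>X\<in>reps_mod M. cnj (?f X) * (\<Sum>H\<in>reps_mod M. ?f (H + X)))"
    using sum_reps_shift[OF M, of ?f] ec_F_cong by simp
  also have "\<dots> = (\<Sum>X\<in>reps_mod M. \<Sum>H\<in>reps_mod M. ec M (d * (Q H + b H)) * ec M (d * Bf X H))"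
  proof (simp only: sum_distrib_left, intro sum.cong refl)
    fix X H :: "int ^ 'k"
    have "cnj (?f X) * ?f (H + X) = ec M (d * F (X + H) - d * F X)"
      by (simp add: ec_diff mult.commute add.commute)
    also have "d * F (X + H) - d * F X = d * (Q H + b H) + d * Bf X H"
      unfolding F_add grad_def by (simp add: algebra_simps)
    finally show "cnj (?f X) * ?f (H + X) = ec M (d * (Q H + b H)) * ec M (d * Bf X H)"
      by (simp add: ec_add)
  qed
  \<comment> \<open>For a fixed difference \<open>H\<close> the sum over \<open>X\<close> is a
    complete character sum, nonzero only if \<open>H\<close> lies in the kernel of the form modulo
    \<open>M\<close>.\<close>
  also have "\<dots> = (\<Sum>H\<in>reps_mod M. ec M (d * (Q H + b H)) * (\<Sum>X\<in>reps_mod M. ec M (d * Bf X H)))"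
    by (subst sum.swap) (simp add: sum_distrib_left)
  also have "\<dots> = (\<Sum>H\<in>reps_mod M. ec M (d * (Q H + b H)) * (if \<forall>X. M dvd Bf X H then of_int M ^ CARD('k) else 0))"
  proof (intro sum.cong refl arg_cong2[of _ _ _ _ "(*)"])
    fix H
    have "M dvd d * Bf X H \<longleftrightarrow> M dvd Bf X H" for X
      using d by (simp add: coprime_dvd_mult_right_iff coprime_commute)
    then show "(\<Sum>X\<in>reps_mod M. ec M (d * Bf X H)) = (if \<forall>X. M dvd Bf X H then of_int M ^ CARD('k) else 0)"
      using sum_linear_character[OF M, of "\<lambda>X. d * Bf X H"] by (simp add: Bf_add_left distrib_left)
  qed
  finally have eq: "cnj ?S * ?S = (\<Sum>H\<in>reps_mod M. ec M (d * (Q H + b H)) * (if \<forall>X. M dvd Bf X H then of_int M ^ CARD('k) else 0))" .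
  have "(norm ?S)\<^sup>2 = norm (cnj ?S * ?S)" by (simp add: norm_mult power2_eq_square del: cnj_sum)
  also have "\<dots> \<le> (\<Sum>H\<in>reps_mod M. norm (ec M (d * (Q H + b H)) * (if \<forall>X. M dvd Bf X H then of_int M ^ CARD('k) else 0)))"
    unfolding eq by (rule norm_sum)
  also have "\<dots> = (\<Sum>H\<in>reps_mod M. if \<forall>X. M dvd Bf X H then of_int M ^ CARD('k) else 0)"
    using M by (intro sum.cong refl) (simp add: norm_mult norm_power)
  also have "\<dots> = real_of_int M ^ CARD('k) * real (card {H\<in>reps_mod M. \<forall>X. M dvd Bf X H})"
    by (subst sum.inter_filter [symmetric]) simp_all
  finally show ?thesis .
qed

text \<open>Translation by a critical point removes the linear part; only the critical value and the
  homogeneous Gauss sum remain.\<close>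

lemma sum_critical_point:
  assumes M: "M > 0" and X0: "\<And>H. M dvd grad X0 H"
  shows "(\<Sum>X\<in>reps_mod M. ec M (d * F X)) = ec M (d * F X0) * (\<Sum>X\<in>reps_mod M. ec M (d * Q X))"
proof -
  have "(\<Sum>X\<in>reps_mod M. ec M (d * F X)) = (\<Sum>X\<in>reps_mod M. ec M (d * F (X + X0)))"
    using sum_reps_shift[OF M, of "\<lambda>X. ec M (d * F X)"] ec_F_cong by simp
  also have "\<dots> = (\<Sum>X\<in>reps_mod M. ec M (d * F X0 + d * Q X))"
  proof (intro sum.cong refl ec_dvd_diff)
    fix X
    have "d * F (X + X0) - (d * F X0 + d * Q X) = d * grad X0 X"
      using F_add[of X0 X] by (simp add: algebra_simps)
    then show "M dvd d * F (X + X0) - (d * F X0 + d * Q X)" using X0 by simp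
  qed
  finally show ?thesis by (simp add: ec_add sum_distrib_left)
qed

end

section \<open>The Legendre symbol and quadratic reciprocity\<close>

locale odd_prime =
  fixes p :: int
  assumes prime_p: "prime p" and odd_p: "odd p"
begin

lemma p_gt_2: "p > 2"
  using prime_p odd_p prime_ge_2_int[of p] by (cases "p = 2") auto

lemma p_gt_0: "p > 0"
  using p_gt_2 by simp

lemma not_dvd_1 [simp]: "\<not> p dvd 1"
  using p_gt_2 zdvd_not_zless[of 1 p] by auto

lemma not_dvd_2 [simp]: "\<not> p dvd 2"
  using p_gt_2 zdvd_not_zless[of 2 p] by auto

lemma abs_p_neq_1 [simp]: "\<bar>p\<bar> \<noteq> 1"
  using p_gt_2 by simp

lemma dvd_mult_iff: "p dvd a * b \<longleftrightarrow> p dvd a \<or> p dvd b"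
  using prime_p by (rule prime_dvd_mult_iff)

lemma coprime_iff: "coprime a p \<longleftrightarrow> \<not> p dvd a"
  by (rule coprime_prime_right_iff[OF prime_p])

lemma Legendre_values: "Legendre a p \<in> {-1, 0, 1}"
  by (auto simp: Legendre_def)

lemma Legendre_eq_0_iff: "Legendre a p = 0 \<longleftrightarrow> p dvd a"
  by (auto simp: Legendre_def cong_0_iff)

lemma Legendre_unit: "\<not> p dvd a \<Longrightarrow> Legendre a p = 1 \<or> Legendre a p = -1"
  using Legendre_values[of a] Legendre_eq_0_iff[of a] by auto

lemma Legendre_cong:
  assumes "p dvd a - b"
  shows "Legendre a p = Legendre b p"
proof -
  have ab: "[a = b] (mod p)" using assms by (simp add: cong_iff_dvd_diff)
  then have "[a = 0] (mod p) \<longleftrightarrow> [b = 0] (mod p)" by (metis cong_sym cong_trans)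
  moreover have "QuadRes p a \<longleftrightarrow> QuadRes p b"
    unfolding QuadRes_def using ab by (metis cong_sym cong_trans)
  ultimately show ?thesis by (simp add: Legendre_def)
qed

lemma Legendre_euler: "[Legendre a p = a ^ nat ((p - 1) div 2)] (mod p)"
proof -
  have "[Legendre a (int (nat p)) = a ^ ((nat p - 1) div 2)] (mod int (nat p))"
    using prime_p p_gt_2 by (intro euler_criterion) auto
  moreover have "(nat p - 1) div 2 = nat ((p - 1) div 2)" using p_gt_2 by (simp add: nat_div_distrib nat_diff_distrib)
  ultimately show ?thesis using p_gt_2 by simp
qed

text \<open>Lifts congruences obtained from Euler's criterion to equalities: distinct values in -1,
  0, 1 differ by at most 2, which is less than \<open>p\<close>.\<close>

lemma sign_eqI:
  assumes "x \<in> {-1, 0, 1}" "y \<in> {-1, 0, 1::int}" "[x = y] (mod p)"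
  shows "x = y"
proof (rule ccontr)
  assume "x \<noteq> y"
  moreover have "\<bar>x - y\<bar> \<le> 2" using assms(1,2) by auto
  moreover have "p dvd \<bar>x - y\<bar>" using assms(3) by (simp add: cong_iff_dvd_diff)
  ultimately show False using p_gt_2 zdvd_imp_le[of p "\<bar>x - y\<bar>"] by simp
qed

lemma Legendre_mult: "Legendre (a * b) p = Legendre a p * Legendre b p"
proof (rule sign_eqI)
  have "[Legendre a p * Legendre b p = a ^ nat ((p - 1) div 2) * b ^ nat ((p - 1) div 2)] (mod p)"
    by (intro cong_mult Legendre_euler)
  then show "[Legendre (a * b) p = Legendre a p * Legendre b p] (mod p)"
    using Legendre_euler[of "a * b"] by (metis cong_sym cong_trans power_mult_distrib)
  show "Legendre a p * Legendre b p \<in> {-1, 0, 1}"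
    using Legendre_values[of a] Legendre_values[of b] by auto
qed (rule Legendre_values)

lemma Legendre_1 [simp]: "Legendre 1 p = 1"
proof -
  have "QuadRes p 1" unfolding QuadRes_def by (rule exI[of _ 1]) simp
  then show ?thesis by (simp add: Legendre_def cong_0_iff)
qed

lemma Legendre_power: "Legendre (a ^ k) p = Legendre a p ^ k"
  by (induction k) (simp_all add: Legendre_mult)

lemma Legendre_prod: "Legendre (\<Prod>i\<in>A. f i) p = (\<Prod>i\<in>A. Legendre (f i) p)"
  by (induction A rule: infinite_finite_induct) (simp_all add: Legendre_mult)

lemma Legendre_square: "\<not> p dvd a \<Longrightarrow> Legendre a p * Legendre a p = 1"
  using Legendre_unit[of a] by auto

lemma Legendre_minus_1: "Legendre (- 1) p = (- 1) ^ nat ((p - 1) div 2)"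
proof (rule sign_eqI)
  show "(- 1) ^ nat ((p - 1) div 2) \<in> {-1, 0, 1::int}"
    by (cases "even (nat ((p - 1) div 2))") auto
qed (rule Legendre_values, rule Legendre_euler)

lemma Legendre_minus_1_mod_4: "Legendre (- 1) p = (if p mod 4 = 1 then 1 else - 1)"
proof -
  have "even (nat ((p - 1) div 2)) \<longleftrightarrow> p mod 4 = 1"
    using p_gt_2 odd_p by (simp add: even_nat_iff) presburger
  then show ?thesis by (simp add: Legendre_minus_1)
qed

lemma Legendre_minus_1_Legendre: "Legendre (Legendre (- 1) p) p = Legendre (- 1) p"
  by (simp add: Legendre_minus_1_mod_4)

text \<open>Gauss's lemma. With \<open>h = (p - 1) / 2\<close>, the doubles \<open>2 x\<close> with
  \<open>0 < x \<le> h\<close> are already reduced, and those exceeding \<open>h\<close> are the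
  ones with \<open>x > h div 2\<close>. The parity of \<open>h - h div 2\<close> depends on
  \<open>p\<close> modulo 8.\<close>

lemma Legendre_2: "Legendre 2 p = (if p mod 8 = 1 \<or> p mod 8 = 7 then 1 else - 1)"
proof -
  interpret G: GAUSS "nat p" 2
    using prime_p p_gt_2 by unfold_locales (auto simp: cong_0_iff)
  define h where "h = (p - 1) div 2"
  have h: "p = 2 * h + 1" using odd_p by (simp add: h_def)
  have np: "int (nat p) = p" using p_gt_2 by simp
  have "G.C = (\<lambda>x. 2 * x) ` {0<..h}"
  proof -
    have "G.C = (\<lambda>x. (2 * x) mod p) ` {0<..h}"
      unfolding G.C_def G.B_def G.A_def np by (simp add: image_image h_def mult.commute)
    also have "\<dots> = (\<lambda>x. 2 * x) ` {0<..h}"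
      by (intro image_cong refl mod_pos_pos_trivial) (use h in auto)
    finally show ?thesis .
  qed
  then have "G.E = (\<lambda>x. 2 * x) ` {h div 2<..h}"
    unfolding G.E_def np using p_gt_2 by (auto simp: h_def [symmetric] image_iff)
  then have "card G.E = nat (h - h div 2)" by (simp add: card_image inj_on_def)
  then have "Legendre 2 p = (- 1) ^ nat (h - h div 2)" using G.gauss_lemma np by simp
  moreover have "even (nat (h - h div 2)) \<longleftrightarrow> p mod 8 = 1 \<or> p mod 8 = 7"
    using p_gt_2 h by (simp add: even_nat_iff) presburger
  ultimately show ?thesis by simp
qed

text \<open>The signed prime that is 1 modulo 4, which absorbs the sign of quadratic
  reciprocity.\<close>

definition p_star :: int where "p_star = Legendre (- 1) p * p"

text \<open>Quadratic reciprocity with the sign absorbed, extended to \<open>q = 2\<close> by the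
  supplementary law and to \<open>q = p\<close>, where both symbols vanish.\<close>

lemma p_star_reciprocity:
  assumes q: "prime q" "q > 0"
  shows "kronecker_prime p_star q = Legendre q p"
proof (cases "q = p")
  case True
  then show ?thesis using odd_p
    by (simp add: kronecker_prime_def p_star_def Legendre_eq_0_iff Legendre_def cong_0_iff)
next
  case qp: False
  show ?thesis
  proof (cases "q = 2")
    case True
    have "(- p) mod 8 = (if p mod 8 = 0 then 0 else 8 - p mod 8)" by (rule zmod_zminus1_eq_if)
    then have "p_star mod 8 = 1 \<or> p_star mod 8 = 7 \<longleftrightarrow> p mod 8 = 1 \<or> p mod 8 = 7"
      by (auto simp: p_star_def Legendre_minus_1_mod_4 split: if_splits)
    moreover have "odd p_star" using odd_p by (simp add: p_star_def Legendre_minus_1_mod_4)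
    ultimately show ?thesis using True by (simp add: kronecker_prime_def Legendre_2)
  next
    case False
    have oq: "odd q" using q False prime_odd_int[of q] prime_ge_2_int[of q] by force
    interpret Q: odd_prime q using q oq by unfold_locales
    let ?h = "nat ((p - 1) div 2)" and ?k = "nat ((q - 1) div 2)"
    have rec: "Legendre p q * Legendre q p = (- 1) ^ (?h * ?k)"
    proof -
      have "Legendre p q * Legendre q p = (- 1) ^ nat ((p - 1) div 2 * ((q - 1) div 2))"
        using prime_p q p_gt_2 Q.p_gt_2 qp by (intro Quadratic_Reciprocity_int) auto
      then show ?thesis using p_gt_2 Q.p_gt_2 by (simp add: nat_mult_distrib)
    qed
    have npq: "\<not> q dvd p" using primes_dvd_imp_eq[of q p] q prime_p qp by auto
    have nqp: "\<not> p dvd q" using primes_dvd_imp_eq[of p q] q prime_p qp by auto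
    have "Legendre p_star q * Legendre q p = 1"
    proof (cases "p mod 4 = 1")
      case True
      then have "even ?h" using p_gt_2 by (simp add: even_nat_iff) presburger
      then show ?thesis using rec True by (simp add: p_star_def Legendre_minus_1_mod_4)
    next
      case False
      then have "odd ?h" using p_gt_2 odd_p by (simp add: even_nat_iff) presburger
      have "Legendre p_star q = Legendre (- 1) q * Legendre p q"
        using False Q.Legendre_mult[of "- 1" p] by (simp add: p_star_def Legendre_minus_1_mod_4)
      then have "Legendre p_star q * Legendre q p = (- 1) ^ ?k * (- 1) ^ (?h * ?k)"
        using rec by (simp add: Q.Legendre_minus_1)
      also have "\<dots> = ((- 1) ^ Suc ?h) ^ ?k" by (simp only: power_mult power_mult_distrib power_Suc)
      also have "\<dots> = 1" using \<open>odd ?h\<close> by simp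
      finally show ?thesis .
    qed
    then have "Legendre p_star q = Legendre q p" using Legendre_unit[OF nqp] by auto
    then show ?thesis using False by (simp add: kronecker_prime_def)
  qed
qed

text \<open>Reciprocity at each prime factor of \<open>z\<close>. For negative \<open>z\<close> the
  extra sign in \<open>kronecker\<close> agrees with \<open>(-1 / p)\<close>, because
  \<open>p_star < 0\<close> exactly when that symbol is -1. The lemma turns the second symbol in
  clause (1) of \<xi> into the Legendre symbol that Gauss sums produce.\<close>

lemma kronecker_p_star: "kronecker p_star z = Legendre z p"
proof (cases "z = 0")
  case True
  have "\<bar>p_star\<bar> = p" using p_gt_2 by (simp add: p_star_def Legendre_minus_1_mod_4)
  then show ?thesis using True p_gt_2 by (simp add: kronecker_def Legendre_def)
next
  case False
  have "kronecker p_star z = (if z < 0 \<and> p_star < 0 then - 1 else 1) *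
      (\<Prod>q\<in>prime_factors z. Legendre q p ^ multiplicity q z)"
  proof -
    have "(\<Prod>q\<in>prime_factors z. kronecker_prime p_star q ^ multiplicity q z) =
        (\<Prod>q\<in>prime_factors z. Legendre q p ^ multiplicity q z)"
      by (intro prod.cong refl) (auto simp: p_star_reciprocity in_prime_factors_iff prime_gt_0_int)
    then show ?thesis using False unfolding kronecker_def by (simp only: if_False)
  qed
  also have "(\<Prod>q\<in>prime_factors z. Legendre q p ^ multiplicity q z) = Legendre (\<Prod>q\<in>prime_factors z. q ^ multiplicity q z) p"
    by (simp add: Legendre_prod Legendre_power)
  also have "(\<Prod>q\<in>prime_factors z. q ^ multiplicity q z) = \<bar>z\<bar>"
    using False prod_prime_factors[of z] by simp
  also have "(if z < 0 \<and> p_star < 0 then - 1 else 1) * Legendre \<bar>z\<bar> p = Legendre z p"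
  proof (cases "z < 0")
    case True
    have "Legendre z p = Legendre (- 1) p * Legendre \<bar>z\<bar> p"
      using True Legendre_mult[of "- 1" "\<bar>z\<bar>"] by simp
    moreover have "p_star < 0 \<longleftrightarrow> Legendre (- 1) p = - 1"
      using p_gt_2 by (simp add: p_star_def Legendre_minus_1_mod_4)
    moreover have "Legendre (- 1) p = 1 \<or> Legendre (- 1) p = - 1"
      by (simp add: Legendre_minus_1_mod_4)
    ultimately show ?thesis using True by auto
  qed simp
  finally show ?thesis .
qed

section \<open>Gauss sums in one variable\<close>

definition gauss :: "int \<Rightarrow> nat \<Rightarrow> complex" where
  "gauss a j = (\<Sum>x\<in>{0..<p ^ j}. ec (p ^ j) (a * x\<^sup>2))"

lemma gauss_0 [simp]: "gauss a 0 = 1"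
  by (simp add: gauss_def)

lemma ec_square_cong: "M dvd x - y \<Longrightarrow> ec M (a * x\<^sup>2) = ec M (a * y\<^sup>2)"
proof (rule ec_dvd_diff)
  assume "M dvd x - y"
  moreover have "a * x\<^sup>2 - a * y\<^sup>2 = a * (x + y) * (x - y)"
    by (simp add: power2_eq_square algebra_simps)
  ultimately show "M dvd a * x\<^sup>2 - a * y\<^sup>2" by simp
qed

text \<open>Write \<open>z = u + p ^ Suc j * v\<close>. The square contributes only the cross term
  \<open>2 a u v\<close> modulo \<open>p\<close>, so the sum over \<open>v\<close> forces
  \<open>p\<close> to divide \<open>u\<close>; the remaining \<open>u = p * w\<close> give the sum
  with exponent lowered by 2.\<close>

lemma gauss_rec:
  assumes a: "\<not> p dvd a"
  shows "gauss a (Suc (Suc j)) = of_int p * gauss a j"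
proof -
  let ?M = "p ^ Suc (Suc j)" and ?K = "p ^ Suc j"
  have inner: "(\<Sum>v\<in>{0..<p}. ec ?M (a * (u + ?K * v)\<^sup>2)) =
      (if p dvd u then of_int p * ec ?M (a * u\<^sup>2) else 0)" for u
  proof -
    have "ec ?M (a * (u + ?K * v)\<^sup>2) = ec ?M (a * u\<^sup>2) * ec p (v * (2 * a * u))" for v
    proof -
      have "a * (u + ?K * v)\<^sup>2 - (a * u\<^sup>2 + ?K * (v * (2 * a * u))) = ?M * (a * p ^ j * v\<^sup>2)"
        by (simp add: power2_eq_square algebra_simps)
      then have "ec ?M (a * (u + ?K * v)\<^sup>2) = ec ?M (a * u\<^sup>2 + ?K * (v * (2 * a * u)))"
        by (intro ec_dvd_diff) (metis dvd_triv_left)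
      moreover have "ec ?M (?K * (v * (2 * a * u))) = ec p (v * (2 * a * u))"
        using ec_scale[of ?K p "v * (2 * a * u)"] p_gt_0 unfolding power_Suc2[of p "Suc j"] by simp
      ultimately show ?thesis by (simp add: ec_add)
    qed
    moreover have "p dvd 2 * a * u \<longleftrightarrow> p dvd u" using a by (simp add: dvd_mult_iff)
    ultimately show ?thesis
      using sum_ec[OF p_gt_0, of "2 * a * u"] by (simp flip: sum_distrib_left)
  qed
  have "gauss a (Suc (Suc j)) = (\<Sum>u\<in>{0..<?K}. if p dvd u then of_int p * ec ?M (a * u\<^sup>2) else 0)"
  proof -
    have MK: "?M = ?K * p" by simp
    have "gauss a (Suc (Suc j)) = (\<Sum>z\<in>{0..<?K * p}. ec ?M (a * z\<^sup>2))"
      unfolding gauss_def MK ..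
    also have "\<dots> = (\<Sum>u\<in>{0..<?K}. \<Sum>v\<in>{0..<p}. ec ?M (a * (u + ?K * v)\<^sup>2))"
      by (rule sum_residues_digits) (use p_gt_0 in simp)
    finally show ?thesis unfolding inner .
  qed
  also have "\<dots> = (\<Sum>u\<in>{u\<in>{0..<?K}. p dvd u}. of_int p * ec ?M (a * u\<^sup>2))"
    by (subst sum.inter_filter) simp_all
  also have "\<dots> = (\<Sum>w\<in>{0..<p ^ j}. of_int p * ec ?M (a * (p * w)\<^sup>2))"
    unfolding multiples_of_prime[OF prime_p] using p_gt_0 by (subst sum.reindex) (auto intro: inj_onI)
  also have "\<dots> = (\<Sum>w\<in>{0..<p ^ j}. of_int p * ec (p ^ j) (a * w\<^sup>2))"
  proof (intro sum.cong refl arg_cong2[of _ _ _ _ "(*)"])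
    fix w
    have "ec ?M (a * (p * w)\<^sup>2) = ec (p\<^sup>2 * p ^ j) (p\<^sup>2 * (a * w\<^sup>2))"
      by (simp add: power2_eq_square mult_ac)
    also have "\<dots> = ec (p ^ j) (a * w\<^sup>2)" using p_gt_0 by (intro ec_scale) simp
    finally show "ec ?M (a * (p * w)\<^sup>2) = ec (p ^ j) (a * w\<^sup>2)" .
  qed
  finally show ?thesis by (simp add: gauss_def sum_distrib_left)
qed

lemma card_square_roots:
  assumes t: "t \<in> {0..<p}"
  shows "int (card {x\<in>{0..<p}. x\<^sup>2 mod p = t}) = 1 + Legendre t p"
proof -
  have iff: "x\<^sup>2 mod p = t \<longleftrightarrow> p dvd x\<^sup>2 - t" for x
    using t mod_eq_dvd_iff[of "x\<^sup>2" p t] by simp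
  consider "t = 0" | "t \<noteq> 0" "QuadRes p t" | "t \<noteq> 0" "\<not> QuadRes p t" by blast
  then show ?thesis
  proof cases
    case 1
    have "p dvd x\<^sup>2 \<longleftrightarrow> p dvd x" for x by (simp add: power2_eq_square dvd_mult_iff)
    then have "{x\<in>{0..<p}. x\<^sup>2 mod p = t} = {x\<in>{0..<p}. p dvd x}"
      unfolding iff by (simp add: 1)
    also have "\<dots> = {0}" using p_gt_0 by (auto dest: zdvd_imp_le simp: zdvd_not_zless le_less)
    finally show ?thesis by (simp add: 1 Legendre_def)
  next
    case 3
    then have "card {x\<in>{0..<p}. x\<^sup>2 mod p = t} = card ({} :: int set)"
      unfolding iff by (intro arg_cong[of _ _ card]) (auto simp: QuadRes_def cong_iff_dvd_diff)
    moreover have "\<not> p dvd t" using 3 t zdvd_not_zless[of t p] by auto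
    ultimately show ?thesis using 3 by (simp add: Legendre_def cong_0_iff)
  next
    case 2
    have nt: "\<not> p dvd t" using 2 t zdvd_not_zless[of t p] by auto
    obtain y where y: "p dvd y\<^sup>2 - t" using 2 by (auto simp: QuadRes_def cong_iff_dvd_diff)
    have ny: "\<not> p dvd y"
    proof
      assume "p dvd y"
      then have "p dvd y\<^sup>2" by (simp add: power2_eq_square)
      then show False using y nt by (metis dvd_diff_right_iff)
    qed
    have "{x\<in>{0..<p}. x\<^sup>2 mod p = t} = {y mod p, (- y) mod p}"
    proof (rule equalityI; rule subsetI)
      fix x assume "x \<in> {x\<in>{0..<p}. x\<^sup>2 mod p = t}"
      then have x: "0 \<le> x" "x < p" "p dvd x\<^sup>2 - t" by (auto simp: iff)
      have "p dvd (x\<^sup>2 - t) - (y\<^sup>2 - t)" using x(3) y by (rule dvd_diff)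
      then have "p dvd (x - y) * (x + y)" by (simp add: power2_eq_square algebra_simps)
      then have "p dvd y - x \<or> p dvd - y - x"
        unfolding dvd_mult_iff by (metis add.commute dvd_diff_commute dvd_minus_iff minus_add_distrib uminus_add_conv_diff minus_diff_eq)
      then show "x \<in> {y mod p, (- y) mod p}" using x by (auto intro: mod_eqI [symmetric])
    next
      fix x assume "x \<in> {y mod p, (- y) mod p}"
      then have x: "x \<in> {0..<p}" "p dvd x - y \<or> p dvd x - (- y)" using p_gt_0 by (auto simp del: diff_minus_eq_add)
      then have "p dvd (x - y) * (x + y)" by (auto simp: dvd_mult_iff)
      then have "p dvd (x - y) * (x + y) + (y\<^sup>2 - t)" using y by (rule dvd_add)
      then have "p dvd x\<^sup>2 - t" by (simp add: power2_eq_square algebra_simps)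
      then show "x \<in> {x\<in>{0..<p}. x\<^sup>2 mod p = t}" using x by (simp add: iff)
    qed
    moreover have "y mod p \<noteq> (- y) mod p"
    proof
      assume "y mod p = (- y) mod p"
      then have "p dvd 2 * y" by (simp add: mod_eq_dvd_iff)
      then show False using ny by (simp add: dvd_mult_iff)
    qed
    ultimately have "card {x\<in>{0..<p}. x\<^sup>2 mod p = t} = 2" by simp
    then show ?thesis using 2 nt by (simp add: Legendre_def cong_0_iff)
  qed
qed

definition tau :: complex where "tau = gauss 1 1"

text \<open>Grouping \<open>x\<close> by \<open>t = x^2\<close> modulo \<open>p\<close>, where each
  \<open>t\<close> has \<open>1 + (t / p)\<close> square roots.\<close>

lemma gauss_1_aux: "gauss a 1 = (\<Sum>t\<in>{0..<p}. ec p (a * t)) + (\<Sum>t\<in>{0..<p}. of_int (Legendre t p) * ec p (a * t))"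
proof -
  have "gauss a 1 = (\<Sum>x\<in>{0..<p}. ec p (a * (x\<^sup>2 mod p)))"
    unfolding gauss_def by (simp, intro sum.cong refl ec_dvd_diff)
      (simp add: right_diff_distrib [symmetric] dvd_diff_commute[of p "_\<^sup>2"])
  also have "\<dots> = (\<Sum>t\<in>{0..<p}. \<Sum>x\<in>{x\<in>{0..<p}. x\<^sup>2 mod p = t}. ec p (a * (x\<^sup>2 mod p)))"
    using p_gt_0 by (intro sum.group [symmetric]) auto
  also have "\<dots> = (\<Sum>t\<in>{0..<p}. of_int (1 + Legendre t p) * ec p (a * t))"
    by (intro sum.cong refl) (simp flip: card_square_roots)
  finally show ?thesis by (simp add: distrib_right sum.distrib)
qed

lemma sum_Legendre_twist:
  "(\<Sum>t\<in>{0..<p}. of_int (Legendre t p) * ec p (t * a)) = of_int (Legendre a p) * tau"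
proof (cases "p dvd a")
  case True
  \<comment> \<open>At \<open>a = 0\<close> the identity \<open>gauss_1_aux\<close> reads
    \<open>p = p\<close> plus this sum.\<close>
  have "(\<Sum>t\<in>{0..<p}. of_int (Legendre t p) :: complex) = 0"
    using gauss_1_aux[of 0] by (simp add: gauss_def)
  moreover have "ec p (t * a) = 1" for t using True by (simp add: ec_eq_1_if_dvd)
  ultimately show ?thesis using True by (simp add: Legendre_eq_0_iff)
next
  case False
  let ?f = "\<lambda>t. of_int (Legendre t p) * ec p t"
  have "ec p x = ec p y" "Legendre x p = Legendre y p" if "p dvd x - y" for x y
    using ec_dvd_diff[OF that] Legendre_cong[OF that] by auto
  then have "(\<Sum>t\<in>{0..<p}. ?f (a * t)) = (\<Sum>t\<in>{0..<p}. ?f t)"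
    using False p_gt_0 by (intro sum_residues_unit) (auto simp: coprime_iff)
  also have "\<dots> = tau"
    unfolding tau_def gauss_1_aux using sum_ec[OF p_gt_0, of 1] by (simp add: mult.commute)
  finally have "of_int (Legendre a p) * tau = of_int (Legendre a p) * (\<Sum>t\<in>{0..<p}. ?f (a * t))" by simp
  also have "\<dots> = (\<Sum>t\<in>{0..<p}. of_int (Legendre a p * Legendre a p) * of_int (Legendre t p) * ec p (t * a))"
    by (simp add: Legendre_mult sum_distrib_left mult_ac)
  finally show ?thesis using Legendre_square[OF False] by simp
qed

lemma gauss_1:
  assumes a: "\<not> p dvd a"
  shows "gauss a 1 = of_int (Legendre a p) * tau"
proof -
  have c: "ec p (a * t) = ec p (t * a)" for t by (simp only: mult.commute)
  have "gauss a 1 = (\<Sum>t\<in>{0..<p}. ec p (t * a)) + (\<Sum>t\<in>{0..<p}. of_int (Legendre t p) * ec p (t * a))"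
    by (simp only: gauss_1_aux c)
  then show ?thesis unfolding sum_Legendre_twist sum_ec[OF p_gt_0] using a by (simp only: if_False add_0)
qed

lemma gauss_eq: "\<not> p dvd a \<Longrightarrow> gauss a j = of_int (Legendre a p) ^ j * gauss 1 j"
proof (induction j rule: induct_nat_012)
  case 1
  show ?case using gauss_1[OF 1] unfolding tau_def by simp
next
  case (ge2 j)
  then have "(of_int (Legendre a p) :: complex) * of_int (Legendre a p) = 1"
    by (metis Legendre_square of_int_1 of_int_mult)
  then show ?case using ge2 by (simp add: gauss_rec mult.assoc [symmetric])
qed simp

lemma gauss_even: "gauss 1 (2 * i) = of_int p ^ i"
  by (induction i) (simp_all add: gauss_rec)

lemma gauss_odd: "gauss 1 (2 * i + 1) = of_int p ^ i * tau"
  by (induction i) (simp_all add: gauss_rec tau_def)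

text \<open>Expanding \<open>G(1) G(-1)\<close> and summing over the difference of the two variables.\<close>

lemma tau_square: "tau\<^sup>2 = of_int p_star"
proof -
  let ?e = "\<lambda>x. ec p (1 * x\<^sup>2)"
  have "gauss (- 1) 1 * gauss 1 1 = (\<Sum>y\<in>{0..<p}. ec p (- 1 * y\<^sup>2) * (\<Sum>x\<in>{0..<p}. ?e x))"
    by (simp add: gauss_def sum_distrib_right)
  also have "\<dots> = (\<Sum>y\<in>{0..<p}. ec p (- 1 * y\<^sup>2) * (\<Sum>h\<in>{0..<p}. ?e (h + y)))"
  proof -
    have "(\<Sum>h\<in>{0..<p}. ?e (h + y)) = (\<Sum>x\<in>{0..<p}. ?e x)" for y
      by (rule sum_residues_shift[OF p_gt_0]) (rule ec_square_cong)
    then show ?thesis by simp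
  qed
  also have "\<dots> = (\<Sum>y\<in>{0..<p}. \<Sum>h\<in>{0..<p}. ec p (h\<^sup>2) * ec p (y * (2 * h)))"
    by (simp only: sum_distrib_left ec_add [symmetric])
       (simp add: power2_eq_square algebra_simps)
  also have "\<dots> = (\<Sum>h\<in>{0..<p}. ec p (h\<^sup>2) * (\<Sum>y\<in>{0..<p}. ec p (y * (2 * h))))"
    by (subst sum.swap) (simp add: sum_distrib_left)
  also have "\<dots> = (\<Sum>h\<in>{0..<p}. if h = 0 then of_int p else 0)"
  proof (intro sum.cong refl)
    fix h assume "h \<in> {0..<p}"
    then have "p dvd 2 * h \<longleftrightarrow> h = 0" using zdvd_imp_le[of p h] by (cases "h = 0") (auto simp: dvd_mult_iff)
    then show "ec p (h\<^sup>2) * (\<Sum>y\<in>{0..<p}. ec p (y * (2 * h))) = (if h = 0 then of_int p else 0)"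
      by (simp add: sum_ec[OF p_gt_0])
  qed
  also have "\<dots> = of_int p" using p_gt_0 by simp
  finally have "of_int (Legendre (- 1) p) * tau\<^sup>2 = of_int p"
    using gauss_1[of "- 1"] by (simp add: tau_def power2_eq_square mult_ac)
  then have "of_int (Legendre (- 1) p) * (of_int (Legendre (- 1) p) * tau\<^sup>2) = of_int (p_star)"
    by (simp add: p_star_def)
  then show ?thesis by (simp add: Legendre_minus_1_mod_4 split: if_splits)
qed

text \<open>The sign of the Gauss sum is left undetermined. The later evaluations contain either its
  even powers or combinations in which \<open>tau\<close> occurs squared.\<close>

lemma gauss_square: "(gauss 1 j)\<^sup>2 = of_int (Legendre (- 1) p * p) ^ j"
proof (cases "even j")
  case True
  then obtain i where i: "j = 2 * i" by blast
  show ?thesis unfolding i gauss_even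
    by (simp add: Legendre_minus_1_mod_4 power_mult [symmetric] mult.commute)
next
  case False
  then obtain i where i: "j = 2 * i + 1" by (auto elim: oddE)
  have "(of_int p ^ i :: complex)\<^sup>2 = of_int (Legendre (- 1) p * p) ^ (2 * i)"
    by (simp add: Legendre_minus_1_mod_4 power_mult [symmetric] mult.commute)
  then show ?thesis
    unfolding i gauss_odd power_mult_distrib tau_square by (simp add: p_star_def)
qed

text \<open>For \<open>d = x + p * y\<close> the symbol sees only \<open>x\<close>; the sum over
  \<open>y\<close> forces \<open>p ^ j\<close> to divide \<open>z\<close>, and the sum over
  \<open>x\<close> is a twisted sum modulo \<open>p\<close>. This is the sum over \<open>d\<close>
  at primes dividing \<open>m\<close> but not \<Delta>.\<close>

lemma sum_units_Legendre:
  "(\<Sum>d\<in>units_mod (p ^ Suc j). of_int (Legendre d p) * ec (p ^ Suc j) (d * z)) =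
    (if p ^ j dvd z then of_int (p ^ j) * of_int (Legendre (z div p ^ j) p) * tau else 0)"
proof -
  let ?M = "p ^ Suc j"
  have "(\<Sum>d\<in>units_mod ?M. of_int (Legendre d p) * ec ?M (d * z))
      = (\<Sum>d\<in>{0..<?M}. of_int (Legendre d p) * ec ?M (d * z))"
  proof (rule sum.mono_neutral_left)
    show "\<forall>d\<in>{0..<?M} - units_mod ?M. of_int (Legendre d p) * ec ?M (d * z) = 0"
      by (auto simp: units_mod_def coprime_iff Legendre_eq_0_iff)
  qed (auto simp: units_mod_def)
  also have "\<dots> = (\<Sum>x\<in>{0..<p}. \<Sum>y\<in>{0..<p ^ j}. of_int (Legendre (x + p * y) p) * ec ?M ((x + p * y) * z))"
    using sum_residues_digits[OF p_gt_0, of _ "p ^ j"] by simp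
  also have "\<dots> = (\<Sum>x\<in>{0..<p}. of_int (Legendre x p) * ec ?M (x * z) * (\<Sum>y\<in>{0..<p ^ j}. ec (p ^ j) (y * z)))"
  proof (simp only: sum_distrib_left, intro sum.cong refl)
    fix x y
    have "Legendre (x + p * y) p = Legendre x p" by (rule Legendre_cong) simp
    moreover have "ec ?M (p * y * z) = ec (p ^ j) (y * z)"
      using ec_scale[of p "p ^ j" "y * z"] p_gt_0 by (simp add: mult.assoc)
    ultimately show "of_int (Legendre (x + p * y) p) * ec ?M ((x + p * y) * z) =
        of_int (Legendre x p) * ec ?M (x * z) * ec (p ^ j) (y * z)"
      by (simp only: distrib_right ec_add) simp
  qed
  also have "\<dots> = (if p ^ j dvd z then of_int (p ^ j) * (\<Sum>x\<in>{0..<p}. of_int (Legendre x p) * ec ?M (x * z)) else 0)"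
    using sum_ec[of "p ^ j" z] p_gt_0 by (simp add: sum_distrib_left mult_ac)
  also have "\<dots> = (if p ^ j dvd z then of_int (p ^ j) * of_int (Legendre (z div p ^ j) p) * tau else 0)"
  proof (cases "p ^ j dvd z")
    case True
    then obtain w where w: "z = p ^ j * w" by blast
    have "ec ?M (x * z) = ec p (x * w)" for x
      using ec_scale[of "p ^ j" p "x * w"] p_gt_0 by (simp add: w mult_ac)
    then show ?thesis using True p_gt_0 by (simp add: sum_Legendre_twist w)
  qed simp
  finally show ?thesis .
qed

end

section \<open>Gauss sums of unimodular quadratic forms\<close>

definition mform :: "int ^ 'k ^ 'k \<Rightarrow> int ^ 'k \<Rightarrow> int" where
  "mform A X = (\<Sum>k\<in>UNIV. \<Sum>l\<in>UNIV. A $ k $ l * X $ k * X $ l)"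

text \<open>The congruence \<open>A \<mapsto> E A E\<^sup>T\<close> by the elementary matrix \<open>E = 1 + c e\<^sub>i\<^sub>j\<close>.\<close>

definition shear :: "'k \<Rightarrow> 'k \<Rightarrow> int \<Rightarrow> int ^ 'k ^ 'k \<Rightarrow> int ^ 'k ^ 'k" where
  "shear i j c A = (\<chi> k l. A $ k $ l + (if k = i then c * A $ j $ l else 0)
     + (if l = i then c * A $ k $ j else 0) + (if k = i \<and> l = i then c\<^sup>2 * A $ j $ j else 0))"

text \<open>The quadratic form of \<open>E A E^T\<close> at \<open>X\<close> is that of
  \<open>A\<close> at \<open>E^T X\<close>, which adds \<open>c\<close> times the coordinate
  \<open>i\<close> to the coordinate \<open>j\<close>.\<close>

lemma mform_shear:
  assumes "i \<noteq> j"
  shows "mform (shear i j c A) X = mform A (X + axis j (c * X $ i))"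
proof -
  let ?t = "c * X $ i"
  have L: "shear i j c A $ k $ l * X $ k * X $ l = A $ k $ l * X $ k * X $ l
      + (if k = i then A $ j $ l * ?t * X $ l else 0) + (if l = i then A $ k $ j * X $ k * ?t else 0)
      + (if k = i then if l = i then A $ j $ j * ?t * ?t else 0 else 0)" for k l
    by (simp add: shear_def algebra_simps power2_eq_square)
  have R: "A $ k $ l * (X + axis j ?t) $ k * (X + axis j ?t) $ l = A $ k $ l * X $ k * X $ l
      + (if k = j then A $ j $ l * ?t * X $ l else 0) + (if l = j then A $ k $ j * X $ k * ?t else 0)
      + (if k = j then if l = j then A $ j $ j * ?t * ?t else 0 else 0)" for k l
    by (simp add: axis_def algebra_simps)
  have swap: "(\<Sum>l\<in>UNIV. if k = i then f l else 0) = (if k = i then \<Sum>l\<in>UNIV. f l else (0::int))"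
    for f :: "'a \<Rightarrow> int" and k i :: 'a by simp
  show ?thesis
    unfolding mform_def L R by (simp add: sum.distrib swap)
qed

lemma det_shear:
  assumes "i \<noteq> j"
  shows "det (shear i j c A) = det (A :: int ^ 'k ^ 'k)"
proof -
  define R where "R = (\<lambda>A :: int ^ 'k ^ 'k. \<chi> k. if k = i then row i A + c *s row j A else row k A)"
  have detR: "det (R A) = det A" for A unfolding R_def by (rule det_row_operation[OF assms])
  have "shear i j c A = transpose (R (transpose (R A)))"
    using assms by (simp add: shear_def R_def transpose_def row_def vec_eq_iff algebra_simps power2_eq_square)
  then show ?thesis by (simp add: detR)
qed

text \<open>Elementary congruences have determinant 1 and are bijective substitutions modulo every
  \<open>M\<close>, so the determinant and the complete exponential sums are invariants of this
  relation.\<close>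

inductive shear_equiv :: "int ^ 'k ^ 'k \<Rightarrow> int ^ 'k ^ 'k \<Rightarrow> bool" for A where
  base: "shear_equiv A A"
| step: "shear_equiv A A' \<Longrightarrow> i \<noteq> j \<Longrightarrow> shear_equiv A (shear i j c A')"

lemma shear_equiv_trans: "shear_equiv A' A'' \<Longrightarrow> shear_equiv A A' \<Longrightarrow> shear_equiv A A''"
  by (induction rule: shear_equiv.induct) (auto intro: shear_equiv.intros)

lemma shear_equiv_det: "shear_equiv A A' \<Longrightarrow> det A' = det A"
  by (induction rule: shear_equiv.induct) (auto simp: det_shear)

lemma transpose_shear: "transpose A = A \<Longrightarrow> transpose (shear i j c A) = shear i j c A"
  by (auto simp: shear_def transpose_def vec_eq_iff)

lemma shear_equiv_sym: "shear_equiv A A' \<Longrightarrow> transpose A = A \<Longrightarrow> transpose A' = A'"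
  by (induction rule: shear_equiv.induct) (auto simp: transpose_shear)

lemma mform_cong:
  assumes "vdvd M (X - Y)"
  shows "M dvd mform A X - mform A Y"
proof -
  have c: "[X $ k = Y $ k] (mod M)" for k using assms by (simp add: vdvd_def cong_iff_dvd_diff)
  have "[mform A X = mform A Y] (mod M)"
    unfolding mform_def by (intro cong_sum cong_mult cong_refl c)
  then show ?thesis by (simp add: cong_iff_dvd_diff)
qed

lemma shear_equiv_sum:
  assumes "shear_equiv A A'" and M: "M > 0"
  shows "(\<Sum>X\<in>reps_mod M. ec M (d * mform A' X)) = (\<Sum>X\<in>reps_mod M. ec M (d * mform A X))"
  using assms(1)
proof (induction rule: shear_equiv.induct)
  case (step A' i j c)
  have f: "ec M (d * mform A' X) = ec M (d * mform A' Y)" if "vdvd M (X - Y)" for X Y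
    by (rule ec_dvd_diff) (simp add: mform_cong[OF that] flip: right_diff_distrib)
  have "(\<Sum>X\<in>reps_mod M. ec M (d * mform (shear i j c A') X))
      = (\<Sum>X\<in>reps_mod M. ec M (d * mform A' (X + axis j (c * X $ i))))"
    using step by (simp add: mform_shear)
  also have "\<dots> = (\<Sum>X\<in>reps_mod M. ec M (d * mform A' X))"
  proof (rule sum_reps_bij[OF M, where \<phi> = "\<lambda>X. X + axis j (c * X $ i)" and \<psi> = "\<lambda>X. X - axis j (c * X $ i)"])
    fix X Y :: "int ^ 'a" assume XY: "vdvd M (X - Y)"
    then have "M dvd (X $ k - Y $ k) + c * (X $ i - Y $ i)" "M dvd (X $ k - Y $ k) - c * (X $ i - Y $ i)"
      "M dvd X $ k - Y $ k" for k
      by (simp_all add: vdvd_def)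
    moreover have "(X $ k - Y $ k) + c * (X $ i - Y $ i) = X $ k + c * X $ i - (Y $ k + c * Y $ i)"
      "(X $ k - Y $ k) - c * (X $ i - Y $ i) = X $ k - c * X $ i - (Y $ k - c * Y $ i)" for k
      by (simp_all add: algebra_simps)
    ultimately show "vdvd M (X + axis j (c * X $ i) - (Y + axis j (c * Y $ i)))"
      "vdvd M (X - axis j (c * X $ i) - (Y - axis j (c * Y $ i)))"
      unfolding vdvd_def axis_def by auto
  qed (use step f in \<open>auto simp: vdvd_def axis_def\<close>)
  finally show ?case using step by simp
qed simp

lemma det_cong:
  fixes A A' :: "int ^ 'k ^ 'k"
  assumes "\<And>i j. [A $ i $ j = A' $ i $ j] (mod q)"
  shows "[det A = det A'] (mod q)"
  unfolding det_def by (intro cong_sum cong_mult cong_prod cong_refl assms)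

lemma dvd_det_row:
  fixes A :: "int ^ 'k ^ 'k"
  assumes "\<And>j. q dvd A $ i $ j"
  shows "q dvd det A"
proof -
  let ?A' = "\<chi> k. if k = i then 0 else A $ k"
  have "[det A = det ?A'] (mod q)"
    using assms by (intro det_cong) (auto simp: cong_0_iff)
  also have "det ?A' = 0" by (rule det_row_0)
  finally show ?thesis by (simp add: cong_0_iff)
qed

context odd_prime
begin

text \<open>If every diagonal entry outside \<open>S\<close> is divisible by \<open>p\<close>, row
  \<open>i\<close> still has a unit entry in some column \<open>l\<close>, since otherwise
  \<open>p\<close> would divide the determinant. Adding index \<open>l\<close> to index
  \<open>i\<close> makes the pivot \<open>A_ii + A_ll + 2 A_il\<close>, a unit because
  \<open>p\<close> is odd. The rows of \<open>S\<close> are already clean, which keeps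
  \<open>l\<close> outside \<open>S\<close>.\<close>

lemma shear_pivot:
  fixes A :: "int ^ 'k ^ 'k"
  assumes sym: "transpose A = A" and det: "\<not> p dvd det A" and j: "j > 0"
    and S: "\<And>k l. k \<in> S \<Longrightarrow> l \<noteq> k \<Longrightarrow> p ^ j dvd A $ k $ l" and "S \<noteq> UNIV"
  obtains A' i where "shear_equiv A A'" "i \<notin> S" "\<not> p dvd A' $ i $ i"
    "\<And>k l. k \<in> S \<Longrightarrow> l \<noteq> k \<Longrightarrow> p ^ j dvd A' $ k $ l"
proof (cases "\<exists>i. i \<notin> S \<and> \<not> p dvd A $ i $ i")
  case True
  then show ?thesis using that[of A] S shear_equiv.base by blast
next
  case False
  have symA: "A $ k $ l = A $ l $ k" for k l
    using sym by (metis transpose_def vec_lambda_beta)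
  obtain i where i: "i \<notin> S" using \<open>S \<noteq> UNIV\<close> by auto
  have "\<exists>l. \<not> p dvd A $ i $ l" using dvd_det_row[of p A i] det by blast
  then obtain l where l: "\<not> p dvd A $ i $ l" by blast
  have li: "l \<noteq> i" using l False i by auto
  have lS: "l \<notin> S"
  proof
    assume "l \<in> S"
    then have "p ^ j dvd A $ l $ i" using S li by auto
    moreover have "p dvd p ^ j" using j by simp
    ultimately show False using l symA dvd_trans by metis
  qed
  let ?A' = "shear i l 1 A"
  show ?thesis
  proof (rule that[of ?A' i])
    show "shear_equiv A ?A'" using li by (intro shear_equiv.intros) auto
    have eq: "?A' $ i $ i = A $ i $ i + A $ l $ l + 2 * A $ i $ l"
      using symA[of l i] by (simp add: shear_def)
    have "p dvd A $ i $ i" "p dvd A $ l $ l" using False i lS by blast+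
    then have "p dvd A $ i $ i + A $ l $ l" by (rule dvd_add)
    moreover have "\<not> p dvd 2 * A $ i $ l" using l by (simp add: dvd_mult_iff)
    ultimately show "\<not> p dvd ?A' $ i $ i" unfolding eq by (simp add: dvd_add_right_iff)
    show "p ^ j dvd ?A' $ k $ m" if "k \<in> S" "m \<noteq> k" for k m
    proof -
      have "k \<noteq> i" "l \<noteq> k" "i \<noteq> k" using that i lS by auto
      then show ?thesis using that S[of k] by (auto simp: shear_def intro!: dvd_add)
    qed
  qed (fact i)
qed

lemma shear_eliminate:
  fixes A :: "int ^ 'k ^ 'k"
  assumes "finite R" and i: "i \<notin> S" "\<not> p dvd A $ i $ i"
    and S: "\<And>k l. k \<in> S \<Longrightarrow> l \<noteq> k \<Longrightarrow> p ^ j dvd A $ k $ l"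
    and R: "i \<notin> R" "R \<inter> S = {}"
  shows "\<exists>A'. shear_equiv A A' \<and> A' $ i $ i = A $ i $ i \<and> (\<forall>l\<in>R. p ^ j dvd A' $ i $ l) \<and>
    (\<forall>k\<in>S. \<forall>l. l \<noteq> k \<longrightarrow> p ^ j dvd A' $ k $ l)"
  using assms(1) R
proof (induction R rule: finite_induct)
  case empty
  then show ?case using S by (intro exI[of _ A]) (auto intro: shear_equiv.base)
next
  case (insert l R)
  then obtain A' where A': "shear_equiv A A'" "A' $ i $ i = A $ i $ i" "\<forall>l\<in>R. p ^ j dvd A' $ i $ l"
    "\<forall>k\<in>S. \<forall>l. l \<noteq> k \<longrightarrow> p ^ j dvd A' $ k $ l" by auto
  have "coprime (A $ i $ i) (p ^ j)" using i by (simp add: coprime_iff)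
  then obtain u where "[A $ i $ i * u = 1] (mod p ^ j)" using cong_solve_coprime_int by blast
  then have u: "p ^ j dvd A $ i $ i * u - 1" by (simp add: cong_iff_dvd_diff)
  \<comment> \<open>With \<open>u\<close> inverse to the pivot, the new entry is
    \<open>A_il (1 - A_ii u)\<close>, a multiple of \<open>p ^ j\<close>.\<close>
  let ?c = "- u * A' $ i $ l"
  let ?A'' = "shear l i ?c A'"
  have li: "l \<noteq> i" and lS: "l \<notin> S" using insert.prems by auto
  have "?A'' $ i $ l = - (A' $ i $ l * (A $ i $ i * u - 1))"
    using li A'(2) by (simp add: shear_def algebra_simps)
  then have "p ^ j dvd ?A'' $ i $ l" using u by (simp only: dvd_minus_iff dvd_mult)
  moreover have "?A'' $ i $ m = A' $ i $ m" if "m \<noteq> l" for m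
    using that li by (simp add: shear_def)
  moreover have "p ^ j dvd ?A'' $ k $ m" if "k \<in> S" "m \<noteq> k" for k m
  proof -
    have "k \<noteq> l" "k \<noteq> i" using that lS i by auto
    then show ?thesis using that A'(4) by (auto simp: shear_def)
  qed
  moreover have "shear_equiv A ?A''" using A'(1) li by (rule shear_equiv.step)
  moreover have "?A'' $ i $ i = A $ i $ i" using A'(2) li by (simp add: shear_def)
  moreover have "\<forall>m\<in>insert l R. p ^ j dvd ?A'' $ i $ m"
  proof
    fix m assume "m \<in> insert l R"
    then show "p ^ j dvd ?A'' $ i $ m"
      using calculation(1,2) A'(3) by (cases "m = l") (simp, simp only: insert_iff simp_thms)
  qed
  ultimately show ?case by blast
qed

text \<open>The exponential sums see the matrix only modulo \<open>p ^ j\<close>, so pivots are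
  inverted modulo \<open>p ^ j\<close> and all matrices stay integral. The induction enlarges the
  set \<open>S\<close> of rows that are already diagonal to this precision.\<close>

lemma shear_diagonalize:
  fixes A :: "int ^ 'k ^ 'k"
  assumes sym: "transpose A = A" and det: "\<not> p dvd det A" and j: "j > 0"
  obtains D where "shear_equiv A D" "\<And>k l. k \<noteq> l \<Longrightarrow> p ^ j dvd D $ k $ l"
proof -
  have "\<exists>D. shear_equiv A D \<and> (\<forall>k l. k \<noteq> l \<longrightarrow> p ^ j dvd D $ k $ l)"
    if "transpose A = A" "\<not> p dvd det A" "\<forall>k\<in>S. \<forall>l. l \<noteq> k \<longrightarrow> p ^ j dvd A $ k $ l" for S and A :: "int ^ 'k ^ 'k"
    using that
  proof (induction "card (- S)" arbitrary: S A rule: less_induct)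
    case less
    show ?case
    proof (cases "S = UNIV")
      case True
      then show ?thesis using less.prems by (intro exI[of _ A]) (auto intro: shear_equiv.base)
    next
      case False
      obtain A1 i where A1: "shear_equiv A A1" "i \<notin> S" "\<not> p dvd A1 $ i $ i"
        "\<And>k l. k \<in> S \<Longrightarrow> l \<noteq> k \<Longrightarrow> p ^ j dvd A1 $ k $ l"
        using shear_pivot[OF less.prems(1,2) j _ False] less.prems(3) by metis
      have "\<exists>A2. shear_equiv A1 A2 \<and> A2 $ i $ i = A1 $ i $ i \<and> (\<forall>l\<in>- insert i S. p ^ j dvd A2 $ i $ l) \<and>
          (\<forall>k\<in>S. \<forall>l. l \<noteq> k \<longrightarrow> p ^ j dvd A2 $ k $ l)"
      proof (rule shear_eliminate)
        show "p ^ j dvd A1 $ k $ l" if "k \<in> S" "l \<noteq> k" for k l using A1(4) that .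
      qed (use A1(2,3) in auto)
      then obtain A2 where A2: "shear_equiv A1 A2" "A2 $ i $ i = A1 $ i $ i"
        "\<forall>l\<in>- insert i S. p ^ j dvd A2 $ i $ l" "\<forall>k\<in>S. \<forall>l. l \<noteq> k \<longrightarrow> p ^ j dvd A2 $ k $ l"
        by (elim exE conjE)
      have A12: "shear_equiv A A2" using A2(1) A1(1) by (rule shear_equiv_trans)
      have tr: "transpose A2 = A2" using shear_equiv_sym[OF A12] less.prems by blast
      have symA: "A2 $ k $ l = A2 $ l $ k" for k l
        using tr by (metis transpose_def vec_lambda_beta)
      have "p ^ j dvd A2 $ i $ l" if "l \<noteq> i" for l
      proof (cases "l \<in> S")
        case True
        then show ?thesis unfolding symA[of i l] using that A2(4) by simp
      qed (use that A2(3) in simp)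
      then have "\<forall>k\<in>insert i S. \<forall>l. l \<noteq> k \<longrightarrow> p ^ j dvd A2 $ k $ l" using A2(4) by auto
      moreover have "card (- insert i S) < card (- S)" using A1(2) by (intro psubset_card_mono) auto
      ultimately obtain D where "shear_equiv A2 D" "\<forall>k l. k \<noteq> l \<longrightarrow> p ^ j dvd D $ k $ l"
        using less.hyps[of "insert i S" A2] tr shear_equiv_det[OF A12] less.prems(2) by auto
      then show ?thesis using A12 shear_equiv_trans by blast
    qed
  qed
  from this[of A "{}"] show ?thesis using that assms by auto
qed

text \<open>After diagonalisation the sum is a product of one-variable Gauss sums, whose symbols
  multiply to that of the determinant, because \<open>det A\<close> is congruent modulo
  \<open>p\<close> to the product of the diagonal entries.\<close>

lemma gauss_matrix:
  fixes A :: "int ^ 'k ^ 'k"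
  assumes sym: "transpose A = A" and det: "\<not> p dvd det A" and d: "\<not> p dvd d"
  shows "(\<Sum>X\<in>reps_mod (p ^ j). ec (p ^ j) (d * mform A X)) =
    of_int (Legendre (d ^ CARD('k) * det A) p) ^ j * gauss 1 j ^ CARD('k)"
proof (cases "j = 0")
  case True
  then show ?thesis by simp
next
  case False
  then have j: "j > 0" by simp
  have M: "p ^ j > 0" using p_gt_0 by simp
  obtain D where D: "shear_equiv A D" "\<And>k l. k \<noteq> l \<Longrightarrow> p ^ j dvd D $ k $ l"
    using shear_diagonalize[OF sym det j] by blast
  let ?D = "(\<chi> k l. if k = l then D $ k $ k else 0) :: int ^ 'k ^ 'k"
  have pj: "p dvd p ^ j" using j by simp
  have "[det D = det ?D] (mod p)"
    using D(2) dvd_trans[OF pj] by (intro det_cong) (auto simp: cong_iff_dvd_diff)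
  also have "det ?D = (\<Prod>k\<in>UNIV. D $ k $ k)" by (subst det_diagonal) auto
  finally have "[det A = (\<Prod>k\<in>UNIV. D $ k $ k)] (mod p)" by (simp add: shear_equiv_det[OF D(1)])
  then have det_prod: "p dvd det A - (\<Prod>k\<in>UNIV. D $ k $ k)" by (simp add: cong_iff_dvd_diff)
  have unit: "\<not> p dvd D $ k $ k" for k
  proof
    assume "p dvd D $ k $ k"
    then have "p dvd (\<Prod>k\<in>UNIV. D $ k $ k)" by (meson UNIV_I dvd_prodI dvd_trans finite)
    then show False using det det_prod by (metis dvd_diff_left_iff)
  qed
  have mf: "p ^ j dvd mform D X - (\<Sum>k\<in>UNIV. D $ k $ k * (X $ k)\<^sup>2)" for X
  proof -
    have "[mform D X = (\<Sum>k\<in>UNIV. \<Sum>l\<in>UNIV. if l = k then D $ k $ k * (X $ k)\<^sup>2 else 0)] (mod p ^ j)"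
      unfolding mform_def
    proof (intro cong_sum)
      fix k l
      show "[D $ k $ l * X $ k * X $ l = (if l = k then D $ k $ k * (X $ k)\<^sup>2 else 0)] (mod p ^ j)"
        using D(2)[of k l] by (auto simp: power2_eq_square mult.assoc cong_0_iff)
    qed
    then show ?thesis by (simp add: cong_iff_dvd_diff)
  qed
  have ec_sum: "ec M (\<Sum>k\<in>K. f k) = (\<Prod>k\<in>K. ec M (f k))" for M and f :: "'k \<Rightarrow> int" and K
    by (induction K rule: infinite_finite_induct) (simp_all add: ec_add)
  have "(\<Sum>X\<in>reps_mod (p ^ j). ec (p ^ j) (d * mform A X)) = (\<Sum>X\<in>reps_mod (p ^ j). ec (p ^ j) (d * mform D X))"
    using shear_equiv_sum[OF D(1) M] by simp
  also have "\<dots> = (\<Sum>X\<in>reps_mod (p ^ j). \<Prod>k\<in>UNIV. ec (p ^ j) (d * D $ k $ k * (X $ k)\<^sup>2))"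
  proof (rule sum.cong)
    fix X :: "int ^ 'k"
    have "ec (p ^ j) (d * mform D X) = ec (p ^ j) (d * (\<Sum>k\<in>UNIV. D $ k $ k * (X $ k)\<^sup>2))"
      by (rule ec_dvd_diff) (simp add: mf flip: right_diff_distrib)
    then show "ec (p ^ j) (d * mform D X) = (\<Prod>k\<in>UNIV. ec (p ^ j) (d * D $ k $ k * (X $ k)\<^sup>2))"
      by (simp add: sum_distrib_left ec_sum mult.assoc)
  qed simp
  also have "\<dots> = (\<Prod>k\<in>UNIV. gauss (d * D $ k $ k) j)"
    by (subst sum_reps_prod) (simp add: gauss_def)
  also have "\<dots> = (\<Prod>k\<in>UNIV. of_int (Legendre (d * D $ k $ k) p) ^ j * gauss 1 j)"
  proof (rule prod.cong)
    fix k
    have "\<not> p dvd d * D $ k $ k" using d unit[of k] dvd_mult_iff by blast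
    then show "gauss (d * D $ k $ k) j = of_int (Legendre (d * D $ k $ k) p) ^ j * gauss 1 j" by (rule gauss_eq)
  qed simp
  also have "\<dots> = of_int (\<Prod>k\<in>UNIV. Legendre (d * D $ k $ k) p) ^ j * gauss 1 j ^ CARD('k)"
    by (simp add: prod.distrib prod_power_distrib)
  also have "(\<Prod>k\<in>UNIV. Legendre (d * D $ k $ k) p) = Legendre (d ^ CARD('k) * (\<Prod>k\<in>UNIV. D $ k $ k)) p"
    by (simp add: Legendre_prod [symmetric] prod.distrib)
  also have "\<dots> = Legendre (d ^ CARD('k) * det A) p"
    using det_prod by (intro Legendre_cong) (simp add: dvd_diff_commute flip: right_diff_distrib)
  finally show ?thesis .
qed

end

section \<open>Even lattices\<close>

lemma ext_form_add_left: "ext_form B (x + y) z = ext_form B x z + ext_form B y z"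
  and ext_form_add_right: "ext_form B z (x + y) = ext_form B z x + ext_form B z y"
  and ext_form_diff_left: "ext_form B (x - y) z = ext_form B x z - ext_form B y z"
  and ext_form_diff_right: "ext_form B z (x - y) = ext_form B z x - ext_form B z y"
  by (simp_all add: ext_form_def algebra_simps sum.distrib sum_subtractf)

lemma ext_form_smult_left: "ext_form B (c *s x) y = c * ext_form B x y"
  and ext_form_smult_right: "ext_form B x (c *s y) = c * ext_form B x y"
  by (simp_all add: ext_form_def sum_distrib_left mult_ac)

lemmas ext_form_simps = ext_form_add_left ext_form_add_right ext_form_diff_left ext_form_diff_right
  ext_form_smult_left ext_form_smult_right

lemma ext_form_0 [simp]: "ext_form B 0 y = 0" "ext_form B x 0 = 0"
  by (simp_all add: ext_form_def)

lemma emb_add: "emb (x + y) = emb x + emb y"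
  and emb_diff: "emb (x - y) = emb x - emb y"
  and emb_smult: "emb (c *s x) = of_int c *s emb x"
  and emb_0 [simp]: "emb 0 = 0"
  by (simp_all add: emb_def vec_eq_iff)

lemma of_int_det: "of_int (det A) = det ((\<chi> i j. of_int (A $ i $ j)) :: 'f::comm_ring_1 ^ 'n ^ 'n)"
  by (simp add: det_def)

lemma det_uminus: "det (- A :: 'a::comm_ring_1 ^ 'n ^ 'n) = (- 1) ^ CARD('n) * det A"
proof -
  have "- A = (\<chi> i. (- 1) *s (A $ i))" by (simp add: vec_eq_iff)
  then show ?thesis by (simp add: det_rows_mul)
qed

text \<open>Expansion along a row with one nonzero entry, in Leibniz form: only permutations fixing
  \<open>None\<close> contribute, and \<open>map_permutation\<close> identifies them, signs
  included, with the permutations of the original index type.\<close>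

lemma det_option:
  fixes A :: "'a::comm_ring_1 ^ ('n::finite option) ^ ('n option)"
  assumes "\<And>j. A $ None $ Some j = 0"
  shows "det A = A $ None $ None * det (\<chi> i j. A $ Some i $ Some j)"
proof -
  let ?P = "{q. q permutes (UNIV :: 'n option set)}" and ?Q = "{q. q permutes (UNIV :: 'n set)}"
  let ?f = "\<lambda>q. of_int (sign q) * (\<Prod>i\<in>UNIV. A $ i $ q i)"
  let ?g = "map_permutation UNIV (Some :: 'n \<Rightarrow> 'n option)"
  let ?S = "range (Some :: 'n \<Rightarrow> 'n option)"
  have bij: "bij_betw Some (UNIV :: 'n set) ?S" by (rule inj_on_imp_bij_betw) simp
  have app: "?g q (Some i) = Some (q i)" "?g q None = None" for q i
    by (auto simp: map_permutation_apply map_permutation_def restrict_id_def)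
  have "det A = (\<Sum>q\<in>{q\<in>?P. q None = None}. ?f q)"
    unfolding det_def
  proof (rule sum.mono_neutral_right)
    show "\<forall>q\<in>?P - {q\<in>?P. q None = None}. ?f q = 0"
    proof
      fix q assume q: "q \<in> ?P - {q\<in>?P. q None = None}"
      then obtain j where "q None = Some j" by auto
      then have "A $ None $ q None = 0" using assms by simp
      then have "(\<Prod>i\<in>UNIV. A $ i $ q i) = 0" by (intro prod_zero) auto
      then show "?f q = 0" by simp
    qed
  qed (auto simp: finite_permutations)
  also have "{q\<in>?P. q None = None} = ?g ` ?Q"
  proof (intro equalityI subsetI)
    fix q assume "q \<in> {q\<in>?P. q None = None}"
    then have q: "q permutes UNIV" "q None = None" by auto
    have inj: "inj q" using q(1) by (rule permutes_inj)
    have some: "q (Some i) \<noteq> None" for i using inj q(2) by (metis inj_eq option.distinct(1))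
    define r where "r i = the (q (Some i))" for i
    have qr: "q (Some i) = Some (r i)" for i using some[of i] by (auto simp: r_def)
    have "inj r" using inj qr by (metis (no_types) inj_def option.inject)
    then have "r permutes UNIV"
      using finite_UNIV_inj_surj[of r] by (intro bij_imp_permutes) (auto simp: bij_def)
    moreover have "?g r = q"
    proof
      show "?g r x = q x" for x using app qr q(2) by (cases x) auto
    qed
    ultimately show "q \<in> ?g ` ?Q" by blast
  next
    fix q assume "q \<in> ?g ` ?Q"
    then obtain r where r: "r permutes UNIV" "q = ?g r" by auto
    have "?g r permutes ?S" using bij r(1) by (rule map_permutation_permutes)
    then have "q permutes UNIV" using r permutes_subset by blast
    then show "q \<in> {q\<in>?P. q None = None}" using app r by auto
  qed
  also have "(\<Sum>q\<in>?g ` ?Q. ?f q) = (\<Sum>r\<in>?Q. ?f (?g r))"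
  proof (rule sum.reindex[unfolded o_def])
    show "inj_on ?g ?Q"
    proof (rule inj_onI)
      fix r s assume "?g r = ?g s"
      then have "Some (r i) = Some (s i)" for i using app(1) by metis
      then show "r = s" by auto
    qed
  qed
  also have "\<dots> = (\<Sum>r\<in>?Q. A $ None $ None * (of_int (sign r) * (\<Prod>i\<in>UNIV. A $ Some i $ Some (r i))))"
  proof (rule sum.cong)
    fix r assume r: "r \<in> ?Q"
    have "sign (?g r) = sign r" using r by (intro sign_map_permutation) auto
    moreover have "(\<Prod>i\<in>UNIV. A $ i $ ?g r i) = A $ None $ None * (\<Prod>i\<in>?S. A $ i $ ?g r i)"
      by (simp add: UNIV_option_conv app)
    moreover have "(\<Prod>i\<in>?S. A $ i $ ?g r i) = (\<Prod>i\<in>UNIV. A $ Some i $ Some (r i))"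
      by (subst prod.reindex) (simp_all add: app)
    ultimately show "?f (?g r) = A $ None $ None * (of_int (sign r) * (\<Prod>i\<in>UNIV. A $ Some i $ Some (r i)))"
      by (simp add: mult_ac)
  qed simp
  finally show ?thesis by (simp add: det_def sum_distrib_left)
qed

lemma int_of_rat_Ints: "x \<in> \<int> \<Longrightarrow> of_int \<lfloor>x\<rfloor> = (x :: rat)"
  by (auto elim: Ints_cases)

lemma Ints_of_int_div_iff:
  assumes "M \<noteq> 0"
  shows "of_int a / of_int M \<in> (\<int> :: rat set) \<longleftrightarrow> M dvd a"
proof
  assume "of_int a / of_int M \<in> (\<int> :: rat set)"
  then obtain k where "of_int a / of_int M = (of_int k :: rat)" by (auto elim: Ints_cases)
  then have "of_int a = (of_int (k * M) :: rat)" using assms by (simp add: field_simps)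
  then have "a = k * M" by (simp only: of_int_eq_iff)
  then show "M dvd a" by simp
qed (use assms in auto)

section \<open>An even lattice and its dual\<close>

locale even_lat =
  fixes B :: "int ^ 'n \<Rightarrow> int ^ 'n \<Rightarrow> int"
  assumes even_lattice: "even_lattice B"
begin

lemma B_add_left: "B (x + y) z = B x z + B y z"
  and B_add_right: "B x (y + z) = B x y + B x z"
  and B_even: "even (B x x)"
  using even_lattice by (simp_all add: even_lattice_def)

lemma B_sym: "B x y = B y x"
  using even_lattice unfolding even_lattice_def by meson

lemma B_nondegenerate: "(\<And>y. B x y = 0) \<Longrightarrow> x = 0"
  using even_lattice unfolding even_lattice_def by meson

lemma B_smult_left: "B (c *s x) y = c * B x y"
  using additive_smult[of "\<lambda>x. B x y"] B_add_left by simp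

lemma B_smult_right: "B y (c *s x) = c * B y x"
  using B_smult_left B_sym by metis

definition q :: "int ^ 'n \<Rightarrow> int" where "q y = B y y div 2"

lemma q_B: "2 * q y = B y y"
  using B_even by (simp add: q_def)

abbreviation "\<Delta> \<equiv> lat_det B"

lemma B_basis: "B x y = (\<Sum>i\<in>UNIV. \<Sum>j\<in>UNIV. x $ i * y $ j * B (axis i 1) (axis j 1))"
proof -
  have "B x y = (\<Sum>i\<in>UNIV. x $ i * B (axis i 1) y)"
    by (rule additive_basis) (rule B_add_left)
  also have "\<dots> = (\<Sum>i\<in>UNIV. x $ i * (\<Sum>j\<in>UNIV. y $ j * B (axis i 1) (axis j 1)))"
  proof -
    have "B (axis i 1) y = (\<Sum>j\<in>UNIV. y $ j * B (axis i 1) (axis j 1))" for i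
      by (rule additive_basis) (rule B_add_right)
    then show ?thesis by simp
  qed
  finally show ?thesis by (simp add: sum_distrib_left mult.assoc)
qed

lemma ext_form_emb: "ext_form B (emb x) (emb y) = of_int (B x y)"
  by (subst B_basis) (simp add: ext_form_def emb_def)

lemma ext_form_sym: "ext_form B x y = ext_form B y x"
proof -
  have "ext_form B x y = (\<Sum>j\<in>UNIV. \<Sum>i\<in>UNIV. x $ i * y $ j * of_int (B (axis i 1) (axis j 1)))"
    unfolding ext_form_def by (rule sum.swap)
  also have "\<dots> = ext_form B y x"
    unfolding ext_form_def
  proof (rule sum.cong[OF HOL.refl], rule sum.cong[OF HOL.refl])
    fix i j
    show "x $ i * y $ j * of_int (B (axis i 1) (axis j 1)) = y $ j * x $ i * of_int (B (axis j 1) (axis i 1))"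
      unfolding B_sym[of "axis i 1" "axis j 1"] by (simp only: mult.commute)
  qed
  finally show ?thesis .
qed

lemma ext_quad_emb: "ext_quad B (emb y) = of_int (q y)"
proof -
  have "rat_of_int (B y y) = 2 * of_int (q y)" by (simp flip: q_B)
  then show ?thesis by (simp add: ext_quad_def ext_form_emb)
qed

lemma ext_quad_add: "ext_quad B (x + y) = ext_quad B x + ext_quad B y + ext_form B x y"
  by (simp add: ext_quad_def ext_form_simps ext_form_sym[of y x] field_simps)

lemma ext_quad_smult: "ext_quad B (c *s x) = c\<^sup>2 * ext_quad B x"
  by (simp add: ext_quad_def ext_form_simps power2_eq_square)

definition gram :: "rat ^ 'n ^ 'n" where
  "gram = (\<chi> i j. of_int (B (axis i 1) (axis j 1)))"

lemma gram_nth: "gram $ i $ j = of_int (B (axis i 1) (axis j 1))"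
  by (simp add: gram_def)

lemma det_gram: "det gram = of_int \<Delta>"
  by (simp add: gram_def lat_det_def of_int_det)

lemma gram_mult: "(gram *v x) $ i = ext_form B x (emb (axis i 1))"
proof -
  have "ext_form B x (emb (axis i 1)) = (\<Sum>j\<in>UNIV. \<Sum>k\<in>UNIV. if k = i then x $ j * of_int (B (axis j 1) (axis k 1)) else 0)"
    unfolding ext_form_def by (intro sum.cong refl) (simp add: emb_def axis_def)
  then show ?thesis
    by (simp add: gram_def matrix_vector_mult_def B_sym[of "axis i 1"] mult.commute)
qed

text \<open>A rational kernel vector of the Gram matrix, multiplied by the product of its
  denominators, would be a nonzero integral vector in the radical of the form.\<close>

lemma \<Delta>_nonzero: "\<Delta> \<noteq> 0"
proof
  assume "\<Delta> = 0"
  then have "\<not> invertible gram" by (simp add: invertible_det_nz det_gram)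
  then obtain x where x: "gram *v x = 0" "x \<noteq> 0"
    by (metis invertible_left_inverse matrix_left_invertible_ker)
  obtain c :: int and z where c: "c \<noteq> 0" "of_int c *s x = emb z"
  proof
    let ?c = "\<Prod>i\<in>UNIV. snd (quotient_of (x $ i))"
    have pos: "snd (quotient_of (x $ i)) > 0" for i by (rule quotient_of_denom_pos')
    show "?c \<noteq> 0" using pos by (metis finite less_irrefl prod_zero_iff)
    show "of_int ?c *s x = emb (\<chi> i. \<lfloor>of_int ?c * x $ i\<rfloor>)"
    proof (simp only: vec_eq_iff emb_def vec_lambda_beta vector_smult_component, intro allI)
      fix i
      let ?s = "snd (quotient_of (x $ i))" and ?R = "\<Prod>j\<in>UNIV - {i}. snd (quotient_of (x $ j))"
      have "x $ i = of_int (fst (quotient_of (x $ i))) / of_int ?s"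
        by (rule quotient_of_div) simp
      then have 1: "of_int ?s * x $ i = of_int (fst (quotient_of (x $ i)))"
        using pos[of i] by (simp add: field_simps)
      have "?c = ?s * ?R" by (subst prod.remove[of UNIV i]) auto
      then have "of_int ?c * x $ i = of_int ?R * (of_int ?s * x $ i)"
        by (simp only: of_int_mult mult_ac)
      then have "of_int ?c * x $ i \<in> \<int>" unfolding 1 by (simp only: Ints_mult Ints_of_int)
      then show "of_int ?c * x $ i = of_int \<lfloor>of_int ?c * x $ i\<rfloor>" by (simp only: int_of_rat_Ints)
    qed
  qed
  have "B z (axis i 1) = 0" for i
  proof -
    have "rat_of_int (B z (axis i 1)) = of_int c * (gram *v x) $ i"
      by (simp add: gram_mult ext_form_emb [symmetric] c(2) [symmetric] ext_form_simps)
    then show ?thesis using x by simp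
  qed
  then have "B z y = 0" for y
    using additive_basis[of "B z" y] B_add_right by simp
  then have "z = 0" by (rule B_nondegenerate)
  then have "of_int c *s x = 0" using c by simp
  then show False using c x by (auto simp: vec_eq_iff)
qed

lemma dual_latticeD: "x \<in> dual_lattice B \<Longrightarrow> ext_form B x (emb y) \<in> \<int>"
  by (simp add: dual_lattice_def)

lemma dual_add: "x \<in> dual_lattice B \<Longrightarrow> y \<in> dual_lattice B \<Longrightarrow> x + y \<in> dual_lattice B"
  by (simp add: dual_lattice_def ext_form_simps)

lemma dual_smult: "x \<in> dual_lattice B \<Longrightarrow> of_int c *s x \<in> dual_lattice B"
  by (simp add: dual_lattice_def ext_form_simps)

text \<open>The floor merely changes the type to \<open>int\<close>; on the dual lattice it is
  exact.\<close>

definition pair :: "rat ^ 'n \<Rightarrow> int ^ 'n \<Rightarrow> int" where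
  "pair x y = \<lfloor>ext_form B x (emb y)\<rfloor>"

lemma of_int_pair: "x \<in> dual_lattice B \<Longrightarrow> of_int (pair x y) = ext_form B x (emb y)"
  by (simp add: pair_def int_of_rat_Ints dual_latticeD)

lemma pair_add:
  assumes "x \<in> dual_lattice B"
  shows "pair x (y + z) = pair x y + pair x z"
proof -
  have "rat_of_int (pair x (y + z)) = of_int (pair x y + pair x z)"
    by (simp add: of_int_pair[OF assms] emb_add ext_form_simps)
  then show ?thesis by (simp only: of_int_eq_iff)
qed

lemma pair_smult: "x \<in> dual_lattice B \<Longrightarrow> pair x (c *s y) = c * pair x y"
  using additive_smult[of "pair x"] pair_add by simp

lemma int_combinationI:
  assumes "\<And>k. x $ k \<in> (\<int> :: rat set)"
  obtains z where "x = emb z"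
proof
  show "x = emb (\<chi> i. \<lfloor>x $ i\<rfloor>)"
    by (simp add: emb_def vec_eq_iff int_of_rat_Ints[OF assms])
qed

text \<open>Cramer's rule: the products with a basis are integers, so the coordinates of a dual
  vector have denominators dividing \<Delta>.\<close>

lemma \<Delta>_dual:
  assumes "x \<in> dual_lattice B"
  obtains z where "of_int \<Delta> *s x = emb z"
proof (rule int_combinationI)
  fix k
  have "x $ k * of_int \<Delta> = det (\<chi> i j. if j = k then (gram *v x) $ i else gram $ i $ j)"
    by (simp add: cramer_lemma det_gram)
  also have "\<dots> = of_int (det (\<chi> i j. if j = k then pair x (axis i 1) else B (axis i 1) (axis j 1)))"
    unfolding of_int_det by (intro arg_cong[of _ _ det])
      (simp add: vec_eq_iff gram_mult of_int_pair[OF assms] gram_nth)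
  finally show "(of_int \<Delta> *s x) $ k \<in> \<int>" by (simp add: mult.commute)
qed (rule that)

lemma \<Delta>_pair_Ints:
  assumes "x \<in> dual_lattice B" "y \<in> dual_lattice B"
  shows "of_int \<Delta> * ext_form B x y \<in> \<int>"
proof -
  obtain z where z: "of_int \<Delta> *s y = emb z" using \<Delta>_dual[OF assms(2)] by blast
  have "of_int \<Delta> * ext_form B x y = ext_form B x (emb z)" by (simp add: z [symmetric] ext_form_simps)
  then show ?thesis using assms(1) dual_latticeD by simp
qed

end

text \<open>The polynomial counted by \<^const>\<open>N_count\<close> is treated as a quadratic polynomial in \<open>g + 1\<close>
  variables, indexed by \<^typ>\<open>'n option\<close>: the component \<open>None\<close> is \<open>x\<close>, the others are \<open>y\<close>.\<close>

locale lat_alpha = even_lat B for B :: "int ^ 'n \<Rightarrow> int ^ 'n \<Rightarrow> int" +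
  fixes \<alpha> :: "rat ^ 'n" and m mt :: int
  assumes \<alpha>: "\<alpha> \<in> dual_lattice B"
    and hm: "of_int m = 2 * of_int (lat_det B) * (of_int mt + ext_quad B \<alpha>)"
    and m_nonzero: "m \<noteq> 0"
    and odd_rank: "odd CARD('n)"
begin

text \<open>The polar form of \<open>m x^2 / (2 \<Delta>) - q(x \<alpha> + y)\<close>, expanded so
  that all coefficients are integers.\<close>

definition Bf :: "int ^ ('n option) \<Rightarrow> int ^ ('n option) \<Rightarrow> int" where
  "Bf X Y = 2 * mt * X $ None * Y $ None - pair \<alpha> (vtail X) * Y $ None - pair \<alpha> (vtail Y) * X $ None
     - B (vtail X) (vtail Y)"

definition gramf :: "rat ^ ('n option) ^ ('n option)" where
  "gramf = (\<chi> i j. of_int (Bf (axis i 1) (axis j 1)))"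

lemma m_div_\<Delta>: "of_int m / of_int \<Delta> = 2 * of_int mt + ext_form B \<alpha> \<alpha>"
  using hm \<Delta>_nonzero by (simp add: ext_quad_def field_simps)

lemma axis_None [simp]: "axis None (1::int) $ None = 1" "vtail (axis None (1::int)) = 0"
  and axis_Some [simp]: "axis (Some i) (1::int) $ None = 0" "vtail (axis (Some i) (1::int)) = axis i 1"
  by (simp_all add: vec_eq_iff axis_def)

lemma pair_\<alpha>_0 [simp]: "pair \<alpha> 0 = 0"
  by (simp add: pair_def ext_form_def)

lemma B_0 [simp]: "B 0 y = 0" "B y 0 = 0"
  using B_add_left[of 0 0 y] B_add_right[of y 0 0] by simp_all

lemma gramf_simps:
  "gramf $ None $ None = 2 * of_int mt"
  "gramf $ None $ Some i = - ext_form B \<alpha> (emb (axis i 1))"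
  "gramf $ Some i $ None = - ext_form B \<alpha> (emb (axis i 1))"
  "gramf $ Some i $ Some k = - gram $ i $ k"
  by (simp_all add: gramf_def Bf_def of_int_pair[OF \<alpha>] gram_def)

lemma ext_form_axis: "ext_form B x y = (\<Sum>i\<in>UNIV. y $ i * ext_form B x (emb (axis i 1)))"
proof -
  have "ext_form B x (emb (axis i 1)) = (\<Sum>j\<in>UNIV. x $ j * of_int (B (axis j 1) (axis i 1)))" for i
    using gram_mult[of x i] by (simp add: gram_def matrix_vector_mult_def B_sym[of "axis i 1"] mult.commute)
  then show ?thesis
    unfolding ext_form_def by (subst sum.swap) (simp add: sum_distrib_left mult_ac)
qed

lemma sum_UNIV_option: "(\<Sum>i\<in>(UNIV :: 'n option set). f i) = f None + (\<Sum>i\<in>UNIV. f (Some i))"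
  by (simp add: UNIV_option_conv sum.reindex)

text \<open>Subtracting \<alpha>-multiples of the lattice rows from the row \<open>None\<close>
  turns it into \<open>(m / \<Delta>, 0, ..., 0)\<close>. The remaining block is the negative Gram
  matrix, of determinant \<open>- \<Delta>\<close> because the rank is odd.\<close>

lemma det_gramf: "det gramf = - of_int m"
proof -
  let ?x = "\<chi> i. case i of None \<Rightarrow> 1 | Some i \<Rightarrow> - \<alpha> $ i"
  let ?A = "\<chi> i. if i = None then \<Sum>i\<in>UNIV. ?x $ i *s row i gramf else row i gramf"
  have "ext_form B \<alpha> \<alpha> = (\<Sum>i\<in>UNIV. \<alpha> $ i * ext_form B \<alpha> (emb (axis i 1)))"
    by (rule ext_form_axis)
  then have 1: "?A $ None $ None = of_int m / of_int \<Delta>"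
    by (simp add: sum_UNIV_option row_def gramf_simps m_div_\<Delta> sum_negf)
  have "(\<Sum>i\<in>UNIV. \<alpha> $ i * gram $ i $ j) = ext_form B \<alpha> (emb (axis j 1))" for j
    using gram_mult[of \<alpha> j] by (simp add: gram_def matrix_vector_mult_def B_sym[of "axis j 1"] mult.commute)
  then have 2: "?A $ None $ Some j = 0" for j
    by (simp add: sum_UNIV_option row_def gramf_simps)
  have "det gramf = det ?A" using cramer_lemma_transpose[of None ?x gramf] by simp
  also have "\<dots> = of_int m / of_int \<Delta> * det (\<chi> i j. ?A $ Some i $ Some j)"
    using det_option[of ?A] 1 2 by simp
  also have "(\<chi> i j. ?A $ Some i $ Some j) = - gram"
    by (simp add: vec_eq_iff row_def gramf_simps)
  finally show ?thesis using odd_rank \<Delta>_nonzero by (simp add: det_uminus det_gram)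
qed

lemma lat_det_Bf: "lat_det Bf = - m"
proof -
  have "rat_of_int (lat_det Bf) = of_int (- m)"
    using det_gramf by (simp add: lat_det_def of_int_det gramf_def)
  then show ?thesis by (simp only: of_int_eq_iff)
qed

text \<open>Cramer's rule for the Gram matrix of \<open>Bf\<close>, whose determinant is \<open>- m\<close>.\<close>

lemma lat_span:
  assumes \<delta>: "\<delta> \<in> dual_lattice B" and l: "of_int l = of_int \<Delta> * (of_int s + ext_form B \<alpha> \<delta>)"
  obtains z where "of_int m *s \<delta> - of_int l *s \<alpha> = emb z"
proof (rule int_combinationI)
  fix k
  let ?w = "of_int m *s \<delta> - of_int l *s \<alpha>"
  have mn: "rat_of_int m \<noteq> 0" using m_nonzero by simp
  \<comment> \<open>The rational solution of the system with matrix \<open>gramf\<close> and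
    integral right-hand side \<open>?b\<close>. Cramer's rule makes \<open>m\<close> times it
    integral, and the components of that multiple are \<open>l\<close> and
    \<open>?w\<close>.\<close>
  define x where "x = (\<chi> i. case i of None \<Rightarrow> of_int l / of_int m | Some i \<Rightarrow> ?w $ i / rat_of_int m)"
  have mx: "of_int m * x $ None = of_int l" "of_int m * x $ Some i = ?w $ i" for i
    using mn by (simp_all add: x_def)
  let ?b = "\<lambda>i. case i of None \<Rightarrow> s | Some i \<Rightarrow> - pair \<delta> (axis i 1)"
  have lm: "of_int l * (2 * of_int mt + ext_form B \<alpha> \<alpha>) = of_int m * (of_int s + ext_form B \<alpha> \<delta>)"
    unfolding m_div_\<Delta> [symmetric] l using \<Delta>_nonzero by simp
  have rows: "of_int m * (gramf *v x) $ j = gramf $ j $ None * of_int l + (\<Sum>i\<in>UNIV. gramf $ j $ Some i * ?w $ i)" for j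
  proof -
    have "of_int m * (gramf *v x) $ j = gramf $ j $ None * (of_int m * x $ None) + (\<Sum>i\<in>UNIV. gramf $ j $ Some i * (of_int m * x $ Some i))"
      by (simp add: matrix_vector_mult_def sum_UNIV_option sum_distrib_left distrib_left mult_ac)
    then show ?thesis unfolding mx .
  qed
  have "(gramf *v x) $ None = of_int s"
  proof -
    have "of_int m * (gramf *v x) $ None = 2 * of_int mt * of_int l - ext_form B \<alpha> ?w"
      unfolding rows ext_form_axis[of \<alpha> ?w] gramf_simps by (simp add: sum_negf mult.commute)
    also have "\<dots> = of_int m * of_int s"
      using lm by (simp add: ext_form_simps algebra_simps)
    finally show ?thesis using mn by simp
  qed
  moreover have "(gramf *v x) $ Some i = - of_int (pair \<delta> (axis i 1))" for i
  proof -
    have "of_int m * (gramf *v x) $ Some i = - of_int l * ext_form B \<alpha> (emb (axis i 1)) - (gram *v ?w) $ i"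
      unfolding rows gramf_simps by (simp add: matrix_vector_mult_def sum_negf mult.commute)
    also have "\<dots> = of_int m * (- of_int (pair \<delta> (axis i 1)))"
      by (simp add: gram_mult ext_form_simps of_int_pair[OF \<delta>])
    finally show ?thesis by (simp only: mult_left_cancel[OF mn])
  qed
  ultimately have b: "(gramf *v x) $ i = of_int (?b i)" for i by (cases i) auto
  have "x $ Some k * (- of_int m) = det (\<chi> i j. if j = Some k then (gramf *v x) $ i else gramf $ i $ j)"
    by (simp only: cramer_lemma det_gramf)
  also have "\<dots> = of_int (det (\<chi> i j. if j = Some k then ?b i else Bf (axis i 1) (axis j 1)))"
    unfolding of_int_det b by (intro arg_cong[of _ _ det]) (simp add: vec_eq_iff gramf_def)
  finally have "- ?w $ k \<in> \<int>" using mx(2)[of k] by (simp add: mult.commute)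
  then show "?w $ k \<in> \<int>" by (metis Ints_minus minus_minus)
qed (rule that)

text \<open>With \<open>l = \<Delta> <\<alpha>, \<delta>>\<close> the vector
  \<open>m \<delta> - l \<alpha>\<close> lies in the lattice, and its integral product with \<delta>
  is the negative of the expression.\<close>

lemma disc_Ints:
  assumes \<delta>: "\<delta> \<in> dual_lattice B"
  shows "of_int \<Delta> * (ext_form B \<alpha> \<delta>)\<^sup>2 - of_int m * ext_form B \<delta> \<delta> \<in> \<int>"
proof -
  obtain l where l: "of_int \<Delta> * ext_form B \<alpha> \<delta> = of_int l"
    using \<Delta>_pair_Ints[OF \<alpha> \<delta>] by (auto elim: Ints_cases)
  then obtain z where z: "of_int m *s \<delta> - of_int l *s \<alpha> = emb z"
    using lat_span[OF \<delta>, of l 0] by auto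
  have "ext_form B \<delta> (emb z) = of_int m * ext_form B \<delta> \<delta> - of_int l * ext_form B \<alpha> \<delta>"
    by (simp add: z [symmetric] ext_form_simps ext_form_sym[of \<delta> \<alpha>])
  also have "\<dots> = - (of_int \<Delta> * (ext_form B \<alpha> \<delta>)\<^sup>2 - of_int m * ext_form B \<delta> \<delta>)"
    by (simp add: l [symmetric] power2_eq_square)
  finally have "- (of_int \<Delta> * (ext_form B \<alpha> \<delta>)\<^sup>2 - of_int m * ext_form B \<delta> \<delta>) \<in> \<int>"
    using dual_latticeD[OF \<delta>] by metis
  then show ?thesis using Ints_minus by fastforce
qed

text \<open>For \<open>H = (x, y)\<close> in the kernel modulo \<open>M\<close>, the vector
  \<open>\<delta> = (x \<alpha> + y) / M\<close> is in the dual lattice, so \<open>lat_span\<close>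
  makes \<open>z = m \<delta> - l \<alpha>\<close> integral for a suitable \<open>l\<close>.
  Multiplying by \<open>M\<close> gives \<open>m x = M l\<close> and
  \<open>m y = M z\<close>.\<close>

lemma kernel_Bf:
  assumes M: "M > 0" and H: "\<And>X. M dvd Bf X H"
  shows "vdvd M (m *s H)"
proof -
  let ?x = "H $ None" and ?y = "vtail H"
  define \<delta> where "\<delta> = (1 / of_int M) *s (of_int ?x *s \<alpha> + emb ?y)"
  have M\<delta>: "of_int M *s \<delta> = of_int ?x *s \<alpha> + emb ?y"
    using M by (simp add: \<delta>_def vec_eq_iff)
  have \<delta>: "\<delta> \<in> dual_lattice B"
    unfolding dual_lattice_def
  proof (clarify)
    fix z
    have "M dvd pair \<alpha> z * ?x + B ?y z"
    proof -
      have "Bf (vcons 0 z) H = - (pair \<alpha> z * ?x + B ?y z)"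
        using B_sym[of z] by (simp add: Bf_def)
      then show ?thesis using H[of "vcons 0 z"] by (metis dvd_minus_iff)
    qed
    moreover have "ext_form B \<delta> (emb z) = of_int (pair \<alpha> z * ?x + B ?y z) / of_int M"
      by (simp add: \<delta>_def ext_form_simps of_int_pair[OF \<alpha>] ext_form_emb mult.commute add_divide_distrib)
    ultimately show "ext_form B \<delta> (emb z) \<in> \<int>" using M by (simp only: Ints_of_int_div_iff)
  qed
  have "M dvd Bf (vcons 1 0) H" by (rule H)
  then obtain s where "Bf (vcons 1 0) H = M * s" by blast
  then have s: "2 * mt * ?x - pair \<alpha> ?y = M * s" by (simp add: Bf_def)
  obtain l0 where l0: "of_int \<Delta> * ext_form B \<alpha> \<delta> = of_int l0"
    using \<Delta>_pair_Ints[OF \<alpha> \<delta>] by (auto elim: Ints_cases)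
  let ?l = "\<Delta> * s + l0"
  have l: "of_int ?l = of_int \<Delta> * (of_int s + ext_form B \<alpha> \<delta>)" by (simp add: l0 distrib_left)
  obtain z where z: "of_int m *s \<delta> - of_int ?l *s \<alpha> = emb z" using lat_span[OF \<delta> l] by blast
  have "of_int m / of_int \<Delta> * of_int ?x = of_int (2 * mt * ?x) + ext_form B \<alpha> (of_int ?x *s \<alpha>)"
    by (simp add: m_div_\<Delta> ext_form_simps algebra_simps)
  also have "of_int ?x *s \<alpha> = of_int M *s \<delta> - emb ?y" by (simp add: M\<delta>)
  also have "of_int (2 * mt * ?x) + ext_form B \<alpha> (of_int M *s \<delta> - emb ?y) = of_int (M * s) + of_int M * ext_form B \<alpha> \<delta>"
    unfolding s [symmetric] by (simp add: ext_form_simps of_int_pair[OF \<alpha>])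
  finally have "of_int m * of_int ?x = of_int M * (of_int \<Delta> * (of_int s + ext_form B \<alpha> \<delta>))"
    using \<Delta>_nonzero by (simp add: field_simps)
  then have "rat_of_int (m * ?x) = of_int (M * ?l)" by (simp only: l [symmetric] of_int_mult)
  then have mx: "m * ?x = M * ?l" by (simp only: of_int_eq_iff)
  have my: "m * H $ Some i = M * z $ i" for i
  proof -
    have "emb (M *s z) = of_int M *s (of_int m *s \<delta> - of_int ?l *s \<alpha>)" by (simp only: emb_smult z)
    also have "\<dots> = of_int m *s (of_int M *s \<delta>) - of_int (M * ?l) *s \<alpha>"
      by (simp add: vec_eq_iff algebra_simps)
    also have "\<dots> = emb (m *s ?y)"
      unfolding M\<delta> mx [symmetric] by (simp add: emb_smult vec_eq_iff algebra_simps)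
    finally have "emb (M *s z) $ i = emb (m *s ?y) $ i" by simp
    then have "rat_of_int (M * z $ i) = of_int (m * H $ Some i)" by (simp add: emb_def)
    then show ?thesis by (simp only: of_int_eq_iff)
  qed
  show ?thesis unfolding vdvd_def
  proof
    show "M dvd (m *s H) $ i" for i using mx my by (cases i) simp_all
  qed
qed

end

section \<open>Critical points of the polynomial and the discriminant
  \<open>l^2 - m n\<close>\<close>

locale lat_data = lat_alpha B \<alpha> m mt for B :: "int ^ 'n \<Rightarrow> int ^ 'n \<Rightarrow> int" and \<alpha> m mt +
  fixes \<beta> :: "rat ^ 'n" and n l nt lt :: int
  assumes \<beta>: "\<beta> \<in> dual_lattice B"
    and hn: "of_int n = 2 * of_int (lat_det B) * (of_int nt + ext_quad B \<beta>)"
    and hl: "of_int l = of_int (lat_det B) * (of_int lt + ext_form B \<alpha> \<beta>)"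
begin

definition Qf :: "int ^ ('n option) \<Rightarrow> int" where
  "Qf X = mt * (X $ None)\<^sup>2 - pair \<alpha> (vtail X) * X $ None - q (vtail X)"

definition bf :: "int ^ ('n option) \<Rightarrow> int" where
  "bf X = pair \<beta> (vtail X) - lt * X $ None"

sublocale quad_poly Bf Qf bf nt
proof
  show "Bf (X + Y) Z = Bf X Z + Bf Y Z" for X Y Z
    by (simp add: Bf_def pair_add[OF \<alpha>] B_add_left algebra_simps)
  show "Bf X Y = Bf Y X" for X Y
    using B_sym[of "vtail X"] by (simp add: Bf_def)
  show "2 * Qf X = Bf X X" for X
    unfolding Bf_def q_B [symmetric] by (simp add: Qf_def power2_eq_square)
  show "bf (X + Y) = bf X + bf Y" for X Y
    by (simp add: bf_def pair_add[OF \<beta>] algebra_simps)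
qed

text \<open>This vanishes at the critical point of the polynomial over \<open>\<rat>\<close>.\<close>

definition res :: "int ^ ('n option) \<Rightarrow> rat ^ 'n" where
  "res X = \<beta> - of_int (X $ None) *s \<alpha> - emb (vtail X)"

lemma grad_tail: "of_int (grad X (vcons 0 y)) = ext_form B (res X) (emb y)"
  by (simp add: grad_def Bf_def bf_def res_def ext_form_simps ext_form_emb of_int_pair[OF \<alpha>] of_int_pair[OF \<beta>] mult.commute)

lemma grad_head: "of_int (grad X (vcons 1 0)) = (of_int m * of_int (X $ None) - of_int l) / of_int \<Delta> + ext_form B \<alpha> (res X)"
proof -
  have "pair \<beta> 0 = 0" by (simp add: pair_def ext_form_def)
  moreover have "of_int l / of_int \<Delta> = of_int lt + ext_form B \<alpha> \<beta>" using \<Delta>_nonzero by (simp add: hl)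
  ultimately show ?thesis
    using m_div_\<Delta> by (simp add: grad_def Bf_def bf_def res_def diff_divide_distrib ext_form_simps of_int_pair[OF \<alpha>] flip: times_divide_eq_left) (simp add: algebra_simps)
qed

lemma grad_split: "grad X H = H $ None * grad X (vcons 1 0) + grad X (vcons 0 (vtail H))"
proof -
  have "H = H $ None *s vcons 1 0 + vcons 0 (vtail H)"
    by (simp add: vec_eq_iff vcons_def split: option.split)
  then show ?thesis by (metis grad_add grad_smult)
qed

text \<open>Completion of the square in \<open>y\<close>, doubled and multiplied by \<Delta> to
  clear the denominators of \<open>m\<close>, \<open>l\<close> and \<open>n\<close>.\<close>

lemma F_res:
  "2 * of_int \<Delta> * of_int (F X) =
    of_int m * (of_int (X $ None))\<^sup>2 - 2 * of_int l * of_int (X $ None) + of_int n - of_int \<Delta> * ext_form B (res X) (res X)"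
  unfolding hm hn hl
  by (simp add: F_def Qf_def bf_def res_def ext_form_simps of_int_pair[OF \<alpha>] of_int_pair[OF \<beta>] ext_form_emb
        ext_quad_def ext_form_sym[of \<beta> \<alpha>] ext_form_sym[of "emb _" \<alpha>] ext_form_sym[of "emb _" \<beta>] q_B [symmetric] algebra_simps power2_eq_square)

text \<open>Divisibility in the lattice directions gives \<open>res X = P \<delta>\<close> with
  \<delta> in the dual lattice; in the remaining direction it makes \<open>m x - l\<close> equal to
  \<open>\<Delta> P (s - <\<alpha>, \<delta>>)\<close>. Substitution into
  \<open>l^2 - m n = (m x - l)^2 - m (m x^2 - 2 l x + n)\<close> together with \<open>F_res\<close>
  leaves \<open>P^2\<close> times an expression whose integrality is
  \<open>disc_Ints\<close>.\<close>

lemma grad_disc: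
  assumes P: "P > 0" and X: "\<And>H. P dvd grad X H"
  shows "\<exists>k. l\<^sup>2 - m * n = \<Delta> * (P\<^sup>2 * k - 2 * m * F X)"
proof -
  define \<delta> where "\<delta> = (1 / of_int P) *s res X"
  have r: "res X = of_int P *s \<delta>" using P by (simp add: \<delta>_def vec_eq_iff)
  have \<delta>: "\<delta> \<in> dual_lattice B"
    unfolding dual_lattice_def
  proof clarify
    fix z
    have "ext_form B \<delta> (emb z) = of_int (grad X (vcons 0 z)) / of_int P"
      by (simp add: grad_tail \<delta>_def ext_form_simps)
    then show "ext_form B \<delta> (emb z) \<in> \<int>" using P X by (simp only: Ints_of_int_div_iff)
  qed
  obtain s where s: "grad X (vcons 1 0) = P * s" using X by blast
  let ?x = "rat_of_int (X $ None)" and ?a = "ext_form B \<alpha> \<delta>" and ?d = "ext_form B \<delta> \<delta>"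
    and ?D = "rat_of_int \<Delta>" and ?P = "rat_of_int P"
  have h: "of_int m * ?x - of_int l = ?D * ?P * (of_int s - ?a)"
  proof -
    have "(of_int m * ?x - of_int l) / ?D = ?P * (of_int s - ?a)"
      using grad_head[of X] unfolding s r by (simp add: ext_form_simps algebra_simps)
    then show ?thesis using \<Delta>_nonzero by (simp add: field_simps)
  qed
  obtain k1 where k1: "?D * ?a\<^sup>2 - of_int m * ?d = of_int k1"
    using disc_Ints[OF \<delta>] by (auto elim: Ints_cases)
  obtain k2 where k2: "?D * ?a = of_int k2"
    using \<Delta>_pair_Ints[OF \<alpha> \<delta>] by (auto elim: Ints_cases)
  have "rat_of_int (l\<^sup>2 - m * n) = (of_int m * ?x - of_int l)\<^sup>2
      - of_int m * (of_int m * ?x\<^sup>2 - 2 * of_int l * ?x + of_int n)"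
    by (simp add: power2_eq_square algebra_simps)
  also have "of_int m * ?x\<^sup>2 - 2 * of_int l * ?x + of_int n = 2 * ?D * of_int (F X) + ?D * (?P\<^sup>2 * ?d)"
    using F_res[of X] unfolding r by (simp add: ext_form_simps power2_eq_square mult.assoc)
  also have "(of_int m * ?x - of_int l)\<^sup>2 - of_int m * (2 * ?D * of_int (F X) + ?D * (?P\<^sup>2 * ?d))
      = ?D * (?P\<^sup>2 * (?D * (of_int s)\<^sup>2 - 2 * (?D * ?a) * of_int s + (?D * ?a\<^sup>2 - of_int m * ?d)) - 2 * of_int m * of_int (F X))"
    unfolding h by (simp add: power2_eq_square algebra_simps)
  also have "\<dots> = rat_of_int (\<Delta> * (P\<^sup>2 * (\<Delta> * s\<^sup>2 - 2 * k2 * s + k1) - 2 * m * F X))"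
    unfolding k1 k2 by simp
  finally show ?thesis by (simp only: of_int_eq_iff) blast
qed

lemma \<Delta>_dvd_disc: "\<Delta> dvd l\<^sup>2 - m * n"
  \<comment> \<open>Modulo \<open>P = 1\<close> every point is critical.\<close>
  using grad_disc[of 1 0] by auto

text \<open>The critical point over the rationals is \<open>(l, m \<beta> - l \<alpha>) / m\<close>,
  and by \<open>lat_span\<close> its numerator is integral. Replacing \<open>1 / m\<close> by the
  inverse \<open>mb\<close> modulo \<open>M\<close> leaves an error with factor
  \<open>1 - m * mb\<close>.\<close>

lemma critical_point:
  assumes mb: "M dvd m * mb - 1"
  obtains X0 where "\<And>H. M dvd grad X0 H"
proof -
  obtain z where z: "of_int m *s \<beta> - of_int l *s \<alpha> = emb z"
    using lat_span[OF \<beta> hl] by blast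
  let ?X = "vcons (mb * l) (mb *s z)"
  have r: "res ?X = of_int (1 - m * mb) *s \<beta>"
    by (simp add: res_def emb_smult z [symmetric] vec_eq_iff algebra_simps)
  have "rat_of_int (grad ?X (vcons 0 y)) = of_int ((1 - m * mb) * pair \<beta> y)" for y
    by (simp only: grad_tail r ext_form_simps of_int_pair[OF \<beta>] of_int_mult)
  then have 0: "grad ?X (vcons 0 y) = (1 - m * mb) * pair \<beta> y" for y by (simp only: of_int_eq_iff)
  have "rat_of_int (grad ?X (vcons 1 0)) = of_int ((m * mb - 1) * lt)"
  proof -
    have "rat_of_int (grad ?X (vcons 1 0)) = of_int (m * mb - 1) * (of_int l / of_int \<Delta>) + of_int (1 - m * mb) * ext_form B \<alpha> \<beta>"
      unfolding grad_head r by (simp add: ext_form_simps algebra_simps diff_divide_distrib)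
    also have "of_int l / of_int \<Delta> = of_int lt + ext_form B \<alpha> \<beta>" using \<Delta>_nonzero by (simp add: hl)
    finally show ?thesis by (simp add: algebra_simps)
  qed
  then have 1: "grad ?X (vcons 1 0) = (m * mb - 1) * lt" by (simp only: of_int_eq_iff)
  have mb': "M dvd 1 - m * mb" using mb by (simp add: dvd_diff_commute)
  have "M dvd grad ?X H" for H
    unfolding grad_split[of ?X H] 0 1 using mb mb' by simp
  then show ?thesis by (rule that)
qed

end

section \<open>Local evaluation\<close>

lemma mform_gram:
  assumes add: "\<And>X Y Z. Bf (X + Y) Z = Bf X Z + Bf Y Z" and sym: "\<And>X Y. Bf X Y = Bf Y (X :: int ^ 'k)"
  shows "mform (\<chi> i j. Bf (axis i 1) (axis j 1)) X = Bf X X"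
proof -
  have add': "Bf Z (X + Y) = Bf Z X + Bf Z Y" for X Y Z using add sym by metis
  have "Bf X X = (\<Sum>i\<in>UNIV. X $ i * Bf (axis i 1) X)" by (rule additive_basis) (rule add)
  moreover have "Bf (axis i 1) X = (\<Sum>j\<in>UNIV. X $ j * Bf (axis i 1) (axis j 1))" for i
    by (rule additive_basis) (rule add')
  ultimately show ?thesis by (simp add: mform_def sum_distrib_left mult_ac)
qed

lemma (in odd_prime) gauss_form:
  assumes add: "\<And>X Y Z. Bf (X + Y) Z = Bf X Z + Bf Y Z" and sym: "\<And>X Y. Bf X Y = Bf Y (X :: int ^ 'k)"
    and det: "\<not> p dvd lat_det Bf" and d: "\<not> p dvd d"
  shows "(\<Sum>X\<in>reps_mod (p ^ j). ec (p ^ j) (d * Bf X X)) =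
    of_int (Legendre (d ^ CARD('k) * lat_det Bf) p) ^ j * gauss 1 j ^ CARD('k)"
proof -
  let ?A = "\<chi> i j. Bf (axis i 1) (axis j 1)"
  have "transpose ?A = ?A" using sym by (simp add: transpose_def vec_eq_iff)
  then show ?thesis
    using gauss_matrix[of ?A d j] det d by (simp add: mform_gram[of Bf, OF add sym] lat_det_def)
qed

lemma (in odd_prime) half_mod: obtains u where "p ^ j dvd 2 * u - 1" "\<not> p dvd u \<or> j = 0"
proof -
  have "coprime 2 (p ^ j)" using odd_p by simp
  then obtain u where "[2 * u = 1] (mod p ^ j)" using cong_solve_coprime_int by blast
  then have u: "p ^ j dvd 2 * u - 1" by (simp add: cong_iff_dvd_diff)
  have "\<not> p dvd u" if "j \<noteq> 0"
  proof
    assume "p dvd u"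
    moreover have "p dvd 2 * u - 1" using that u by (metis dvd_power dvd_trans neq0_conv)
    ultimately have "p dvd 1" by (metis dvd_diff_right_iff dvd_mult)
    then show False by simp
  qed
  then show ?thesis using that u by blast
qed

lemma (in odd_prime) sum_ramanujan:
  "(\<Sum>i\<le>j. ramanujan (p ^ i) z) = (if p ^ j dvd z then of_int (p ^ j) else 0)"
proof (induction j)
  case (Suc j)
  show ?case unfolding sum.atMost_Suc Suc ramanujan_prime_power[OF prime_p] by (simp only: add_diff_eq add_diff_cancel_left')
qed simp

context lat_data
begin

text \<open>Half the number \<open>g + 1\<close> of variables, an integer because the rank is odd. A
  unimodular Gauss sum to the modulus \<open>C\<close> in these variables has absolute value
  \<open>C ^ h\<close>.\<close>

definition h :: nat where "h = (CARD('n) + 1) div 2"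

lemma h_even: "2 * h = CARD('n option)" "CARD('n) = 2 * (h - 1) + 1" "h \<ge> 1" "(CARD('n) - 1) div 2 = h - 1"
  using odd_rank by (auto simp: h_def card_UNIV_option elim!: oddE)

lemma Legendre_m_L:
  assumes "odd_prime p"
  shows "Legendre (m_L B m) p = Legendre (- 1) p ^ (h - 1) * Legendre m p"
proof -
  interpret odd_prime p by fact
  have "Legendre 4 p = 1" using Legendre_mult[of 2 2] Legendre_square[OF not_dvd_2] by simp
  then have "Legendre (- 4) p = Legendre (- 1) p" using Legendre_mult[of "- 1" 4] by simp
  then show ?thesis by (simp add: m_L_def h_even Legendre_mult Legendre_power)
qed

text \<open>Scaling the form by a unit multiplies the determinant by a \<open>2 * h\<close>-th
  power, so the inner sum is the same for every \<open>d\<close>. Its symbol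
  \<open>(-m / p) (-1 / p) ^ h\<close> equals \<open>(m_L / p)\<close>, and the remaining sum over
  \<open>d\<close> is a Ramanujan sum at the critical value.\<close>

lemma T_unit:
  assumes p: "odd_prime p" and pm: "\<not> p dvd m" and X0: "\<And>H. p ^ j dvd grad X0 H"
  shows "T (p ^ j) = of_int (Legendre (m_L B m) p) ^ j * of_int p ^ (j * h) * ramanujan (p ^ j) (F X0)"
proof (cases "j = 0")
  case True
  then show ?thesis by simp
next
  case False
  interpret odd_prime p by fact
  have M: "p ^ j > 0" using p_gt_0 by simp
  obtain u where u: "p ^ j dvd 2 * u - 1" "\<not> p dvd u" using half_mod False by metis
  have G: "(\<Sum>X\<in>reps_mod (p ^ j). ec (p ^ j) (d * Qf X)) =
      of_int (Legendre (m_L B m) p) ^ j * of_int p ^ (j * h)" if d: "coprime d (p ^ j)" for d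
  proof -
    have d': "\<not> p dvd d" using d False by (simp add: coprime_iff)
    have "(\<Sum>X\<in>reps_mod (p ^ j). ec (p ^ j) (d * Qf X)) = (\<Sum>X\<in>reps_mod (p ^ j). ec (p ^ j) (d * u * Bf X X))"
    proof (intro sum.cong[OF HOL.refl] ec_dvd_diff)
      fix X
      have "d * Qf X - d * u * Bf X X = - (d * Qf X) * (2 * u - 1)"
        unfolding Bf_Q [symmetric] by (simp add: algebra_simps)
      then show "p ^ j dvd d * Qf X - d * u * Bf X X" using u(1) by (simp only: dvd_mult)
    qed
    also have "\<dots> = of_int (Legendre ((d * u) ^ (2 * h) * - m) p) ^ j * (gauss 1 j)\<^sup>2 ^ h"
    proof -
      have "\<not> p dvd d * u" using d' u(2) dvd_mult_iff by blast
      moreover have "\<not> p dvd lat_det Bf" using pm by (simp add: lat_det_Bf)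
      ultimately have "(\<Sum>X\<in>reps_mod (p ^ j). ec (p ^ j) (d * u * Bf X X)) =
          of_int (Legendre ((d * u) ^ CARD('n option) * lat_det Bf) p) ^ j * gauss 1 j ^ CARD('n option)"
        by (intro gauss_form[of Bf, OF Bf_add_left Bf_sym])
      then show ?thesis unfolding h_even(1) [symmetric] lat_det_Bf power_mult[of "gauss 1 j"] .
    qed
    also have "Legendre ((d * u) ^ (2 * h) * - m) p = Legendre (- m) p"
      using Legendre_square[of "d * u"] d' u(2) dvd_mult_iff[of d u]
      by (simp only: Legendre_mult Legendre_power power_mult) (simp add: power2_eq_square)
    also have "of_int (Legendre (- m) p) ^ j * (gauss 1 j)\<^sup>2 ^ h =
        of_int (Legendre (- m) p * Legendre (- 1) p ^ h) ^ j * (of_int p ^ (j * h) :: complex)"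
      by (simp add: gauss_square power_mult_distrib power_mult [symmetric] mult.commute)
    also have "Legendre (- m) p * Legendre (- 1) p ^ h = Legendre (m_L B m) p"
    proof -
      obtain h' where h': "h = Suc h'" using h_even(3) by (cases h) auto
      have "Legendre (- m) p = Legendre (- 1) p * Legendre m p" using Legendre_mult[of "- 1" m] by simp
      moreover have "Legendre (- 1) p * Legendre (- 1) p = 1" by (simp add: Legendre_minus_1_mod_4)
      ultimately show ?thesis unfolding Legendre_m_L[OF p] h' by (simp add: mult_ac)
    qed
    finally show ?thesis .
  qed
  have "T (p ^ j) = (\<Sum>d\<in>units_mod (p ^ j). ec (p ^ j) (d * F X0) * (\<Sum>X\<in>reps_mod (p ^ j). ec (p ^ j) (d * Qf X)))"
    unfolding T_altdef by (intro sum.cong[OF HOL.refl] sum_critical_point[OF M X0])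
  also have "\<dots> = (\<Sum>d\<in>units_mod (p ^ j). ec (p ^ j) (d * F X0) * (of_int (Legendre (m_L B m) p) ^ j * of_int p ^ (j * h)))"
    by (intro sum.cong[OF HOL.refl]) (simp add: G units_mod_def)
  finally show ?thesis by (simp add: ramanujan_def sum_distrib_left mult_ac)
qed

definition disc :: int where "disc = (l\<^sup>2 - m * n) div \<Delta>"

lemma disc: "l\<^sup>2 - m * n = \<Delta> * disc"
  using \<Delta>_dvd_disc by (simp add: disc_def)

text \<open>The factor at \<open>p\<close> of the Dirichlet convolution that Fourier inversion in \<open>v\<close> produces.\<close>

definition Xi_local :: "int \<Rightarrow> nat \<Rightarrow> complex" where
  "Xi_local p j = (\<Sum>i\<le>j. of_int (kronecker_prime (m_L B m) p) ^ (j - i) * T (p ^ i) / of_int p ^ (i * h)) / of_int p ^ j"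

lemma Xi_local_unit:
  assumes p: "odd_prime p" and pm: "\<not> p dvd m"
  shows "Xi_local p j = (if p ^ j dvd disc then of_int (Legendre (m_L B m) p) ^ j else 0)"
proof -
  interpret odd_prime p by fact
  have M: "p ^ j > 0" using p_gt_0 by simp
  have "coprime m (p ^ j)" using pm by (simp add: coprime_iff)
  then obtain mb where "[m * mb = 1] (mod p ^ j)" using cong_solve_coprime_int by blast
  then have "p ^ j dvd m * mb - 1" by (simp add: cong_iff_dvd_diff)
  then obtain X0 where X0: "\<And>H. p ^ j dvd grad X0 H" using critical_point by blast
  have kp: "kronecker_prime (m_L B m) p = Legendre (m_L B m) p"
    using odd_p by (auto simp: kronecker_prime_def)
  let ?\<chi> = "of_int (Legendre (m_L B m) p) :: complex"
  have "?\<chi> ^ (j - i) * T (p ^ i) / of_int p ^ (i * h) = ?\<chi> ^ j * ramanujan (p ^ i) (F X0)" if "i \<le> j" for i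
  proof -
    have "p ^ i dvd grad X0 H" for H using X0 le_imp_power_dvd[OF that] dvd_trans by blast
    then have "T (p ^ i) = ?\<chi> ^ i * of_int p ^ (i * h) * ramanujan (p ^ i) (F X0)"
      by (rule T_unit[OF p pm])
    moreover have "?\<chi> ^ (j - i) * ?\<chi> ^ i = ?\<chi> ^ j" using that by (simp flip: power_add)
    ultimately show ?thesis using p_gt_0 by (simp add: mult.assoc [symmetric])
  qed
  then have "Xi_local p j = ?\<chi> ^ j * (\<Sum>i\<le>j. ramanujan (p ^ i) (F X0)) / of_int p ^ j"
    unfolding Xi_local_def kp by (simp add: sum_distrib_left)
  also have "\<dots> = (if p ^ j dvd F X0 then ?\<chi> ^ j else 0)"
    using p_gt_0 by (simp add: sum_ramanujan)
  \<comment> \<open>By \<open>grad_disc\<close>, \<open>disc\<close> is congruent to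
    \<open>- 2 m F X0\<close> modulo \<open>p ^ j\<close>, and \<open>2 m\<close> is
    invertible.\<close>
  also have "p ^ j dvd F X0 \<longleftrightarrow> p ^ j dvd disc"
  proof -
    obtain k where "l\<^sup>2 - m * n = \<Delta> * ((p ^ j)\<^sup>2 * k - 2 * m * F X0)"
      using grad_disc[OF M X0] by blast
    then have D: "disc = p ^ j * (p ^ j * k) - 2 * m * F X0"
      using \<Delta>_nonzero by (simp add: disc_def power2_eq_square mult.assoc)
    have "coprime (p ^ j) (2 * m)" using pm odd_p by (simp add: coprime_commute[of _ "2 * m"] coprime_commute[of p] coprime_iff)
    then have "p ^ j dvd F X0 \<longleftrightarrow> p ^ j dvd 2 * m * F X0" by (simp add: coprime_dvd_mult_right_iff)
    also have "\<dots> \<longleftrightarrow> p ^ j dvd disc" unfolding D by (metis dvd_diff_right_iff dvd_triv_left)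
    finally show ?thesis .
  qed
  finally show ?thesis .
qed

section \<open>Primes dividing \<open>m\<close> but not \<Delta>\<close>

lemma tail_shift:
  assumes D: "M dvd \<Delta> * Db - 1"
  obtains y0 where "\<And>x y. M dvd F (vcons x (y + y0 x)) - (F (vcons x (y0 x)) - q y)"
    "\<And>x. M dvd 2 * \<Delta> * F (vcons x (y0 x)) - (m * x\<^sup>2 - 2 * l * x + n)"
proof -
  obtain za where za: "of_int \<Delta> *s \<alpha> = emb za" using \<Delta>_dual[OF \<alpha>] by blast
  obtain zb where zb: "of_int \<Delta> *s \<beta> = emb zb" using \<Delta>_dual[OF \<beta>] by blast
  \<comment> \<open>An integral substitute for \<open>\<beta> - x \<alpha>\<close>, the critical
    point in \<open>y\<close> alone: \<open>za\<close> and \<open>zb\<close> are \<Delta> times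
    \<alpha> and \<beta>, and \<open>Db\<close> inverts \<Delta> modulo \<open>M\<close>.\<close>
  define y0 where "y0 x = Db *s zb - (x * Db) *s za" for x
  let ?e = "1 - \<Delta> * Db"
  have e: "M dvd ?e" using D by (simp add: dvd_diff_commute)
  have res0: "res (vcons x (y0 x)) = of_int ?e *s (\<beta> - of_int x *s \<alpha>)" for x
    by (simp add: res_def y0_def emb_diff emb_smult za [symmetric] zb [symmetric] vec_eq_iff algebra_simps)
  have "M dvd F (vcons x (y + y0 x)) - (F (vcons x (y0 x)) - q y)" for x y
  proof -
    have "rat_of_int (grad (vcons x (y0 x)) (vcons 0 y)) = of_int (?e * (pair \<beta> y - x * pair \<alpha> y))"
      by (simp only: grad_tail res0 ext_form_simps of_int_mult of_int_diff of_int_pair[OF \<alpha>] of_int_pair[OF \<beta>])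
    then have g: "grad (vcons x (y0 x)) (vcons 0 y) = ?e * (pair \<beta> y - x * pair \<alpha> y)"
      by (simp only: of_int_eq_iff)
    have "vcons x (y + y0 x) = vcons x (y0 x) + vcons 0 y"
      by (simp add: vec_eq_iff vcons_def split: option.split)
    then have "F (vcons x (y + y0 x)) - (F (vcons x (y0 x)) - q y) = ?e * (pair \<beta> y - x * pair \<alpha> y)"
      by (simp add: F_add g Qf_def)
    then show ?thesis using e by (metis dvd_mult2)
  qed
  moreover have "M dvd 2 * \<Delta> * F (vcons x (y0 x)) - (m * x\<^sup>2 - 2 * l * x + n)" for x
  proof -
    let ?\<gamma> = "\<beta> - of_int x *s \<alpha>"
    have "?\<gamma> = \<beta> + of_int (- x) *s \<alpha>" by (simp add: vec_eq_iff)
    then have "?\<gamma> \<in> dual_lattice B" using dual_add[OF \<beta> dual_smult[OF \<alpha>]] by (simp only:)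
    then obtain k where k: "of_int \<Delta> * ext_form B ?\<gamma> ?\<gamma> = of_int k"
      using \<Delta>_pair_Ints by (metis Ints_cases)
    have "rat_of_int (2 * \<Delta> * F (vcons x (y0 x))) = of_int (m * x\<^sup>2 - 2 * l * x + n) - (of_int ?e)\<^sup>2 * (of_int \<Delta> * ext_form B ?\<gamma> ?\<gamma>)"
      using F_res[of "vcons x (y0 x)"] unfolding res0 ext_form_smult_left ext_form_smult_right
      by (simp add: power2_eq_square mult_ac)
    also have "\<dots> = of_int (m * x\<^sup>2 - 2 * l * x + n - ?e\<^sup>2 * k)" unfolding k by simp
    finally have "2 * \<Delta> * F (vcons x (y0 x)) = m * x\<^sup>2 - 2 * l * x + n - ?e\<^sup>2 * k"
      by (simp only: of_int_eq_iff)
    then have "2 * \<Delta> * F (vcons x (y0 x)) - (m * x\<^sup>2 - 2 * l * x + n) = ?e * (- (?e * k))"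
      by (simp add: power2_eq_square mult.assoc)
    then show ?thesis using e by (metis dvd_mult2)
  qed
  ultimately show ?thesis by (rule that)
qed

lemma sum_tail:
  assumes p: "odd_prime p" and pD: "\<not> p dvd \<Delta>" and d: "\<not> p dvd d" and j: "j > 0"
    and y0: "\<And>x y. p ^ j dvd F (vcons x (y + y0 x)) - (F (vcons x (y0 x)) - q y)"
    and u: "p ^ j dvd 2 * u - 1" "\<not> p dvd u"
  shows "(\<Sum>y\<in>reps_mod (p ^ j). ec (p ^ j) (d * F (vcons x y))) =
    ec (p ^ j) (d * F (vcons x (y0 x))) *
    (of_int (Legendre ((- d * u) ^ CARD('n) * \<Delta>) p) ^ j * odd_prime.gauss p 1 j ^ CARD('n))"
proof -
  interpret odd_prime p by fact
  let ?M = "p ^ j"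
  have M: "?M > 0" using p_gt_0 by simp
  have "(\<Sum>y\<in>reps_mod ?M. ec ?M (d * F (vcons x y))) = (\<Sum>y\<in>reps_mod ?M. ec ?M (d * F (vcons x (y + y0 x))))"
  proof (rule sum_reps_shift[symmetric])
    fix y z :: "int ^ 'n" assume "vdvd ?M (y - z)"
    then have "vdvd ?M (vcons x y - vcons x z)"
      by (simp add: vdvd_def vcons_def split: option.split)
    then show "ec ?M (d * F (vcons x y)) = ec ?M (d * F (vcons x z))" by (rule ec_F_cong)
  qed (rule M)
  also have "\<dots> = (\<Sum>y\<in>reps_mod ?M. ec ?M (d * F (vcons x (y0 x)) + - d * u * B y y))"
  proof (intro sum.cong[OF HOL.refl] ec_dvd_diff)
    fix y
    have "d * F (vcons x (y + y0 x)) - (d * F (vcons x (y0 x)) + - d * u * B y y)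
        = d * (F (vcons x (y + y0 x)) - (F (vcons x (y0 x)) - q y)) + d * q y * (2 * u - 1)"
      unfolding q_B [symmetric] by (simp add: algebra_simps)
    then show "?M dvd d * F (vcons x (y + y0 x)) - (d * F (vcons x (y0 x)) + - d * u * B y y)"
      using y0[of x y] u(1) by (metis dvd_add dvd_mult)
  qed
  also have "\<dots> = ec ?M (d * F (vcons x (y0 x))) * (\<Sum>y\<in>reps_mod ?M. ec ?M (- d * u * B y y))"
    by (simp only: ec_add sum_distrib_left)
  also have "(\<Sum>y\<in>reps_mod ?M. ec ?M (- d * u * B y y)) =
      of_int (Legendre ((- d * u) ^ CARD('n) * \<Delta>) p) ^ j * gauss 1 j ^ CARD('n)"
  proof (rule gauss_form)
    show "\<not> p dvd - d * u" using d u(2) dvd_mult_iff[of "- d" u] by simp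
  qed (use B_add_left B_sym pD in auto)
  finally show ?thesis .
qed

text \<open>Eliminating \<open>y\<close> leaves \<open>(m x^2 - 2 l x + n) / (2 \<Delta>)\<close>;
  replacing \<open>d\<close> by \<open>2 \<Delta> d\<close> clears the denominator. The number of
  eliminated variables is odd, so the symbol of \<open>d\<close> survives as
  \<open>(-d / p)\<close>, while that of \<Delta> occurs to an even power.\<close>

lemma T_ramified_aux:
  assumes p: "odd_prime p" and pD: "\<not> p dvd \<Delta>" and j: "j > 0"
  shows "T (p ^ j) = odd_prime.gauss p 1 j ^ CARD('n) *
    (\<Sum>d\<in>units_mod (p ^ j). of_int (Legendre (- d) p) ^ j * (\<Sum>x\<in>{0..<p ^ j}. ec (p ^ j) (d * (m * x\<^sup>2 - 2 * l * x + n))))"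
proof -
  interpret odd_prime p by fact
  let ?M = "p ^ j"
  have M: "?M > 0" using p_gt_0 by simp
  have coD: "coprime (2 * \<Delta>) ?M" "coprime \<Delta> ?M" using pD dvd_mult_iff[of 2 \<Delta>] by (auto simp: coprime_iff)
  obtain Db where "[\<Delta> * Db = 1] (mod ?M)" using coD(2) cong_solve_coprime_int by blast
  then have "?M dvd \<Delta> * Db - 1" by (simp add: cong_iff_dvd_diff)
  then obtain y0 where y0: "\<And>x y. ?M dvd F (vcons x (y + y0 x)) - (F (vcons x (y0 x)) - q y)"
    and f: "\<And>x. ?M dvd 2 * \<Delta> * F (vcons x (y0 x)) - (m * x\<^sup>2 - 2 * l * x + n)"
    by (rule tail_shift) blast
  obtain u where u: "?M dvd 2 * u - 1" "\<not> p dvd u" using half_mod j by (metis less_irrefl)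
  define \<phi> where "\<phi> d = of_int (Legendre ((- d * u) ^ CARD('n) * \<Delta>) p) ^ j * (\<Sum>x\<in>{0..<?M}. ec ?M (d * F (vcons x (y0 x))))" for d
  have "T ?M = (\<Sum>d\<in>units_mod ?M. gauss 1 j ^ CARD('n) * \<phi> d)"
    unfolding T_altdef sum_reps_vcons
  proof (rule sum.cong[OF HOL.refl])
    fix d assume "d \<in> units_mod ?M"
    then have d: "\<not> p dvd d" using j by (auto simp: units_mod_def coprime_iff)
    show "(\<Sum>x = 0..<?M. \<Sum>y\<in>reps_mod ?M. ec ?M (d * F (vcons x y))) = gauss 1 j ^ CARD('n) * \<phi> d"
      unfolding \<phi>_def sum_distrib_left
      by (rule sum.cong[OF HOL.refl]) (simp only: sum_tail[OF p pD d j y0 u] mult_ac)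
  qed
  also have "\<dots> = gauss 1 j ^ CARD('n) * (\<Sum>d\<in>units_mod ?M. \<phi> (2 * \<Delta> * d))"
  proof -
    have "\<phi> d = \<phi> d'" if "?M dvd d - d'" for d d'
    proof -
      have "p dvd d - d'" using that j by (metis dvd_power dvd_trans)
      then have "p dvd d' - d" by (simp add: dvd_diff_commute)
      then have A: "[- d * u = - d' * u] (mod p)" by (intro cong_mult) (simp_all add: cong_iff_dvd_diff)
      have "[(- d * u) ^ CARD('n) * \<Delta> = (- d' * u) ^ CARD('n) * \<Delta>] (mod p)"
        by (rule cong_scalar_right[OF cong_pow[OF A]])
      then have 1: "Legendre ((- d * u) ^ CARD('n) * \<Delta>) p = Legendre ((- d' * u) ^ CARD('n) * \<Delta>) p"
        by (intro Legendre_cong) (simp add: cong_iff_dvd_diff)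
      have 2: "ec ?M (d * z) = ec ?M (d' * z)" for z
        using that by (intro ec_dvd_diff) (simp flip: left_diff_distrib)
      show ?thesis unfolding \<phi>_def 1 2 ..
    qed
    then have "(\<Sum>d\<in>units_mod ?M. \<phi> (2 * \<Delta> * d)) = (\<Sum>d\<in>units_mod ?M. \<phi> d)"
      using M coD by (intro sum_units_unit) auto
    then show ?thesis by (simp add: sum_distrib_left)
  qed
  also have "(\<Sum>d\<in>units_mod ?M. \<phi> (2 * \<Delta> * d)) = (\<Sum>d\<in>units_mod ?M. of_int (Legendre (- d) p) ^ j * (\<Sum>x\<in>{0..<?M}. ec ?M (d * (m * x\<^sup>2 - 2 * l * x + n))))"
  proof (rule sum.cong[OF HOL.refl])
    fix d assume "d \<in> units_mod ?M"
    then have d: "\<not> p dvd d" using j by (auto simp: units_mod_def coprime_iff)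
    have "p dvd 2 * u - 1" using u(1) j by (metis dvd_power dvd_trans)
    then have L2u: "Legendre 2 p * Legendre u p = 1" using Legendre_cong[of "2 * u" 1] by (simp add: Legendre_mult)
    have "- (2 * \<Delta> * d) * u = (- d) * \<Delta> * (2 * u)" by simp
    then have "Legendre ((- (2 * \<Delta> * d) * u) ^ CARD('n) * \<Delta>) p
        = (Legendre (- d) p * Legendre \<Delta> p) ^ CARD('n) * Legendre \<Delta> p"
      by (simp only: Legendre_mult Legendre_power L2u mult_1_right)
    also have "\<dots> = (Legendre (- d) p * Legendre (- d) p) ^ (h - 1) * (Legendre \<Delta> p * Legendre \<Delta> p) ^ h * Legendre (- d) p"
    proof -
      obtain h' where "h = Suc h'" using h_even(3) by (cases h) auto
      then show ?thesis unfolding h_even(2) by (simp add: power_mult power2_eq_square power_mult_distrib mult_ac)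
    qed
    also have "\<dots> = Legendre (- d) p" using d pD by (simp add: Legendre_square)
    finally have L: "Legendre ((- (2 * \<Delta> * d) * u) ^ CARD('n) * \<Delta>) p = Legendre (- d) p" .
    have "ec ?M (2 * \<Delta> * d * F (vcons x (y0 x))) = ec ?M (d * (m * x\<^sup>2 - 2 * l * x + n))" for x
    proof (rule ec_dvd_diff)
      have "2 * \<Delta> * d * F (vcons x (y0 x)) - d * (m * x\<^sup>2 - 2 * l * x + n)
          = d * (2 * \<Delta> * F (vcons x (y0 x)) - (m * x\<^sup>2 - 2 * l * x + n))" by (simp add: algebra_simps)
      then show "?M dvd 2 * \<Delta> * d * F (vcons x (y0 x)) - d * (m * x\<^sup>2 - 2 * l * x + n)"
        using f[of x] by (metis dvd_mult)
    qed
    then show "\<phi> (2 * \<Delta> * d) = of_int (Legendre (- d) p) ^ j * (\<Sum>x\<in>{0..<?M}. ec ?M (d * (m * x\<^sup>2 - 2 * l * x + n)))"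
      unfolding \<phi>_def L by simp
  qed
  finally show ?thesis .
qed

end

context odd_prime
begin

text \<open>Modulo \<open>p ^ j\<close> a shift of \<open>x\<close> by multiples of
  \<open>p ^ (j - 1)\<close> affects only the linear term, as \<open>p\<close> divides
  \<open>m\<close>; this is a nontrivial character as soon as \<open>p\<close> does not divide
  \<open>l\<close>.\<close>

lemma sum_linear_vanish:
  assumes j: "j > 0" and d: "\<not> p dvd d" and m: "p dvd m" and l: "\<not> p dvd l"
  shows "(\<Sum>x\<in>{0..<p ^ j}. ec (p ^ j) (d * (m * x\<^sup>2 - 2 * l * x + n))) = 0"
proof -
  obtain i where i: "j = Suc i" using j by (cases j) auto
  let ?M = "p ^ Suc i" and ?K = "p ^ i"
  let ?f = "\<lambda>x. ec ?M (d * (m * x\<^sup>2 - 2 * l * x + n))"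
  have shift: "?f (x + ?K * y) = ?f x * ec p (y * (- 2 * d * l))" for x y
  proof -
    obtain m' where m': "m = p * m'" using m by blast
    have "d * (m * (x + ?K * y)\<^sup>2 - 2 * l * (x + ?K * y) + n) - (d * (m * x\<^sup>2 - 2 * l * x + n) + ?K * (y * (- 2 * d * l)))
        = ?M * (d * m' * (2 * x * y + ?K * y\<^sup>2))"
      by (simp add: m' power2_eq_square algebra_simps)
    then have "?f (x + ?K * y) = ec ?M (d * (m * x\<^sup>2 - 2 * l * x + n) + ?K * (y * (- 2 * d * l)))"
      by (intro ec_dvd_diff) (metis dvd_triv_left)
    also have "\<dots> = ?f x * ec p (y * (- 2 * d * l))"
      unfolding ec_add power_Suc2 using ec_scale[of ?K p "y * (- 2 * d * l)"] p_gt_0 by simp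
    finally show ?thesis .
  qed
  have MK: "?M = ?K * p" by simp
  have "(\<Sum>x\<in>{0..<?K * p}. ?f x) = (\<Sum>x\<in>{0..<?K}. \<Sum>y\<in>{0..<p}. ?f (x + ?K * y))"
    by (rule sum_residues_digits) (use p_gt_0 in simp)
  also have "\<dots> = (\<Sum>x\<in>{0..<?K}. ?f x * (\<Sum>y\<in>{0..<p}. ec p (y * (- 2 * d * l))))"
    by (simp only: shift sum_distrib_left)
  also have "\<dots> = 0"
  proof -
    have "\<not> p dvd - 2 * d * l" using d l dvd_mult_iff[of "- 2 * d" l] dvd_mult_iff[of "- 2" d] by simp
    then show ?thesis by (simp only: sum_ec[OF p_gt_0] if_False mult_zero_right sum.neutral_const)
  qed
  finally show ?thesis unfolding i MK .
qed

text \<open>With a factor \<open>p\<close> common to the quadratic and linear terms, the summand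
  depends on \<open>x\<close> modulo \<open>p ^ i\<close> only, whence the factor \<open>p\<close>.
  Completing the square with the inverse \<open>mb\<close> of \<open>m'\<close> leaves a Gauss sum
  to the modulus \<open>p ^ i\<close>.\<close>

lemma sum_quadratic_ramified:
  assumes d: "\<not> p dvd d" and m': "\<not> p dvd m'" and mb: "p ^ i dvd m' * mb - 1"
  shows "(\<Sum>x\<in>{0..<p ^ Suc i}. ec (p ^ Suc i) (d * (p * m' * x\<^sup>2 - 2 * (p * l') * x + n))) =
    of_int p * ec (p ^ Suc i) (d * (n - p * mb * l'\<^sup>2)) * of_int (Legendre (d * m') p) ^ i * gauss 1 i"
proof -
  let ?M = "p ^ Suc i" and ?K = "p ^ i"
  have K: "?K > 0" using p_gt_0 by simp
  have scale: "ec ?M (p * z) = ec ?K z" for z using ec_scale[of p ?K z] p_gt_0 by simp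
  have 1: "ec ?M (d * (p * m' * x\<^sup>2 - 2 * (p * l') * x + n)) = ec ?M (d * n) * ec ?K (d * (m' * x\<^sup>2 - 2 * l' * x))" for x
  proof -
    have "d * (p * m' * x\<^sup>2 - 2 * (p * l') * x + n) = d * n + p * (d * (m' * x\<^sup>2 - 2 * l' * x))"
      by (simp add: algebra_simps)
    then show ?thesis by (simp only: ec_add scale)
  qed
  have 2: "ec ?K (d * (m' * x\<^sup>2 - 2 * l' * x)) = ec ?K (- d * mb * l'\<^sup>2) * ec ?K (d * m' * (x - mb * l')\<^sup>2)" for x
  proof -
    have "d * (m' * x\<^sup>2 - 2 * l' * x) - (- d * mb * l'\<^sup>2 + d * m' * (x - mb * l')\<^sup>2)
        = (m' * mb - 1) * (2 * d * l' * x - d * mb * l'\<^sup>2)"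
      by (simp add: power2_eq_square algebra_simps)
    then have "ec ?K (d * (m' * x\<^sup>2 - 2 * l' * x)) = ec ?K (- d * mb * l'\<^sup>2 + d * m' * (x - mb * l')\<^sup>2)"
      using mb by (intro ec_dvd_diff) (metis dvd_mult2)
    then show ?thesis by (simp only: ec_add)
  qed
  have g: "(\<Sum>x\<in>{0..<?K}. ec ?K (d * m' * (x - mb * l')\<^sup>2)) = gauss (d * m') i"
  proof -
    have "(\<Sum>x\<in>{0..<?K}. ec ?K (d * m' * (x + - (mb * l'))\<^sup>2)) = (\<Sum>x\<in>{0..<?K}. ec ?K (d * m' * x\<^sup>2))"
      by (rule sum_residues_shift[OF K]) (rule ec_square_cong)
    then show ?thesis by (simp add: gauss_def)
  qed
  have "(\<Sum>x\<in>{0..<?M}. ec ?M (d * (p * m' * x\<^sup>2 - 2 * (p * l') * x + n)))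
      = ec ?M (d * n) * (\<Sum>x\<in>{0..<?K * p}. ec ?K (d * (m' * x\<^sup>2 - 2 * l' * x)))"
    unfolding 1 by (simp only: sum_distrib_left power_Suc2)
  also have "(\<Sum>x\<in>{0..<?K * p}. ec ?K (d * (m' * x\<^sup>2 - 2 * l' * x))) = of_int p * (\<Sum>x\<in>{0..<?K}. ec ?K (d * (m' * x\<^sup>2 - 2 * l' * x)))"
  proof (rule sum_residues_lift)
    fix x y assume xy: "?K dvd x - y"
    have "d * (m' * x\<^sup>2 - 2 * l' * x) - d * (m' * y\<^sup>2 - 2 * l' * y) = (x - y) * (d * (m' * (x + y) - 2 * l'))"
      by (simp add: power2_eq_square algebra_simps)
    then show "ec ?K (d * (m' * x\<^sup>2 - 2 * l' * x)) = ec ?K (d * (m' * y\<^sup>2 - 2 * l' * y))"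
      using xy by (intro ec_dvd_diff) (metis dvd_mult2)
  qed (use p_gt_0 in auto)
  also have "\<dots> = of_int p * (ec ?K (- d * mb * l'\<^sup>2) * gauss (d * m') i)"
    unfolding 2 sum_distrib_left [symmetric] g ..
  also have "ec ?K (- d * mb * l'\<^sup>2) = ec ?M (p * (- d * mb * l'\<^sup>2))" by (simp only: scale)
  finally have "(\<Sum>x\<in>{0..<?M}. ec ?M (d * (p * m' * x\<^sup>2 - 2 * (p * l') * x + n)))
      = of_int p * (ec ?M (d * n) * ec ?M (p * (- d * mb * l'\<^sup>2))) * gauss (d * m') i"
    by (simp only: mult_ac)
  also have "ec ?M (d * n) * ec ?M (p * (- d * mb * l'\<^sup>2)) = ec ?M (d * (n - p * mb * l'\<^sup>2))"
    by (simp add: ec_add [symmetric] algebra_simps)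
  also have "gauss (d * m') i = of_int (Legendre (d * m') p) ^ i * gauss 1 i"
    by (rule gauss_eq) (use d m' dvd_mult_iff[of d m'] in blast)
  finally show ?thesis by (simp only: mult.assoc)
qed

text \<open>One of two consecutive exponents is odd, so \<open>tau\<close> occurs exactly
  once.\<close>

lemma gauss_consecutive: "gauss 1 (Suc i) * gauss 1 i = of_int p ^ i * tau"
proof (cases "even i")
  case True
  then obtain r where "i = 2 * r" by blast
  then show ?thesis using gauss_even[of r] gauss_odd[of r] by (simp add: power_add mult_2)
next
  case False
  then obtain r where "i = 2 * r + 1" by (auto elim: oddE)
  then show ?thesis using gauss_even[of "Suc r"] gauss_odd[of r] by (simp add: power_add mult_2)
qed

end

lemma kronecker_prime_power:
  fixes p :: int
  assumes "prime p"
  shows "kronecker a (p ^ j) = kronecker_prime a p ^ j"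
proof (cases "j = 0")
  case True
  then show ?thesis by (simp add: kronecker_def)
next
  case False
  have p0: "p > 0" using assms by (simp add: prime_gt_0_int)
  then have "prime_factors (p ^ j) = {p}" "multiplicity p (p ^ j) = j" "\<not> p ^ j < 0"
    using assms False by (simp_all add: prime_factors_power prime_prime_factors multiplicity_prime_power not_less)
  then show ?thesis using p0 by (simp add: kronecker_def)
qed

text \<open>Cancelling \<open>m\<close> from a congruence costs the \<open>p\<close>-part of
  \<open>m\<close>, here at most \<open>p ^ 3\<close>.\<close>

lemma p_power_dvd_cofactor:
  fixes p :: int
  assumes p: "prime p" and dvd: "p ^ j dvd m * z" and m: "\<not> p ^ 4 dvd m" "m \<noteq> 0"
  shows "p ^ (j - 3) dvd z"
proof -
  obtain w where w: "m = p ^ multiplicity p m * w" "\<not> p dvd w"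
    using multiplicity_decompose'[of m p] p m(2) by (metis not_prime_unit mult.commute)
  let ?e = "multiplicity p m"
  have e: "?e \<le> 3"
  proof (rule ccontr)
    assume "\<not> ?e \<le> 3"
    then have "p ^ 4 dvd p ^ ?e" by (intro le_imp_power_dvd) simp
    then show False using m w(1) by (metis dvd_mult2)
  qed
  show ?thesis
  proof (cases "j \<le> ?e")
    case True
    then show ?thesis using e by simp
  next
    case False
    have p0: "p ^ ?e \<noteq> 0" using p by simp
    have "p ^ j = p ^ ?e * p ^ (j - ?e)" using False by (simp flip: power_add)
    then have "p ^ ?e * p ^ (j - ?e) dvd p ^ ?e * (w * z)" using dvd w(1) by (metis mult.assoc)
    then have "p ^ (j - ?e) dvd w * z" by (simp only: dvd_times_left_cancel_iff[OF p0])
    moreover have "coprime (p ^ (j - ?e)) w" using w(2) p by (simp add: coprime_commute[of p] coprime_prime_right_iff)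
    ultimately have "p ^ (j - ?e) dvd z" by (simp add: coprime_dvd_mult_right_iff)
    moreover have "p ^ (j - 3) dvd p ^ (j - ?e)" using e by (intro le_imp_power_dvd) simp
    ultimately show ?thesis by (rule dvd_trans[rotated])
  qed
qed

context lat_data
begin

text \<open>If \<open>p\<close> does not divide \<open>l\<close>, both sides vanish. Otherwise
  \<open>E = n - p mb l'^2\<close> is the value after completing the square in \<open>x\<close>, and
  \<open>l^2 - m n\<close> equals \<open>- p m' E\<close> up to a multiple of
  \<open>p ^ (j + 2)\<close>. The twisted sum over \<open>d\<close> reads off the symbol of
  \<open>E / p ^ (j - 1)\<close>, which is thereby expressed through the quotient of
  \<open>l^2 - m n\<close> by \<open>p ^ j\<close>.\<close>

lemma T_ramified:
  assumes p: "odd_prime p" and pD: "\<not> p dvd \<Delta>" and m: "p dvd m" "\<not> p\<^sup>2 dvd m" and j: "j > 0"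
  shows "T (p ^ j) = of_int p ^ (j * h) * of_int p ^ j * (if p ^ j dvd l\<^sup>2 - m * n then
    of_int (Legendre (m_L B m div odd_prime.p_star p) p ^ j * Legendre ((l\<^sup>2 - m * n) div p ^ j) p) else 0)"
proof -
  interpret odd_prime p by fact
  obtain i where i: "j = Suc i" using j by (cases j) auto
  let ?M = "p ^ j"
  obtain m' where m': "m = p * m'" using m(1) by blast
  have pm': "\<not> p dvd m'" using m(2) by (auto simp: m' power2_eq_square)
  have p_dvd_M: "p dvd ?M" using i by simp
  let ?L1 = "Legendre (- 1) p" and ?Lm = "Legendre m' p"
  have L1: "?L1 * ?L1 = 1" by (simp add: Legendre_minus_1_mod_4)
  have Lm: "?Lm * ?Lm = 1" using pm' by (rule Legendre_square)
  show ?thesis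
  proof (cases "p dvd l")
    case False
    have "\<not> p ^ j dvd l\<^sup>2 - m * n"
    proof
      assume "p ^ j dvd l\<^sup>2 - m * n"
      then have "p dvd l\<^sup>2 - m * n" using p_dvd_M dvd_trans by blast
      then have "p dvd (l\<^sup>2 - m * n) + m * n" using m(1) by (intro dvd_add) simp_all
      then have "p dvd l * l" by (simp add: power2_eq_square)
      then show False using False dvd_mult_iff by blast
    qed
    moreover have "T ?M = 0"
    proof -
      have "(\<Sum>x = 0..<?M. ec ?M (d * (m * x\<^sup>2 - 2 * l * x + n))) = 0" if "d \<in> units_mod ?M" for d
      proof -
        have "\<not> p dvd d" using that j by (auto simp: units_mod_def coprime_iff)
        then show ?thesis by (rule sum_linear_vanish[OF j _ m(1) False])
      qed
      then show ?thesis unfolding T_ramified_aux[OF p pD j] by simp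
    qed
    ultimately show ?thesis by simp
  next
    case True
    then obtain l' where l': "l = p * l'" by blast
    have "coprime m' ?M" using pm' by (simp add: coprime_iff)
    then obtain mb where "[m' * mb = 1] (mod ?M)" using cong_solve_coprime_int by blast
    then have mb: "?M dvd m' * mb - 1" by (simp add: cong_iff_dvd_diff)
    have mbi: "p ^ i dvd m' * mb - 1" using mb unfolding i by (metis dvd_mult_right power_Suc)
    define E where "E = n - p * mb * l'\<^sup>2"
    have inner: "of_int (Legendre (- d) p) ^ j * (\<Sum>x\<in>{0..<?M}. ec ?M (d * (m * x\<^sup>2 - 2 * l * x + n)))
      = of_int p * gauss 1 i * of_int (?L1 ^ j * ?Lm ^ i) * (of_int (Legendre d p) * ec ?M (d * E))"
      if "d \<in> units_mod ?M" for d
    proof -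
      have d: "\<not> p dvd d" using that j by (auto simp: units_mod_def coprime_iff)
      have "Legendre (- d) p = ?L1 * Legendre d p" using Legendre_mult[of "- 1" d] by simp
      moreover have "(Legendre d p * Legendre d p) ^ i = 1" using Legendre_square[OF d] by simp
      ultimately have "Legendre (- d) p ^ j * Legendre (d * m') p ^ i = ?L1 ^ j * ?Lm ^ i * Legendre d p"
        unfolding i Legendre_mult by (simp add: power_mult_distrib)
      then have *: "of_int (Legendre (- d) p) ^ j * of_int (Legendre (d * m') p) ^ i = (of_int (?L1 ^ j * ?Lm ^ i) * of_int (Legendre d p) :: complex)"
        by (metis of_int_mult of_int_power)
      have "(\<Sum>x\<in>{0..<?M}. ec ?M (d * (m * x\<^sup>2 - 2 * l * x + n)))
        = of_int p * ec ?M (d * E) * of_int (Legendre (d * m') p) ^ i * gauss 1 i"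
        using sum_quadratic_ramified[OF d pm' mbi, of l' n] unfolding m' l' i E_def .
      then have "of_int (Legendre (- d) p) ^ j * (\<Sum>x\<in>{0..<?M}. ec ?M (d * (m * x\<^sup>2 - 2 * l * x + n)))
        = (of_int (Legendre (- d) p) ^ j * of_int (Legendre (d * m') p) ^ i) * of_int p * ec ?M (d * E) * gauss 1 i"
        by (simp only: mult_ac)
      then show ?thesis unfolding * by (simp only: mult_ac)
    qed
    have "T ?M = gauss 1 j ^ CARD('n) * (\<Sum>d\<in>units_mod ?M. of_int p * gauss 1 i * of_int (?L1 ^ j * ?Lm ^ i) * (of_int (Legendre d p) * ec ?M (d * E)))"
      unfolding T_ramified_aux[OF p pD j] by (simp only: inner cong: sum.cong)
    also have "\<dots> = gauss 1 j ^ CARD('n) * (of_int p * gauss 1 i * of_int (?L1 ^ j * ?Lm ^ i) *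
        (if p ^ i dvd E then of_int (p ^ i) * of_int (Legendre (E div p ^ i) p) * tau else 0))"
      unfolding sum_distrib_left [symmetric] unfolding i sum_units_Legendre ..
    finally have T1: "T ?M = gauss 1 j ^ CARD('n) * (of_int p * gauss 1 i * of_int (?L1 ^ j * ?Lm ^ i) *
        (if p ^ i dvd E then of_int (p ^ i) * of_int (Legendre (E div p ^ i) p) * tau else 0))" .
    \<comment> \<open>The rank is \<open>2 * (h - 1) + 1\<close>: the paired factors are squares,
      and the spare one combines with \<open>gauss 1 i\<close> and \<open>tau\<close> to
      \<open>tau\<close> squared.\<close>
    have G: "gauss 1 j ^ CARD('n) * gauss 1 i * tau = of_int ((?L1 * p) ^ (j * (h - 1)) * p ^ i * (?L1 * p))"
    proof -
      have "gauss 1 j ^ CARD('n) * gauss 1 i * tau = ((gauss 1 j)\<^sup>2) ^ (h - 1) * (gauss 1 j * gauss 1 i) * tau"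
        unfolding h_even(2) by (simp add: power_mult mult_ac)
      also have "\<dots> = of_int (?L1 * p) ^ (j * (h - 1)) * of_int p ^ i * tau\<^sup>2"
      proof -
        have gc: "gauss 1 j * gauss 1 i = of_int p ^ i * tau" by (simp only: i gauss_consecutive)
        show ?thesis unfolding gauss_square gc by (simp add: power_mult power2_eq_square mult.assoc)
      qed
      finally show ?thesis unfolding tau_square p_star_def by simp
    qed
    obtain k where k: "m' * mb - 1 = ?M * k" using mb by blast
    have rel: "l\<^sup>2 - m * n = - p * (m' * E + p * ?M * (k * l'\<^sup>2))"
    proof -
      have "l\<^sup>2 - m * n = - p * (m' * E + p * l'\<^sup>2 * (m' * mb - 1))"
        by (simp add: m' l' E_def power2_eq_square algebra_simps)
      then show ?thesis unfolding k by (simp add: mult_ac)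
    qed
    have iff: "p ^ j dvd l\<^sup>2 - m * n \<longleftrightarrow> p ^ i dvd E"
    proof -
      have "p ^ j dvd l\<^sup>2 - m * n \<longleftrightarrow> p * p ^ i dvd p * (m' * E + p * ?M * (k * l'\<^sup>2))"
        unfolding rel i by simp
      also have "\<dots> \<longleftrightarrow> p ^ i dvd m' * E + p * ?M * (k * l'\<^sup>2)" using p_gt_0 by simp
      also have "\<dots> \<longleftrightarrow> p ^ i dvd m' * E" by (rule dvd_add_left_iff) (simp add: i)
      also have "\<dots> \<longleftrightarrow> p ^ i dvd E"
        using pm' by (intro coprime_dvd_mult_right_iff) (simp add: coprime_commute[of p] coprime_iff)
      finally show ?thesis .
    qed
    show ?thesis
    proof (cases "p ^ i dvd E")
      case False
      then show ?thesis using T1 iff by simp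
    next
      case True
      then obtain e where e: "E = p ^ i * e" by blast
      let ?w = "- (m' * e + p\<^sup>2 * (k * l'\<^sup>2))"
      have w: "l\<^sup>2 - m * n = p ^ j * ?w" unfolding rel e i by (simp add: power2_eq_square algebra_simps)
      have pj0: "p ^ j \<noteq> 0" "p ^ i \<noteq> 0" using p_gt_0 by simp_all
      have wdiv: "(l\<^sup>2 - m * n) div p ^ j = ?w" unfolding w using pj0 by simp
      have "Legendre ?w p = Legendre ((- 1) * m' * e) p"
        by (rule Legendre_cong) (simp add: power2_eq_square)
      then have Lw: "Legendre ?w p = ?L1 * ?Lm * Legendre e p" by (simp only: Legendre_mult)
      have "?L1 * ?Lm * Legendre ?w p = (?L1 * ?L1) * (?Lm * ?Lm) * Legendre e p" unfolding Lw by (simp only: mult_ac)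
      then have Le: "Legendre e p = ?L1 * ?Lm * Legendre ?w p" unfolding L1 Lm by simp
      have ps: "m_L B m div p_star = (- 4) ^ (h - 1) * m' * ?L1"
      proof -
        have "m_L B m = p_star * ((- 4) ^ (h - 1) * m' * ?L1)"
          using L1 by (simp add: m_L_def h_even m' p_star_def mult_ac)
        moreover have "p_star \<noteq> 0" using p_gt_0 by (simp add: p_star_def Legendre_minus_1_mod_4)
        ultimately show ?thesis by simp
      qed
      have "Legendre 4 p = 1" using Legendre_mult[of 2 2] Legendre_square[OF not_dvd_2] by simp
      then have L4: "Legendre (- 4) p = ?L1" using Legendre_mult[of "- 1" 4] by simp
      have Lps: "Legendre (m_L B m div p_star) p = ?L1 ^ h * ?Lm"
      proof -
        obtain h' where "h = Suc h'" using h_even(3) by (cases h) auto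
        then show ?thesis unfolding ps by (simp add: Legendre_mult Legendre_power L4 Legendre_minus_1_Legendre)
      qed
      have "T ?M = (gauss 1 j ^ CARD('n) * gauss 1 i * tau) * of_int (p * (?L1 ^ j * ?Lm ^ i) * p ^ i * Legendre e p)"
        unfolding T1 using True pj0 by (simp add: e mult_ac)
      also have "\<dots> = of_int (((?L1 * p) ^ (j * (h - 1)) * p ^ i * (?L1 * p)) * (p * (?L1 ^ j * ?Lm ^ i) * p ^ i * (?L1 * ?Lm * Legendre ?w p)))"
        unfolding G Le of_int_mult ..
      also have "((?L1 * p) ^ (j * (h - 1)) * p ^ i * (?L1 * p)) * (p * (?L1 ^ j * ?Lm ^ i) * p ^ i * (?L1 * ?Lm * Legendre ?w p))
          = p ^ (j * h) * p ^ j * ((?L1 ^ h * ?Lm) ^ j * Legendre ?w p)"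
      proof -
        obtain h' where h': "h = Suc h'" using h_even(3) by (cases h) auto
        have "((?L1 * p) ^ (j * (h - 1)) * p ^ i * (?L1 * p)) * (p * (?L1 ^ j * ?Lm ^ i) * p ^ i * (?L1 * ?Lm * Legendre ?w p))
          = (?L1 * ?L1) * (p ^ (j * h') * p ^ j * p ^ j) * ((?L1 ^ (j * h') * ?L1 ^ j * ?Lm ^ j) * Legendre ?w p)"
          unfolding h' i by (simp add: power_mult_distrib mult_ac)
        also have "\<dots> = p ^ (j * h) * p ^ j * ((?L1 ^ h * ?Lm) ^ j * Legendre ?w p)"
          unfolding L1 h' by (simp add: power_mult_distrib power_add power_mult [symmetric] mult.commute[of j] mult_ac)
        finally show ?thesis .
      qed
      finally show ?thesis
        unfolding wdiv Lps using iff True by simp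
    qed
  qed
qed

lemma kronecker_prime_m_L_eq_0:
  assumes "prime p" "p = 2 \<and> CARD('n) > 1 \<or> p dvd m"
  shows "kronecker_prime (m_L B m) p = 0"
proof (cases "p = 2")
  case True
  have "even (m_L B m)"
  proof (cases "CARD('n) > 1")
    case True
    \<comment> \<open>An odd rank above 1 is at least 3, so the power of \<open>- 4\<close> in
      \<open>m_L\<close> is nontrivial.\<close>
    then have "h - 1 > 0" using h_even(2) by (cases "h - 1") auto
    then show ?thesis by (simp add: m_L_def h_even)
  next
    case False
    then show ?thesis using assms \<open>p = 2\<close> by (simp add: m_L_def)
  qed
  then show ?thesis using True by (simp add: kronecker_prime_def)
next
  case False
  then have "p dvd m_L B m" using assms by (simp add: m_L_def)
  then show ?thesis using False by (simp add: kronecker_prime_def Legendre_def cong_0_iff)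
qed

text \<open>The power of the vanishing symbol is 0 except at \<open>i = j\<close>, where its
  exponent is 0 and the factor is 1.\<close>

lemma Xi_local_ramified:
  assumes "kronecker_prime (m_L B m) p = 0"
  shows "Xi_local p j = T (p ^ j) / of_int p ^ (j * h) / of_int p ^ j"
proof -
  have "(\<Sum>i\<le>j. of_int (kronecker_prime (m_L B m) p) ^ (j - i) * T (p ^ i) / of_int p ^ (i * h))
      = (\<Sum>i\<in>{j}. of_int (kronecker_prime (m_L B m) p) ^ (j - i) * T (p ^ i) / of_int p ^ (i * h))"
    by (rule sum.mono_neutral_right) (auto simp: assms)
  then show ?thesis by (simp add: Xi_local_def)
qed

text \<open>Stationary phase gives a point where the derivative is divisible by
  \<open>p ^ (j div 2)\<close> and \<open>F\<close> by \<open>p ^ (j - 1)\<close>. The power lost in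
  the latter is regained from \<open>2 m\<close>, which is where \<open>p = 2\<close> or
  \<open>p\<close> dividing \<open>m\<close> enters, and \<open>grad_disc\<close> concludes.\<close>

lemma T_nonzero_dvd_disc:
  assumes p: "prime p" and pm: "p = 2 \<or> p dvd m" and j: "j \<ge> 1" and nz: "T (p ^ j) \<noteq> 0"
  shows "p ^ (2 * (j div 2)) dvd disc"
proof -
  obtain X where X: "\<And>H. p ^ (j div 2) dvd grad X H" "p ^ (j - 1) dvd F X"
    using T_prime_power_nonzeroD[OF p nz j] by blast
  have "p ^ (j div 2) > 0" using p by (simp add: prime_gt_0_int)
  then obtain k where k: "l\<^sup>2 - m * n = \<Delta> * ((p ^ (j div 2))\<^sup>2 * k - 2 * m * F X)"
    using grad_disc X(1) by blast
  have "p dvd 2 * m" using pm by auto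
  then have "p * p ^ (j - 1) dvd 2 * m * F X" using X(2) by (rule mult_dvd_mono)
  then have "p ^ j dvd 2 * m * F X" using j by (cases j) auto
  moreover have "p ^ (2 * (j div 2)) dvd p ^ j" by (rule le_imp_power_dvd) simp
  ultimately have "p ^ (2 * (j div 2)) dvd 2 * m * F X" by (rule dvd_trans[rotated])
  moreover have "disc = p ^ (2 * (j div 2)) * k - 2 * m * F X"
    using k \<Delta>_nonzero by (simp add: disc_def power_mult [symmetric] mult.commute)
  ultimately show ?thesis by simp
qed

text \<open>Kernel vectors are multiples of \<open>p ^ (j - 3)\<close>, so there are at most
  \<open>p ^ (3 * 2 * h)\<close> of them modulo \<open>p ^ j\<close>. The square root taken in
  Weyl's estimate gives \<open>p ^ (3 * h)\<close>, and the sum over the units costs at most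
  \<open>p ^ j\<close>.\<close>

lemma norm_T_le:
  assumes p: "prime p" and m: "\<not> p ^ 4 dvd m"
  shows "norm (T (p ^ j)) \<le> of_int p ^ (j * h) * of_int p ^ j * of_int p ^ (3 * h)"
proof -
  have p0: "p > 0" using p by (simp add: prime_gt_0_int)
  \<comment> \<open>The subtraction is truncated: for \<open>j < 3\<close> the divisor
    \<open>?K\<close> is 1, and the inclusion below remains correct.\<close>
  let ?M = "p ^ j" and ?K = "p ^ (j - 3)"
  have M: "?M > 0" and K: "?K > 0" using p0 by simp_all
  let ?ker = "{H\<in>reps_mod ?M. \<forall>X. ?M dvd Bf X H}"
  have "?ker \<subseteq> (\<lambda>Y. ?K *s Y) ` reps_mod (p ^ 3)"
  proof
    fix H assume H: "H \<in> ?ker"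
    then have "vdvd ?M (m *s H)" using kernel_Bf[OF M] by blast
    then have "?M dvd m * H $ i" for i by (simp add: vdvd_def)
    then have d: "?K dvd H $ i" for i using p_power_dvd_cofactor[OF p _ m m_nonzero] by blast
    let ?Y = "\<chi> i. H $ i div ?K"
    have HY: "H = ?K *s ?Y" using d by (simp add: vec_eq_iff)
    have "?Y \<in> reps_mod (p ^ 3)"
    proof (rule reps_modI)
      fix i
      have b: "0 \<le> H $ i" "H $ i < ?M" using H reps_modD by blast+
      have "?M dvd ?K * p ^ 3" by (simp add: le_imp_power_dvd flip: power_add)
      then have "?M \<le> ?K * p ^ 3" using p0 by (intro zdvd_imp_le) auto
      then have "0 \<le> H $ i div ?K" "H $ i div ?K < p ^ 3"
        using digit_bounds'[of "H $ i" ?K "p ^ 3"] b K by auto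
      then show "0 \<le> ?Y $ i \<and> ?Y $ i < p ^ 3" by simp
    qed
    then show "H \<in> (\<lambda>Y. ?K *s Y) ` reps_mod (p ^ 3)" using HY by blast
  qed
  then have "card ?ker \<le> card ((\<lambda>Y. ?K *s Y) ` (reps_mod (p ^ 3) :: (int ^ ('n option)) set))"
    by (intro card_mono) auto
  also have "\<dots> \<le> card (reps_mod (p ^ 3) :: (int ^ ('n option)) set)" by (rule card_image_le) simp
  also have "\<dots> = nat (p ^ 3) ^ (2 * h)" unfolding h_even(1) by (rule card_reps_mod) (use p0 in simp)
  finally have "real (card ?ker) \<le> real (nat (p ^ 3) ^ (2 * h))" by (simp only: of_nat_le_iff)
  also have "\<dots> = (of_int p ^ (3 * h))\<^sup>2" using p0 by (simp add: power_mult [symmetric] mult_ac)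
  finally have ker: "real (card ?ker) \<le> (of_int p ^ (3 * h))\<^sup>2" .
  have S: "norm (\<Sum>X\<in>reps_mod ?M. ec ?M (d * F X)) \<le> of_int p ^ (j * h) * of_int p ^ (3 * h)"
    if "coprime d ?M" for d
  proof (rule power2_le_imp_le)
    have "(norm (\<Sum>X\<in>reps_mod ?M. ec ?M (d * F X)))\<^sup>2 \<le> real_of_int ?M ^ CARD('n option) * real (card ?ker)"
      by (rule norm_quadratic_sum_bound[OF M that])
    also have "\<dots> \<le> real_of_int ?M ^ CARD('n option) * (of_int p ^ (3 * h))\<^sup>2"
      using ker p0 by (intro mult_left_mono) auto
    also have "\<dots> = (of_int p ^ (j * h) * of_int p ^ (3 * h))\<^sup>2"
      unfolding h_even(1) [symmetric] by (simp add: power_mult_distrib power_mult [symmetric] mult_ac)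
    finally show "(norm (\<Sum>X\<in>reps_mod ?M. ec ?M (d * F X)))\<^sup>2 \<le> (of_int p ^ (j * h) * of_int p ^ (3 * h))\<^sup>2" .
  qed (use p0 in simp)
  have "norm (T ?M) \<le> (\<Sum>d\<in>units_mod ?M. of_int p ^ (j * h) * of_int p ^ (3 * h))"
    unfolding T_altdef by (rule sum_norm_le) (use S in \<open>auto simp: units_mod_def\<close>)
  also have "\<dots> = real (card (units_mod ?M)) * (of_int p ^ (j * h) * of_int p ^ (3 * h))" by simp
  also have "\<dots> \<le> real_of_int ?M * (of_int p ^ (j * h) * of_int p ^ (3 * h))"
  proof (rule mult_right_mono)
    have "card (units_mod ?M) \<le> card {0..<?M}" by (intro card_mono) (auto simp: units_mod_def)
    then have "card (units_mod ?M) \<le> nat ?M" by simp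
    then have "int (card (units_mod ?M)) \<le> ?M" using M by simp
    then show "real (card (units_mod ?M)) \<le> real_of_int ?M" by (metis of_int_le_iff of_int_of_nat_eq)
  qed (use p0 in simp)
  finally show ?thesis by (simp add: mult_ac)
qed

lemma F_vcons_rat:
  "of_int (F (vcons x y)) =
    (of_int m / of_int (2 * \<Delta>) - ext_quad B \<alpha>) * (of_int x)\<^sup>2 - ext_form B \<alpha> (emb y) * of_int x - ext_quad B (emb y)
    + ext_form B \<beta> (emb y) - (of_int l / of_int \<Delta> - ext_form B \<alpha> \<beta>) * of_int x
    + (of_int n / of_int (2 * \<Delta>) - ext_quad B \<beta>)"
proof -
  have "of_int m / of_int (2 * \<Delta>) - ext_quad B \<alpha> = of_int mt"
    "of_int n / of_int (2 * \<Delta>) - ext_quad B \<beta> = of_int nt"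
    "of_int l / of_int \<Delta> - ext_form B \<alpha> \<beta> = of_int lt"
    using \<Delta>_nonzero by (simp_all add: hm hn hl)
  then show ?thesis
    by (simp only:) (simp add: F_def Qf_def bf_def of_int_pair[OF \<alpha>] of_int_pair[OF \<beta>] ext_quad_emb)
qed

lemma N_count_N:
  assumes M: "M > 0"
  shows "N_count B \<alpha> \<beta> l m n M = N M"
proof -
  have "bij_betw (\<lambda>(x, y). vcons x y) {z\<in>{0..<M} \<times> reps_mod M. M dvd F (vcons (fst z) (snd z))} {X\<in>reps_mod M. M dvd F X}"
  proof (rule bij_betw_byWitness[where f' = "\<lambda>X. (X $ None, vtail X)"])
    show "(\<lambda>X. (X $ None, vtail X)) ` {X\<in>reps_mod M. M dvd F X}
        \<subseteq> {z\<in>{0..<M} \<times> reps_mod M. M dvd F (vcons (fst z) (snd z))}"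
      by (auto simp: reps_mod_def)
  qed (auto simp: vcons_in_reps_iff)
  then have "card {z\<in>{0..<M} \<times> reps_mod M. M dvd F (vcons (fst z) (snd z))} = N M"
    unfolding N_def by (rule bij_betw_same_card)
  moreover have "N_count B \<alpha> \<beta> l m n M = card {z\<in>{0..<M} \<times> reps_mod M. M dvd F (vcons (fst z) (snd z))}"
    unfolding N_count_def Let_def F_vcons_rat [symmetric]
    using M by (intro arg_cong[of _ _ card]) (auto simp: Ints_of_int_div_iff)
  ultimately show ?thesis by simp
qed

end

section \<open>Comparison of the local factors with the definition of \<xi>\<close>

locale lat_fundamental = lat_data B \<alpha> m mt \<beta> n l nt lt
  for B :: "int ^ 'n \<Rightarrow> int ^ 'n \<Rightarrow> int" and \<alpha> m mt \<beta> n l nt lt +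
  assumes rank: "CARD('n) > 1"
    and fundamental: "fundamental_discriminant ((- 1) ^ ((CARD('n) - 1) div 2) * m)"
begin

lemma fundamental_abs: "squarefree m \<or> 4 dvd m \<and> squarefree (m div 4)"
proof -
  have s: "squarefree (- x) \<longleftrightarrow> squarefree x" for x :: int
    by (simp add: squarefree_def)
  have "(- 1) ^ ((CARD('n) - 1) div 2) * m = m \<or> (- 1) ^ ((CARD('n) - 1) div 2) * m = - m"
    by (cases "even ((CARD('n) - 1) div 2)") auto
  then show ?thesis using fundamental s s[of "m div 4"]
    by (auto simp: fundamental_discriminant_def dvd_neg_div)
qed

lemma not_square_dvd:
  assumes p: "odd_prime p"
  shows "\<not> p\<^sup>2 dvd m"
proof
  assume d: "p\<^sup>2 dvd m"
  interpret odd_prime p by fact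
  have sq: "\<not> p\<^sup>2 dvd x" if "squarefree x" for x
  proof
    assume "p\<^sup>2 dvd x"
    then have "p dvd 1" using that unfolding squarefree_def by blast
    then show False using not_dvd_1 by blast
  qed
  then have "\<not> squarefree m" using d by blast
  then have m: "4 dvd m" "squarefree (m div 4)" using fundamental_abs by auto
  have "coprime (p\<^sup>2) (2\<^sup>2)"
    using odd_p by (simp only: coprime_power_left_iff coprime_power_right_iff) (simp add: coprime_commute[of p])
  moreover have "p\<^sup>2 dvd 2\<^sup>2 * (m div 4)" using d m by simp
  ultimately have "p\<^sup>2 dvd m div 4" by (simp only: coprime_dvd_mult_right_iff)
  then show False using sq m by blast
qed

lemma not_fourth_power_dvd:
  assumes p: "prime p"
  shows "\<not> p ^ 4 dvd m"
proof
  assume d: "p ^ 4 dvd m"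
  show False
  proof (cases "p = 2")
    case True
    have s: "\<not> 2\<^sup>2 dvd x" if "squarefree x" for x :: int
    proof
      assume "2\<^sup>2 dvd x"
      then have "(2::int) dvd 1" using that unfolding squarefree_def by blast
      then show False by simp
    qed
    have "(2::int)\<^sup>2 * 2\<^sup>2 dvd m" using d True by simp
    then have "2\<^sup>2 dvd m" "2\<^sup>2 dvd m div 4" by (auto elim!: dvdE)
    then show False using fundamental_abs s by blast
  next
    case False
    then have "odd_prime p" using p prime_odd_int[of p] prime_ge_2_int[OF p] by unfold_locales auto
    moreover have "p\<^sup>2 dvd p ^ 4" by (rule le_imp_power_dvd) simp
    ultimately show False using not_square_dvd d dvd_trans by blast
  qed
qed

text \<open>The cases are arranged by the quadratic form: unimodular at \<open>p\<close>; degenerate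
  in one variable only; or not accessible to a direct Gauss sum evaluation, where the counting
  formula is \<open>T_prime_power\<close> in disguise.\<close>

lemma xi_prime_power_eq:
  assumes p: "prime p" and j: "j \<ge> 1"
  shows "of_real (xi_prime_power B \<alpha> \<beta> l m n p j) = Xi_local p j"
proof -
  have p0: "p > 0" using p by (simp add: prime_gt_0_int)
  have gcd_iff: "gcd m (gcd \<Delta> p) = 1 \<longleftrightarrow> \<not> (p dvd m \<and> p dvd \<Delta>)"
  proof
    assume *: "gcd m (gcd \<Delta> p) = 1"
    show "\<not> (p dvd m \<and> p dvd \<Delta>)"
    proof
      assume "p dvd m \<and> p dvd \<Delta>"
      then have "p dvd gcd m (gcd \<Delta> p)" by simp
      then have "p dvd 1" unfolding * .
      then show False using not_prime_unit p by blast
    qed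
  next
    assume *: "\<not> (p dvd m \<and> p dvd \<Delta>)"
    show "gcd m (gcd \<Delta> p) = 1"
    proof (cases "p dvd \<Delta>")
      case True
      then have "\<not> p dvd m" using * by simp
      then have "coprime m p" using coprime_prime_right_iff[OF p] by blast
      then have "coprime m (gcd \<Delta> p)" by (rule coprime_divisors[OF dvd_refl gcd_dvd2])
      then show ?thesis by simp
    next
      case False
      then have "coprime \<Delta> p" using coprime_prime_right_iff[OF p] by blast
      then show ?thesis by simp
    qed
  qed
  consider (unit) "odd_prime p" "\<not> p dvd m" | (ramified) "odd_prime p" "p dvd m" "\<not> p dvd \<Delta>"
    | (other) "p = 2 \<or> p dvd m" "\<not> (odd p \<and> gcd m (gcd \<Delta> p) = 1)"
    using p prime_odd_int[of p] prime_ge_2_int[OF p] gcd_iff unfolding odd_prime_def by force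
  then show ?thesis
  proof cases
    case unit
    interpret odd_prime p by fact
    let ?\<nu> = "multiplicity p (2 * \<Delta>)"
    have g1: "odd p \<and> gcd m (gcd \<Delta> p) = 1" using unit gcd_iff odd_p by auto
    have kp: "kronecker (m_L B m) (p ^ j) = Legendre (m_L B m) p ^ j"
      using odd_p by (auto simp: kronecker_prime_power[OF p] kronecker_prime_def)
    \<comment> \<open>\<open>l^2 - m n\<close> is \<Delta> times \<open>disc\<close>, and the
      exponent \<nu> is exactly the contribution of \<Delta>, since \<open>p\<close> is odd.\<close>
    have iff: "[l\<^sup>2 = m * n] (mod p ^ (j + ?\<nu>)) \<longleftrightarrow> p ^ j dvd disc"
    proof -
      obtain w where w: "2 * \<Delta> = p ^ ?\<nu> * w" "\<not> p dvd w"
        using multiplicity_decompose'[of "2 * \<Delta>" p] p \<Delta>_nonzero by (metis mult.commute mult_eq_0_iff not_prime_unit zero_neq_numeral)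
      have "[l\<^sup>2 = m * n] (mod p ^ (j + ?\<nu>)) \<longleftrightarrow> p ^ (j + ?\<nu>) dvd \<Delta> * disc"
        by (simp add: cong_iff_dvd_diff disc)
      also have "\<dots> \<longleftrightarrow> p ^ (j + ?\<nu>) dvd 2 * (\<Delta> * disc)"
        using odd_p by (intro coprime_dvd_mult_right_iff [symmetric]) simp
      also have "2 * (\<Delta> * disc) = p ^ ?\<nu> * (w * disc)" using w(1) by (metis mult.assoc)
      also have "p ^ (j + ?\<nu>) dvd p ^ ?\<nu> * (w * disc) \<longleftrightarrow> p ^ j dvd w * disc"
        unfolding power_add mult.commute[of "p ^ j"] using p0 by simp
      also have "\<dots> \<longleftrightarrow> p ^ j dvd disc"
        using w(2) by (intro coprime_dvd_mult_right_iff) (simp add: coprime_commute[of p] coprime_iff)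
      finally show ?thesis .
    qed
    have "xi_prime_power B \<alpha> \<beta> l m n p j = (if p ^ j dvd disc then of_int (Legendre (m_L B m) p ^ j) else 0)"
      unfolding xi_prime_power_def Let_def if_P[OF g1] iff kp using unit(2) by simp
    then show ?thesis using Xi_local_unit[OF unit] by simp
  next
    case ramified
    interpret odd_prime p by fact
    have g1: "odd p \<and> gcd m (gcd \<Delta> p) = 1" using ramified gcd_iff odd_p by auto
    have "kronecker (- 1) p = Legendre (- 1) p"
      using kronecker_prime_power[OF p, of "- 1" 1] odd_p by (auto simp: kronecker_prime_def)
    then have ps: "kronecker (- 1) p * p = p_star" by (simp add: p_star_def)
    have kp: "kronecker (m_L B m div p_star) (p ^ j) = Legendre (m_L B m div p_star) p ^ j"
      using odd_p by (auto simp: kronecker_prime_power[OF p] kronecker_prime_def)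
    have "xi_prime_power B \<alpha> \<beta> l m n p j = (if p ^ j dvd l\<^sup>2 - m * n then
        of_int (Legendre (m_L B m div p_star) p ^ j * Legendre ((l\<^sup>2 - m * n) div p ^ j) p) else 0)"
      unfolding xi_prime_power_def Let_def if_P[OF g1] ps kp kronecker_p_star
      using ramified(2) by (simp add: cong_iff_dvd_diff)
    then have "complex_of_real (xi_prime_power B \<alpha> \<beta> l m n p j) = (if p ^ j dvd l\<^sup>2 - m * n then
        of_int (Legendre (m_L B m div p_star) p ^ j * Legendre ((l\<^sup>2 - m * n) div p ^ j) p) else 0)"
      by (simp only: of_real_of_int_eq of_real_0 if_distrib[of of_real])
    moreover have "Xi_local p j = (if p ^ j dvd l\<^sup>2 - m * n then
        of_int (Legendre (m_L B m div p_star) p ^ j * Legendre ((l\<^sup>2 - m * n) div p ^ j) p) else 0)"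
      unfolding Xi_local_ramified[OF kronecker_prime_m_L_eq_0[OF p disjI2[OF ramified(2)]]]
        T_ramified[OF ramified(1,3,2) not_square_dvd[OF ramified(1)] less_le_trans[OF zero_less_one j]]
      using p0 by simp
    ultimately show ?thesis by simp
  next
    case other
    have k0: "kronecker_prime (m_L B m) p = 0" using kronecker_prime_m_L_eq_0[OF p] other(1) rank by blast
    obtain i where i: "j = Suc i" using j by (cases j) auto
    have iff: "[l\<^sup>2 = m * n] (mod \<bar>\<Delta>\<bar> * p ^ (2 * (j div 2))) \<longleftrightarrow> p ^ (2 * (j div 2)) dvd disc"
    proof -
      have "[l\<^sup>2 = m * n] (mod \<bar>\<Delta>\<bar> * p ^ (2 * (j div 2))) \<longleftrightarrow> \<bar>\<Delta>\<bar> * p ^ (2 * (j div 2)) dvd \<Delta> * disc"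
        by (simp add: cong_iff_dvd_diff disc)
      also have "\<dots> \<longleftrightarrow> \<Delta> * p ^ (2 * (j div 2)) dvd \<Delta> * disc" by (cases "\<Delta> \<ge> 0") auto
      finally show ?thesis using \<Delta>_nonzero by simp
    qed
    have "real j * (real CARD('n) + 1) / 2 = real (j * h)"
    proof -
      have "real CARD('n) + 1 = real (2 * h)" using h_even by (simp add: card_UNIV_option)
      then show ?thesis by simp
    qed
    then have pw: "of_int p powr (- (real j * (real CARD('n) + 1) / 2)) = 1 / of_int p ^ (j * h)"
      using p0 by (simp only: powr_minus_divide powr_realpow of_int_0_less_iff)
    let ?v = "1 / of_int p ^ (j * h) * (real (N (p ^ j)) - of_int p ^ CARD('n) * real (N (p ^ i)))"
    have T: "Xi_local p j = of_real ?v"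
      unfolding Xi_local_ramified[OF k0] i T_prime_power[OF p]
      using p0 by (simp add: card_UNIV_option field_simps)
    have Nj: "N_count B \<alpha> \<beta> l m n (p ^ j) = N (p ^ j)" "N_count B \<alpha> \<beta> l m n (p ^ i) = N (p ^ i)"
      using p0 by (simp_all add: N_count_N)
    have xi: "xi_prime_power B \<alpha> \<beta> l m n p j = (if p ^ (2 * (j div 2)) dvd disc then ?v else 0)"
      unfolding xi_prime_power_def Let_def if_not_P[OF other(2)] iff pw Nj(1) using Nj(2) i by simp
    show ?thesis
    proof (cases "p ^ (2 * (j div 2)) dvd disc")
      case True
      then show ?thesis unfolding xi T by simp
    next
      case False
      \<comment> \<open>The value 0 prescribed by the definition agrees with the counting formula:
        stationary phase makes the latter vanish too.\<close>
      then have "T (p ^ j) = 0" using T_nonzero_dvd_disc[OF p other(1) j] by blast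
      then have "Xi_local p j = 0" unfolding Xi_local_ramified[OF k0] by simp
      then show ?thesis unfolding xi using False by simp
    qed
  qed
qed

text \<open>Outside \<open>2 \<Delta>\<close> the explicit evaluations consist of symbols only, so
  the local factor is at most 1 and just the finitely many primes dividing \<open>2 \<Delta>\<close>
  can contribute more. At those with vanishing symbol Weyl's estimate applies.\<close>

lemma xi_prime_power_bound:
  assumes p: "prime p" and j: "j \<ge> 1"
  shows "\<bar>xi_prime_power B \<alpha> \<beta> l m n p j\<bar> \<le> (if p dvd 2 * \<Delta> then of_int p ^ (3 * h) else 1)"
proof (cases "kronecker_prime (m_L B m) p = 0 \<and> p dvd 2 * \<Delta>")
  case True
  have p0: "p > 0" using p by (simp add: prime_gt_0_int)
  have "\<bar>xi_prime_power B \<alpha> \<beta> l m n p j\<bar> = norm (Xi_local p j)"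
    unfolding xi_prime_power_eq[OF assms, symmetric] by simp
  also have "\<dots> = norm (T (p ^ j)) / (of_int p ^ (j * h) * of_int p ^ j)"
    using True p0 by (simp add: Xi_local_ramified norm_divide norm_power norm_mult)
  also have "\<dots> \<le> of_int p ^ (3 * h)"
    using norm_T_le[OF p not_fourth_power_dvd[OF p], of j] p0 by (simp add: divide_le_eq mult_ac)
  finally show ?thesis using True by simp
next
  case False
  have p2: "p \<noteq> 2" using False kronecker_prime_m_L_eq_0[OF p] rank by auto
  then have op: "odd_prime p" using p prime_odd_int[of p] prime_ge_2_int[OF p] by unfold_locales auto
  interpret odd_prime p by fact
  have L: "\<bar>Legendre a p\<bar> \<le> 1" for a using Legendre_values[of a] by auto
  have 1: "1 \<le> (if p dvd 2 * \<Delta> then of_int p ^ (3 * h) else (1::real))"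
    using p_gt_2 by (simp add: one_le_power)
  have "\<bar>xi_prime_power B \<alpha> \<beta> l m n p j\<bar> = norm (Xi_local p j)"
    unfolding xi_prime_power_eq[OF assms, symmetric] by simp
  also have "\<dots> \<le> 1"
  proof (cases "p dvd m")
    case True
    then have k0: "kronecker_prime (m_L B m) p = 0" using kronecker_prime_m_L_eq_0[OF p] by blast
    then have pD: "\<not> p dvd \<Delta>" using False by (meson dvd_mult)
    let ?a = "Legendre (m_L B m div p_star) p ^ j * Legendre ((l\<^sup>2 - m * n) div p ^ j) p"
    have "Xi_local p j = (if p ^ j dvd l\<^sup>2 - m * n then of_int ?a else 0)"
      unfolding Xi_local_ramified[OF k0] T_ramified[OF op pD True not_square_dvd[OF op] less_le_trans[OF zero_less_one j]]
      using p_gt_0 by simp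
    moreover have "\<bar>?a\<bar> \<le> 1" using L by (simp add: abs_mult power_abs mult_le_one power_le_one)
    then have "norm (complex_of_int ?a) \<le> 1" by (simp only: norm_of_int of_int_le_1_iff flip: of_int_abs)
    ultimately show ?thesis by (simp only: split: if_split) simp
  next
    case False
    have "\<bar>Legendre (m_L B m) p ^ j\<bar> \<le> 1" using L by (simp add: power_abs power_le_one)
    then have "norm (complex_of_int (Legendre (m_L B m) p ^ j)) \<le> 1" by (simp only: norm_of_int of_int_le_1_iff flip: of_int_abs)
    then show ?thesis unfolding Xi_local_unit[OF op False] by simp
  qed
  finally show ?thesis using 1 by linarith
qed

end

section \<open>Multiplicative functions on the positive integers\<close>

definition mult_fun :: "(int \<Rightarrow> complex) \<Rightarrow> bool" where
  "mult_fun f \<longleftrightarrow> f 1 = 1 \<and> (\<forall>a b. a > 0 \<longrightarrow> b > 0 \<longrightarrow> coprime a b \<longrightarrow> f (a * b) = f a * f b)"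

definition divs :: "int \<Rightarrow> int set" where
  "divs c = {u. u > 0 \<and> u dvd c}"

definition conv :: "(int \<Rightarrow> complex) \<Rightarrow> (int \<Rightarrow> complex) \<Rightarrow> int \<Rightarrow> complex" where
  "conv f g c = (\<Sum>u\<in>divs c. f u * g (c div u))"

lemma mult_funD: "mult_fun f \<Longrightarrow> f 1 = 1"
  "mult_fun f \<Longrightarrow> a > 0 \<Longrightarrow> b > 0 \<Longrightarrow> coprime a b \<Longrightarrow> f (a * b) = f a * f b"
  by (simp_all add: mult_fun_def)

lemma finite_divs [simp]: "c \<noteq> 0 \<Longrightarrow> finite (divs c)"
  unfolding divs_def by (rule finite_subset[of _ "{0..\<bar>c\<bar>}"]) (auto dest: zdvd_imp_le dvd_imp_le_int)

lemma divs_1 [simp]: "divs 1 = {1}"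
  by (auto simp: divs_def)

lemma divs_quotient: "u \<in> divs c \<Longrightarrow> c = u * (c div u)" "u \<in> divs c \<Longrightarrow> c > 0 \<Longrightarrow> c div u > 0"
  by (auto simp: divs_def pos_imp_zdiv_pos_iff zdvd_imp_le)

text \<open>For coprime \<open>a\<close> and \<open>b\<close> the map \<open>(u, v)\<close> to
  \<open>u * v\<close> is a bijection of divisor sets, with inverse \<open>d\<close> to
  \<open>(gcd d a, gcd d b)\<close>; Bezout coefficients show that the product of these two gcds is
  \<open>d\<close>.\<close>

lemma conv_mult_fun:
  assumes f: "mult_fun f" and g: "mult_fun g"
  shows "mult_fun (conv f g)"
  unfolding mult_fun_def
proof (intro conjI allI impI)
  show "conv f g 1 = 1" using f g by (simp add: conv_def mult_funD)
  fix a b :: int assume a: "a > 0" and b: "b > 0" and ab: "coprime a b"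
  have "conv f g a * conv f g b = (\<Sum>(u, v)\<in>divs a \<times> divs b. (f u * g (a div u)) * (f v * g (b div v)))"
    by (simp add: conv_def sum_product sum.cartesian_product)
  also have "\<dots> = (\<Sum>d\<in>divs (a * b). f d * g (a * b div d))"
  proof (rule sum.reindex_bij_witness[where j = "\<lambda>(u, v). u * v" and i = "\<lambda>d. (gcd d a, gcd d b)"])
    fix uv assume "uv \<in> divs a \<times> divs b"
    then obtain u v where uv: "uv = (u, v)" "u \<in> divs a" "v \<in> divs b" by auto
    have pos: "u > 0" "v > 0" and dvd: "u dvd a" "v dvd b" using uv by (auto simp: divs_def)
    have "coprime v a" "coprime u b" using ab dvd by (meson coprime_commute coprime_divisors dvd_refl)+
    then have "gcd (u * v) a = u" "gcd (u * v) b = v"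
      using pos dvd gcd_mult_left_right_cancel[of a v u] gcd_mult_left_left_cancel[of b u v]
      by (auto simp: coprime_commute)
    then show "(\<lambda>d. (gcd d a, gcd d b)) ((\<lambda>(u, v). u * v) uv) = uv" by (simp add: uv)
    show "(\<lambda>(u, v). u * v) uv \<in> divs (a * b)" using uv pos dvd by (simp add: divs_def mult_dvd_mono)
    have "coprime u v" using ab dvd by (meson coprime_divisors)
    then have 1: "f (u * v) = f u * f v" using f pos by (simp add: mult_funD)
    have aq: "a = u * (a div u)" "b = v * (b div v)" using uv divs_quotient by blast+
    have q: "a div u > 0" "b div v > 0" using uv a b divs_quotient by blast+
    have "a div u dvd a" "b div v dvd b" using aq by (metis dvd_triv_right)+
    then have "coprime (a div u) (b div v)" using ab by (meson coprime_divisors)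
    then have "g ((a div u) * (b div v)) = g (a div u) * g (b div v)" using g q by (simp add: mult_funD)
    moreover have "a * b div (u * v) = (a div u) * (b div v)" using dvd by (simp add: div_mult_div_if_dvd)
    ultimately show "f ((\<lambda>(u, v). u * v) uv) * g (a * b div (\<lambda>(u, v). u * v) uv) =
        (case uv of (u, v) \<Rightarrow> (f u * g (a div u)) * (f v * g (b div v)))"
      by (simp add: uv 1)
  next
    fix d assume d: "d \<in> divs (a * b)"
    show "(gcd d a, gcd d b) \<in> divs a \<times> divs b" using a b by (auto simp: divs_def)
    have d': "d > 0" "d dvd a * b" using d by (auto simp: divs_def)
    obtain s t s' t' where bz: "gcd d a = s * d + t * a" "gcd d b = s' * d + t' * b" using bezout_int by metis
    have "gcd d a * gcd d b = d * (s * s' * d + s * t' * b + t * s' * a) + t * t' * (a * b)"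
      unfolding bz by (simp add: algebra_simps)
    then have "d dvd gcd d a * gcd d b" using d'(2) by simp
    moreover have "gcd d a * gcd d b dvd d"
    proof (rule divides_mult)
      show "coprime (gcd d a) (gcd d b)" using ab by (meson coprime_divisors gcd_dvd2)
    qed auto
    ultimately have "gcd d a * gcd d b = d" using d'(1) by (intro zdvd_antisym_nonneg) auto
    then show "(\<lambda>(u, v). u * v) (gcd d a, gcd d b) = d" by simp
  qed
  finally show "conv f g (a * b) = conv f g a * conv f g b" by (simp add: conv_def)
qed

lemma mult_fun_prod:
  assumes f: "mult_fun f" and c: "c > 0"
  shows "f c = (\<Prod>p\<in>prime_factors c. f (p ^ multiplicity p c))"
proof -
  have "f (\<Prod>p\<in>S. p ^ multiplicity p c) = (\<Prod>p\<in>S. f (p ^ multiplicity p c)) \<and> (\<Prod>p\<in>S. p ^ multiplicity p c) > 0"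
    if "finite S" "S \<subseteq> prime_factors c" for S
    using that
  proof (induction S rule: finite_induct)
    case empty
    then show ?case using f by (simp add: mult_funD)
  next
    case (insert p S)
    have pr: "prime r" if "r \<in> insert p S" for r using insert.prems that by (auto simp: in_prime_factors_iff)
    have pos: "p ^ multiplicity p c > 0" using pr[of p] by (simp add: prime_gt_0_int)
    have "coprime (p ^ multiplicity p c) (\<Prod>r\<in>S. r ^ multiplicity r c)"
    proof (rule prod_coprime_right)
      fix r assume r: "r \<in> S"
      then have "p \<noteq> r" using insert.hyps by auto
      then have "coprime p r" using pr[of p] pr[of r] r by (intro primes_coprime) auto
      then show "coprime (p ^ multiplicity p c) (r ^ multiplicity r c)" by simp
    qed
    then show ?case using insert pos mult_funD(2)[OF f pos] by simp
  qed
  from this[of "prime_factors c"] show ?thesis using c prod_prime_factors[of c] by simp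
qed

lemma conv_prime_power:
  fixes p :: int
  assumes p: "prime p"
  shows "conv f g (p ^ j) = (\<Sum>i\<le>j. f (p ^ (j - i)) * g (p ^ i))"
proof -
  have p0: "p > 1" using p by (simp add: prime_gt_1_int)
  have "divs (p ^ j) = (\<lambda>i. p ^ (j - i)) ` {..j}"
  proof (intro equalityI subsetI)
    fix u assume "u \<in> divs (p ^ j)"
    then have u: "u > 0" "u dvd p ^ j" by (auto simp: divs_def)
    then obtain i where i: "i \<le> j" "normalize u = normalize (p ^ i)" using divides_primepow_weak[OF p] by (metis normalize_power)
    then have "u = p ^ (j - (j - i))" using u p0 by simp
    then show "u \<in> (\<lambda>i. p ^ (j - i)) ` {..j}" by (rule image_eqI) simp
  qed (use p0 in \<open>auto simp: divs_def le_imp_power_dvd\<close>)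
  moreover have "inj_on (\<lambda>i. p ^ (j - i)) {..j}"
    using p0 by (auto intro!: inj_onI dest: power_inject_exp[THEN iffD1, rotated])
  ultimately have "conv f g (p ^ j) = (\<Sum>i\<le>j. f (p ^ (j - i)) * g (p ^ j div p ^ (j - i)))"
    unfolding conv_def by (simp add: sum.reindex)
  also have "\<dots> = (\<Sum>i\<le>j. f (p ^ (j - i)) * g (p ^ i))"
  proof (rule sum.cong)
    fix i assume "i \<in> {..j}"
    then have "p ^ j = p ^ (j - i) * p ^ i" by (simp flip: power_add)
    then have "p ^ j div p ^ (j - i) = p ^ i" using p0 by simp
    then show "f (p ^ (j - i)) * g (p ^ j div p ^ (j - i)) = f (p ^ (j - i)) * g (p ^ i)" by simp
  qed simp
  finally show ?thesis .
qed

lemma kronecker_mult_fun: "mult_fun (\<lambda>u. of_int (kronecker a u))"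
  unfolding mult_fun_def
proof (intro conjI allI impI)
  show "of_int (kronecker a 1) = (1 :: complex)" by (simp add: kronecker_def)
  fix u v :: int assume u: "u > 0" and v: "v > 0"
  let ?k = "kronecker_prime a"
  have ex: "kronecker a w = (\<Prod>p\<in>S. ?k p ^ multiplicity p w)" if "w > 0" "finite S" "prime_factors w \<subseteq> S" "\<And>p. p \<in> S \<Longrightarrow> prime p" for w S
  proof -
    have "kronecker a w = (\<Prod>p\<in>prime_factors w. ?k p ^ multiplicity p w)" using that(1) by (simp add: kronecker_def)
    also have "\<dots> = (\<Prod>p\<in>S. ?k p ^ multiplicity p w)"
    proof (rule prod.mono_neutral_left)
      show "\<forall>p\<in>S - prime_factors w. ?k p ^ multiplicity p w = 1"
        using that by (auto simp: in_prime_factors_iff not_dvd_imp_multiplicity_0)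
    qed (use that in auto)
    finally show ?thesis .
  qed
  let ?S = "prime_factors (u * v)"
  have S: "finite ?S" "prime_factors u \<subseteq> ?S" "prime_factors v \<subseteq> ?S" "\<And>p. p \<in> ?S \<Longrightarrow> prime p"
    using u v by (auto simp: in_prime_factors_iff)
  have "kronecker a (u * v) = (\<Prod>p\<in>?S. ?k p ^ multiplicity p (u * v))" using u v S by (intro ex) auto
  also have "\<dots> = (\<Prod>p\<in>?S. ?k p ^ multiplicity p u * ?k p ^ multiplicity p v)"
  proof (rule prod.cong)
    fix p assume "p \<in> ?S"
    then have "prime_elem p" by (intro prime_imp_prime_elem S(4))
    then have "multiplicity p (u * v) = multiplicity p u + multiplicity p v"
      using u v by (simp add: prime_elem_multiplicity_mult_distrib)
    then show "?k p ^ multiplicity p (u * v) = ?k p ^ multiplicity p u * ?k p ^ multiplicity p v"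
      by (simp add: power_add)
  qed simp
  also have "\<dots> = kronecker a u * kronecker a v"
    using ex[OF u S(1,2,4)] ex[OF v S(1,3,4)] by (simp add: prod.distrib)
  finally show "of_int (kronecker a (u * v)) = (of_int (kronecker a u) * of_int (kronecker a v) :: complex)" by simp
qed

context lat_fundamental
begin

lemma T_quotient_mult_fun: "mult_fun (\<lambda>C. T C / of_int C ^ h)"
  by (auto simp: mult_fun_def T_mult power_mult_distrib)

lemma xi_eq_conv:
  assumes c: "c > 0"
  shows "of_real (xi B \<alpha> \<beta> l m n c) = conv (\<lambda>u. of_int (kronecker (m_L B m) u)) (\<lambda>C. T C / of_int C ^ h) c / of_int c"
proof -
  let ?\<Xi> = "\<lambda>c. conv (\<lambda>u. of_int (kronecker (m_L B m) u)) (\<lambda>C. T C / of_int C ^ h) c / of_int c"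
  have "mult_fun ?\<Xi>"
    using conv_mult_fun[OF kronecker_mult_fun T_quotient_mult_fun, of "m_L B m"] by (simp add: mult_fun_def)
  then have "?\<Xi> c = (\<Prod>p\<in>prime_factors c. ?\<Xi> (p ^ multiplicity p c))" using c by (rule mult_fun_prod)
  also have "\<dots> = (\<Prod>p\<in>prime_factors c. of_real (xi_prime_power B \<alpha> \<beta> l m n p (multiplicity p c)))"
  proof (rule prod.cong)
    fix p assume "p \<in> prime_factors c"
    then have p: "prime p" and j: "multiplicity p c \<ge> 1"
      using c by (auto simp: in_prime_factors_iff Suc_le_eq prime_multiplicity_gt_zero_iff)
    show "?\<Xi> (p ^ multiplicity p c) = of_real (xi_prime_power B \<alpha> \<beta> l m n p (multiplicity p c))"
      unfolding xi_prime_power_eq[OF p j] Xi_local_def conv_prime_power[OF p] kronecker_prime_power[OF p]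
      by (simp add: power_mult)
  qed simp
  finally show ?thesis by (simp add: xi_def)
qed

text \<open>Including all primes dividing \<open>2 \<Delta>\<close>, whether or not they divide
  \<open>c\<close>, only enlarges the product and removes its dependence on
  \<open>c\<close>.\<close>

lemma xi_bound:
  assumes c: "c \<ge> 1"
  shows "\<bar>xi B \<alpha> \<beta> l m n c\<bar> \<le> (\<Prod>p\<in>prime_factors (2 * \<Delta>). of_int p ^ (3 * h))"
proof -
  let ?b = "\<lambda>p. if p dvd 2 * \<Delta> then of_int p ^ (3 * h) else (1::real)"
  have "\<bar>xi B \<alpha> \<beta> l m n c\<bar> = (\<Prod>p\<in>prime_factors c. \<bar>xi_prime_power B \<alpha> \<beta> l m n p (multiplicity p c)\<bar>)"
    by (simp add: xi_def abs_prod)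
  also have "\<dots> \<le> (\<Prod>p\<in>prime_factors c. ?b p)"
  proof (rule prod_mono)
    fix p assume "p \<in> prime_factors c"
    then have p: "prime p" and j: "multiplicity p c \<ge> 1"
      using c by (auto simp: in_prime_factors_iff Suc_le_eq prime_multiplicity_gt_zero_iff)
    then show "0 \<le> \<bar>xi_prime_power B \<alpha> \<beta> l m n p (multiplicity p c)\<bar> \<and> \<bar>xi_prime_power B \<alpha> \<beta> l m n p (multiplicity p c)\<bar> \<le> ?b p"
      using xi_prime_power_bound by auto
  qed
  also have "\<dots> = (\<Prod>p\<in>prime_factors c \<inter> prime_factors (2 * \<Delta>). ?b p)"
    using \<Delta>_nonzero by (intro prod.mono_neutral_right) (auto simp: in_prime_factors_iff)
  also have "\<dots> \<le> (\<Prod>p\<in>prime_factors (2 * \<Delta>). ?b p)"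
  proof (rule prod_mono2)
    show "1 \<le> ?b p" if "p \<in> prime_factors (2 * \<Delta>) - prime_factors c \<inter> prime_factors (2 * \<Delta>)" for p
      using that prime_ge_1_int[of p] by (auto simp: in_prime_factors_iff intro!: one_le_power)
    show "0 \<le> ?b p" if "p \<in> prime_factors c \<inter> prime_factors (2 * \<Delta>)" for p
      using that prime_ge_1_int[of p] by (auto simp: in_prime_factors_iff)
  qed auto
  also have "\<dots> = (\<Prod>p\<in>prime_factors (2 * \<Delta>). of_int p ^ (3 * h))"
    by (intro prod.cong) (auto simp: in_prime_factors_iff)
  finally show ?thesis .
qed

end

section \<open>Unfolding the Kloosterman sums\<close>

lemma i_pow_minus: "cnj (i_pow s) = i_pow (- s)"
  by (simp add: i_pow_def exp_cnj)

text \<open>The matrix is an arbitrary choice; the evaluation uses only its bottom row and that its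
  upper left entry inverts \<open>d\<close> modulo \<open>c\<close>.\<close>

lemma some_SL2:
  assumes "coprime d c"
  shows "some_SL2 c d $ 2 $ 1 = c" "some_SL2 c d $ 2 $ 2 = d" "c dvd some_SL2 c d $ 1 $ 1 * d - 1"
proof -
  obtain a b where ab: "d * a + c * b = 1" using assms by (rule bezout_pair)
  have "\<exists>\<gamma> :: int ^ 2 ^ 2. det \<gamma> = 1 \<and> \<gamma> $ 2 $ 1 = c \<and> \<gamma> $ 2 $ 2 = d"
    by (rule exI[of _ "vector [vector [a, - b], vector [c, d]]"]) (use ab in \<open>simp add: det_2 mult.commute\<close>)
  then have \<gamma>: "det (some_SL2 c d) = 1 \<and> some_SL2 c d $ 2 $ 1 = c \<and> some_SL2 c d $ 2 $ 2 = d"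
    unfolding some_SL2_def by (rule someI_ex)
  then show "some_SL2 c d $ 2 $ 1 = c" "some_SL2 c d $ 2 $ 2 = d" by auto
  have "some_SL2 c d $ 1 $ 1 * d - 1 = c * some_SL2 c d $ 1 $ 2"
    using \<gamma> by (elim conjE) (simp add: det_2 algebra_simps)
  then show "c dvd some_SL2 c d $ 1 $ 1 * d - 1" by (metis dvd_triv_left)
qed

context even_lat
begin

text \<open>The polynomial without its term \<open>- t x\<close>. The class of \<open>l\<close>
  enters through that term alone, so a Fourier transform in \<open>l\<close> is one in
  \<open>t\<close>.\<close>

definition Hp :: "rat ^ 'n \<Rightarrow> int \<Rightarrow> rat ^ 'n \<Rightarrow> int \<Rightarrow> int \<Rightarrow> int ^ 'n \<Rightarrow> int" where
  "Hp \<alpha> mt \<beta> nt x y = mt * x\<^sup>2 - pair \<alpha> y * x - q y + pair \<beta> y + nt"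

text \<open>\<open>T\<close> with \<open>t\<close> as an explicit argument: \<open>lat_data\<close>
  fixes \<open>l\<close>, whereas the inversion sums over it.\<close>

definition Tsum :: "rat ^ 'n \<Rightarrow> int \<Rightarrow> rat ^ 'n \<Rightarrow> int \<Rightarrow> int \<Rightarrow> int \<Rightarrow> complex" where
  "Tsum \<alpha> mt \<beta> nt t C =
     (\<Sum>d\<in>units_mod C. \<Sum>x\<in>{0..<C}. \<Sum>y\<in>reps_mod C. ec C (d * (Hp \<alpha> mt \<beta> nt x y - t * x)))"

text \<open>A Kloosterman sum stripped of its normalisation and phase: the variable \<open>x\<close>
  is frozen at \<open>a w\<close> with \<open>a\<close> inverse to \<open>d\<close>.\<close>

definition Ksum :: "rat ^ 'n \<Rightarrow> int \<Rightarrow> rat ^ 'n \<Rightarrow> int \<Rightarrow> int \<Rightarrow> int \<Rightarrow> complex" where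
  "Ksum \<alpha> mt \<beta> nt w C =
     (\<Sum>d\<in>units_mod C. \<Sum>y\<in>reps_mod C. ec C (d * Hp \<alpha> mt \<beta> nt (some_SL2 C d $ 1 $ 1 * w) y))"

lemma q_add: "q (x + y) = q x + q y + B x y"
proof -
  have "2 * q (x + y) = 2 * (q x + q y + B x y)"
    unfolding q_B B_add_left B_add_right distrib_left using B_sym[of x y] by simp
  then show ?thesis by simp
qed

lemma q_smult: "q (c *s x) = c\<^sup>2 * q x"
proof -
  have "2 * q (c *s x) = 2 * (c\<^sup>2 * q x)"
    unfolding q_B B_smult_left B_smult_right using q_B[of x] by (simp add: power2_eq_square mult_ac)
  then show ?thesis by simp
qed

text \<open>The rational parts \<open>q(\<alpha>)\<close> and \<open>q(\<beta>)\<close> of the Weil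
  exponent cancel against those of \<open>m\<close> and \<open>n\<close>, leaving only the phase
  with \<open><\<alpha>, \<beta>>\<close>. Substituting \<open>d r\<close> for \<open>r\<close> and
  using that \<open>a d\<close> is 1 modulo \<open>C\<close> turns the exponent into
  \<open>d\<close> times the polynomial at \<open>x = a w\<close>. The values of rank and index
  enter as hypotheses, to be supplied by \<open>signature\<close> and
  \<open>card_disc_group\<close>.\<close>

lemma kloosterman_eq:
  assumes \<alpha>: "\<alpha> \<in> dual_lattice B" and \<beta>: "\<beta> \<in> dual_lattice B"
    and hm: "of_int m = 2 * of_int \<Delta> * (of_int mt + ext_quad B \<alpha>)"
    and hn: "of_int n = 2 * of_int \<Delta> * (of_int nt + ext_quad B \<beta>)"
    and C: "C > 0"
    and sign: "b_plus B + b_minus B = CARD('n)"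
    and card: "card (disc_group B) = nat \<bar>\<Delta>\<bar>"
  shows "kloosterman B k (of_int w *s \<alpha>) \<beta> (m * w\<^sup>2) n C =
    i_pow (- sigma_wt B k) / of_real (of_int C powr (real CARD('n) / 2) * sqrt \<bar>\<Delta>\<bar>) *
    ee (of_int w * ext_form B \<alpha> \<beta> / of_int C) * Ksum \<alpha> mt \<beta> nt w C"
proof -
  let ?s = "(real (b_minus B) - real (b_plus B)) / 2"
  let ?R = "of_int C powr (real CARD('n) / 2) * sqrt \<bar>\<Delta>\<bar> :: real"
  let ?ab = "ext_form B \<alpha> \<beta>"
  have term_eq: "cnj (weil_coeff B (of_int w *s \<alpha>) \<beta> (some_SL2 C d)) *
      e_frac (2 * \<Delta> * C) (of_int (m * w\<^sup>2 * (some_SL2 C d $ 1 $ 1) + n * d)) =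
      i_pow (- ?s) / of_real ?R * (ee (of_int w * ?ab / of_int C) *
        (\<Sum>y\<in>reps_mod C. ec C (d * Hp \<alpha> mt \<beta> nt (some_SL2 C d $ 1 $ 1 * w) y)))"
    if d: "d \<in> units_mod C" for d
  proof -
    have dC: "coprime d C" using d by (simp add: units_mod_def)
    define a where "a = some_SL2 C d $ 1 $ 1"
    have ad: "C dvd a * d - 1" unfolding a_def by (rule some_SL2(3)[OF dC])
    let ?E = "\<lambda>r. e_frac C (of_int a * ext_quad B (of_int w *s \<alpha> + emb r) - ext_form B \<beta> (of_int w *s \<alpha> + emb r) + of_int d * ext_quad B \<beta>)"
    let ?G = "\<lambda>r. a * (w\<^sup>2 * mt - w * pair \<alpha> r - q r) + d * nt + pair \<beta> r"
    have E: "cnj (?E r) * e_frac (2 * \<Delta> * C) (of_int (m * w\<^sup>2 * a + n * d)) = ee (of_int w * ?ab / of_int C) * ec C (?G r)" for r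
    proof -
      have D0: "rat_of_int \<Delta> \<noteq> 0" using \<Delta>_nonzero by simp
      have "of_int (m * w\<^sup>2 * a + n * d) / (2 * of_int \<Delta>) =
          (of_int mt + ext_quad B \<alpha>) * (of_int w)\<^sup>2 * of_int a + (of_int nt + ext_quad B \<beta>) * of_int d"
        using D0 by (simp add: hm hn field_simps)
      then have Y: "of_int (m * w\<^sup>2 * a + n * d) / (of_int (2 * \<Delta> * C)) =
          ((of_int mt + ext_quad B \<alpha>) * (of_int w)\<^sup>2 * of_int a + (of_int nt + ext_quad B \<beta>) * of_int d) / rat_of_int C"
        by (metis divide_divide_eq_left of_int_mult of_int_numeral)
      have X: "of_int a * ext_quad B (of_int w *s \<alpha> + emb r) - ext_form B \<beta> (of_int w *s \<alpha> + emb r) + of_int d * ext_quad B \<beta>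
        = of_int a * ((of_int w)\<^sup>2 * ext_quad B \<alpha> + of_int (q r) + of_int w * of_int (pair \<alpha> r)) - of_int w * ?ab - of_int (pair \<beta> r) + of_int d * ext_quad B \<beta>"
        by (simp add: ext_quad_add ext_quad_smult ext_quad_emb ext_form_simps of_int_pair[OF \<alpha>] of_int_pair[OF \<beta>] ext_form_sym[of \<beta> \<alpha>])
      have "cnj (?E r) * e_frac (2 * \<Delta> * C) (of_int (m * w\<^sup>2 * a + n * d)) =
        ee (of_int (m * w\<^sup>2 * a + n * d) / of_int (2 * \<Delta> * C) -
          (of_int a * ext_quad B (of_int w *s \<alpha> + emb r) - ext_form B \<beta> (of_int w *s \<alpha> + emb r) + of_int d * ext_quad B \<beta>) / of_int C)"
        unfolding e_frac_ee ee_minus [symmetric] ee_add [symmetric] by (simp only: diff_conv_add_uminus add.commute)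
      also have "\<dots> = ee (of_int w * ?ab / of_int C + of_int (?G r) / of_int C)"
        unfolding X Y by (intro arg_cong[of _ _ ee]) (simp add: diff_divide_distrib [symmetric] add_divide_distrib [symmetric], simp add: algebra_simps)
      finally show ?thesis by (simp add: ee_add ec_def)
    qed
    have "(\<Sum>r\<in>reps_mod C. ec C (?G r)) = (\<Sum>r\<in>reps_mod C. ec C (?G (d *s r)))"
    proof (rule sum_reps_unit[OF C _ dC, symmetric])
      fix r r' :: "int ^ 'n" assume "vdvd C (r - r')"
      then obtain z where "r - r' = C *s z" by (auto simp: vdvd_iff)
      then have r: "r = r' + C *s z" by (simp add: algebra_simps)
      have "?G r - ?G r' = C * (- a * w * pair \<alpha> z - a * (C * q z + B r' z) + pair \<beta> z)"
        unfolding r by (simp add: pair_add[OF \<alpha>] pair_add[OF \<beta>] pair_smult[OF \<alpha>] pair_smult[OF \<beta>] q_add q_smult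
            B_smult_right power2_eq_square algebra_simps)
      then show "ec C (?G r) = ec C (?G r')" by (intro ec_dvd_diff) (metis dvd_triv_left)
    qed
    also have "\<dots> = (\<Sum>r\<in>reps_mod C. ec C (d * Hp \<alpha> mt \<beta> nt (a * w) r))"
    proof (intro sum.cong[OF HOL.refl] ec_dvd_diff)
      fix r
      have "?G (d *s r) - d * Hp \<alpha> mt \<beta> nt (a * w) r = (a * d - 1) * (- (a * w\<^sup>2 * mt) - d * q r)"
        unfolding Hp_def by (simp add: pair_smult[OF \<alpha>] pair_smult[OF \<beta>] q_smult power2_eq_square algebra_simps)
      then show "C dvd ?G (d *s r) - d * Hp \<alpha> mt \<beta> nt (a * w) r" using ad by (metis dvd_mult2)
    qed
    finally have G: "(\<Sum>r\<in>reps_mod C. ec C (?G r)) = (\<Sum>r\<in>reps_mod C. ec C (d * Hp \<alpha> mt \<beta> nt (a * w) r))" .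
    have "weil_coeff B (of_int w *s \<alpha>) \<beta> (some_SL2 C d) = i_pow ?s / of_real ?R * (\<Sum>r\<in>reps_mod C. ?E r)"
      unfolding weil_coeff_def Let_def some_SL2(1,2)[OF dC] a_def [symmetric] sign card
      by (simp add: sign)
    then have "cnj (weil_coeff B (of_int w *s \<alpha>) \<beta> (some_SL2 C d)) * e_frac (2 * \<Delta> * C) (of_int (m * w\<^sup>2 * a + n * d))
      = i_pow (- ?s) / of_real ?R * (\<Sum>r\<in>reps_mod C. cnj (?E r) * e_frac (2 * \<Delta> * C) (of_int (m * w\<^sup>2 * a + n * d)))"
      by (simp only: complex_cnj_mult complex_cnj_divide i_pow_minus complex_cnj_complex_of_real cnj_sum sum_distrib_right mult.assoc)
    also have "(\<Sum>r\<in>reps_mod C. cnj (?E r) * e_frac (2 * \<Delta> * C) (of_int (m * w\<^sup>2 * a + n * d)))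
      = ee (of_int w * ?ab / of_int C) * (\<Sum>r\<in>reps_mod C. ec C (d * Hp \<alpha> mt \<beta> nt (a * w) r))"
      unfolding E sum_distrib_left [symmetric] G ..
    finally show ?thesis unfolding a_def .
  qed
  have pre: "exp (- of_real pi * \<i> * of_real k / 2) * i_pow (- ?s) = i_pow (- sigma_wt B k)"
    unfolding i_pow_def sigma_wt_def exp_add [symmetric] by (rule arg_cong[of _ _ exp]) (simp add: field_simps)
  have "kloosterman B k (of_int w *s \<alpha>) \<beta> (m * w\<^sup>2) n C = exp (- of_real pi * \<i> * of_real k / 2) *
      (\<Sum>d\<in>units_mod C. i_pow (- ?s) / of_real ?R * (ee (of_int w * ?ab / of_int C) *
        (\<Sum>y\<in>reps_mod C. ec C (d * Hp \<alpha> mt \<beta> nt (some_SL2 C d $ 1 $ 1 * w) y))))"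
    unfolding kloosterman_def units_mod_def [symmetric]
    by (rule arg_cong2[of _ _ _ _ "(*)", OF HOL.refl sum.cong[OF HOL.refl]]) (rule term_eq)
  also have "\<dots> = (exp (- of_real pi * \<i> * of_real k / 2) * i_pow (- ?s)) / of_real ?R * (ee (of_int w * ?ab / of_int C) * Ksum \<alpha> mt \<beta> nt w C)"
    unfolding Ksum_def sum_distrib_left [symmetric] by simp
  finally show ?thesis unfolding pre by (simp only: mult.assoc)
qed

end

lemma (in lat_data) T_eq_Tsum: "T C = Tsum \<alpha> mt \<beta> nt lt C"
proof -
  have "F (vcons x y) = Hp \<alpha> mt \<beta> nt x y - lt * x" for x y
    by (simp add: F_def Qf_def bf_def Hp_def)
  then show ?thesis unfolding T_altdef sum_reps_vcons Tsum_def by simp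
qed

lemma (in lat_fundamental) xi_eq_Tsum:
  assumes c: "c > 0"
  shows "of_real (xi B \<alpha> \<beta> l m n c) =
    (\<Sum>u\<in>divs c. of_int (kronecker (m_L B m) u) * (Tsum \<alpha> mt \<beta> nt lt (c div u) / of_int (c div u) ^ ((CARD('n) + 1) div 2))) / of_int c"
  unfolding xi_eq_conv[OF c] conv_def T_eq_Tsum h_def ..

section \<open>Fourier inversion\<close>

text \<open>No \<open>l\<close> is fixed here: \<open>l0\<close> is
  \<open>\<Delta> <\<alpha>, \<beta>>\<close>, and the admissible \<open>l\<close> are the numbers
  \<open>l0 + \<Delta> * t\<close>.\<close>

locale lat_global = lat_alpha B \<alpha> m mt for B :: "int ^ 'n \<Rightarrow> int ^ 'n \<Rightarrow> int" and \<alpha> m mt +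
  fixes \<beta> :: "rat ^ 'n" and n nt l0 :: int
  assumes \<beta>: "\<beta> \<in> dual_lattice B"
    and hn: "of_int n = 2 * of_int (lat_det B) * (of_int nt + ext_quad B \<beta>)"
    and hl0: "of_int l0 = of_int (lat_det B) * ext_form B \<alpha> \<beta>"
    and rank: "CARD('n) > 1"
    and fundamental: "fundamental_discriminant ((- 1) ^ ((CARD('n) - 1) div 2) * m)"
begin

lemma lat_fundamental: "lat_fundamental B \<alpha> m mt \<beta> n (l0 + \<Delta> * t) nt t"
  by unfold_locales (use \<beta> hn hl0 rank fundamental in \<open>auto simp: distrib_left\<close>)

abbreviation "\<H> \<equiv> Hp \<alpha> mt \<beta> nt"
abbreviation "\<T> \<equiv> Tsum \<alpha> mt \<beta> nt"

lemma H_cong: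
  assumes "C dvd x - x'"
  shows "C dvd \<H> x y - \<H> x' y"
proof -
  have "\<H> x y - \<H> x' y = (x - x') * (mt * (x + x') - pair \<alpha> y)"
    by (simp add: Hp_def power2_eq_square algebra_simps)
  then show ?thesis using assms by (metis dvd_mult2)
qed

lemma T_cong:
  assumes "C dvd t - t'"
  shows "\<T> t C = \<T> t' C"
proof -
  have "ec C (d * (\<H> x y - t * x)) = ec C (d * (\<H> x y - t' * x))" for d x y
  proof (rule ec_dvd_diff)
    have "d * (\<H> x y - t * x) - d * (\<H> x y - t' * x) = (t - t') * (- d * x)" by (simp add: algebra_simps)
    then show "C dvd d * (\<H> x y - t * x) - d * (\<H> x y - t' * x)" using assms by (metis dvd_mult2)
  qed
  then show ?thesis by (simp add: Tsum_def)
qed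

text \<open>Lifted to the modulus \<open>u * C\<close>, the sum over \<open>t\<close> enforces
  \<open>v = u d x\<close> modulo \<open>u * C\<close>. This is solvable only if \<open>u\<close>
  divides \<open>v\<close>, and then \<open>x\<close> must be \<open>a (v / u)\<close> modulo
  \<open>C\<close>, which is the argument in \<open>Ksum\<close>.\<close>

lemma sum_T_character:
  assumes u: "u > 0" and C: "C > 0"
  shows "(\<Sum>t\<in>{0..<u * C}. \<T> t C * ec (u * C) (t * v)) =
    (if u dvd v then of_int (u * C) * Ksum \<alpha> mt \<beta> nt (v div u) C else 0)"
proof -
  let ?c = "u * C"
  have c: "?c > 0" using u C by simp
  have e: "ec C (d * (\<H> x y - t * x)) * ec ?c (t * v) = ec C (d * \<H> x y) * ec ?c (t * (v - u * d * x))" for d x y t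
  proof -
    have "ec C (d * (\<H> x y - t * x)) = ec C (d * \<H> x y) * ec C (- (d * t * x))"
      unfolding ec_add [symmetric] by (simp add: algebra_simps)
    moreover have "ec C (- (d * t * x)) = ec ?c (u * (- (d * t * x)))"
      by (rule ec_scale [symmetric]) (use u in simp)
    moreover have "ec ?c (u * (- (d * t * x))) * ec ?c (t * v) = ec ?c (t * (v - u * d * x))"
      unfolding ec_add [symmetric] by (simp add: algebra_simps)
    ultimately show ?thesis by (simp only: mult.assoc)
  qed
  have "(\<Sum>t\<in>{0..<?c}. \<T> t C * ec ?c (t * v)) =
      (\<Sum>t\<in>{0..<?c}. \<Sum>d\<in>units_mod C. \<Sum>x\<in>{0..<C}. \<Sum>y\<in>reps_mod C. ec C (d * \<H> x y) * ec ?c (t * (v - u * d * x)))"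
    by (simp only: Tsum_def sum_distrib_right e)
  also have "\<dots> = (\<Sum>d\<in>units_mod C. \<Sum>t\<in>{0..<?c}. \<Sum>x\<in>{0..<C}. \<Sum>y\<in>reps_mod C. ec C (d * \<H> x y) * ec ?c (t * (v - u * d * x)))"
    by (rule sum.swap)
  also have "\<dots> = (\<Sum>d\<in>units_mod C. \<Sum>x\<in>{0..<C}. (\<Sum>t\<in>{0..<?c}. ec ?c (t * (v - u * d * x))) * (\<Sum>y\<in>reps_mod C. ec C (d * \<H> x y)))"
  proof (rule sum.cong[OF HOL.refl])
    fix d
    have "(\<Sum>t\<in>{0..<?c}. \<Sum>x\<in>{0..<C}. \<Sum>y\<in>reps_mod C. ec C (d * \<H> x y) * ec ?c (t * (v - u * d * x)))
      = (\<Sum>x\<in>{0..<C}. \<Sum>t\<in>{0..<?c}. \<Sum>y\<in>reps_mod C. ec C (d * \<H> x y) * ec ?c (t * (v - u * d * x)))"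
      by (rule sum.swap)
    then show "(\<Sum>t\<in>{0..<?c}. \<Sum>x\<in>{0..<C}. \<Sum>y\<in>reps_mod C. ec C (d * \<H> x y) * ec ?c (t * (v - u * d * x)))
      = (\<Sum>x\<in>{0..<C}. (\<Sum>t\<in>{0..<?c}. ec ?c (t * (v - u * d * x))) * (\<Sum>y\<in>reps_mod C. ec C (d * \<H> x y)))"
      by (simp only: sum_distrib_left sum_distrib_right mult.commute)
  qed
  also have "\<dots> = (\<Sum>d\<in>units_mod C. \<Sum>x\<in>{0..<C}. if ?c dvd v - u * d * x then of_int ?c * (\<Sum>y\<in>reps_mod C. ec C (d * \<H> x y)) else 0)"
    unfolding sum_ec[OF c] by (intro sum.cong HOL.refl) simp
  also have "\<dots> = (if u dvd v then of_int ?c * Ksum \<alpha> mt \<beta> nt (v div u) C else 0)"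
  proof (cases "u dvd v")
    case False
    have "\<not> ?c dvd v - u * d * x" for d x
    proof
      assume "?c dvd v - u * d * x"
      then have "u dvd v - u * (d * x)" by (metis dvd_mult_left mult.assoc)
      then have "u dvd (v - u * (d * x)) + u * (d * x)" by (intro dvd_add) simp_all
      then show False using False by simp
    qed
    then show ?thesis using False by simp
  next
    case True
    then obtain w where w: "v = u * w" by blast
    have "(\<Sum>x\<in>{0..<C}. if ?c dvd v - u * d * x then of_int ?c * (\<Sum>y\<in>reps_mod C. ec C (d * \<H> x y)) else 0)
      = of_int ?c * (\<Sum>y\<in>reps_mod C. ec C (d * \<H> (some_SL2 C d $ 1 $ 1 * w) y))" if d: "d \<in> units_mod C" for d
    proof -
      define a where "a = some_SL2 C d $ 1 $ 1"
      have ad: "C dvd a * d - 1" unfolding a_def using d by (intro some_SL2(3)) (simp add: units_mod_def)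
      have dvd_iff: "?c dvd v - u * d * x \<longleftrightarrow> x = (a * w) mod C" if x: "x \<in> {0..<C}" for x
      proof -
        have "v - u * d * x = u * (w - d * x)" by (simp add: w algebra_simps)
        then have "?c dvd v - u * d * x \<longleftrightarrow> C dvd w - d * x" using u by simp
        also have "\<dots> \<longleftrightarrow> C dvd a * w - x"
        proof
          assume "C dvd w - d * x"
          then have "C dvd a * (w - d * x) + (a * d - 1) * x" using ad by (metis dvd_add dvd_mult dvd_mult2)
          moreover have "a * (w - d * x) + (a * d - 1) * x = a * w - x" by (simp add: algebra_simps)
          ultimately show "C dvd a * w - x" by simp
        next
          assume "C dvd a * w - x"
          then have "C dvd d * (a * w - x) - (a * d - 1) * w" using ad by (metis dvd_diff dvd_mult dvd_mult2)
          moreover have "d * (a * w - x) - (a * d - 1) * w = w - d * x" by (simp add: algebra_simps)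
          ultimately show "C dvd w - d * x" by simp
        qed
        also have "\<dots> \<longleftrightarrow> x = (a * w) mod C"
        proof
          assume "C dvd a * w - x"
          then show "x = (a * w) mod C" using x mod_eqI[of C "a * w" x] by auto
        next
          assume "x = (a * w) mod C"
          then show "C dvd a * w - x" by (metis dvd_mod_minus dvd_diff_commute)
        qed
        finally show ?thesis .
      qed
      have "(\<Sum>x\<in>{0..<C}. if ?c dvd v - u * d * x then of_int ?c * (\<Sum>y\<in>reps_mod C. ec C (d * \<H> x y)) else 0)
        = (\<Sum>x\<in>{0..<C}. if x = (a * w) mod C then of_int ?c * (\<Sum>y\<in>reps_mod C. ec C (d * \<H> x y)) else 0)"
        by (intro sum.cong HOL.refl) (simp only: dvd_iff)
      also have "\<dots> = of_int ?c * (\<Sum>y\<in>reps_mod C. ec C (d * \<H> ((a * w) mod C) y))"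
        using C by (simp add: sum.delta')
      also have "(\<Sum>y\<in>reps_mod C. ec C (d * \<H> ((a * w) mod C) y)) = (\<Sum>y\<in>reps_mod C. ec C (d * \<H> (a * w) y))"
        by (intro sum.cong[OF HOL.refl] ec_dvd_diff) (simp only: right_diff_distrib [symmetric] dvd_mult[OF H_cong[OF dvd_mod_minus]])
      finally show ?thesis unfolding a_def .
    qed
    then show ?thesis using True u by (simp add: Ksum_def sum_distrib_left w)
  qed
  finally show ?thesis .
qed

lemma l_cong_iff: "l_cong B \<alpha> \<beta> l \<longleftrightarrow> \<Delta> dvd l - l0"
proof -
  have eq: "of_int l / of_int \<Delta> - ext_form B \<alpha> \<beta> = rat_of_int (l - l0) / of_int \<Delta>"
    using \<Delta>_nonzero by (simp add: hl0 diff_divide_distrib)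
  show ?thesis unfolding l_cong_def eq by (rule Ints_of_int_div_iff[OF \<Delta>_nonzero])
qed

text \<open>The class of \<open>l\<close> modulo \<open>2 N c\<close> in the progression
  \<open>l0 + \<Delta> t\<close> corresponds to the class of \<open>t\<close> modulo
  \<open>c\<close>, even if \<Delta> is negative.\<close>

lemma sum_l_cong:
  fixes f :: "int \<Rightarrow> complex"
  assumes c: "c > 0" and f: "\<And>t t'. c dvd t - t' \<Longrightarrow> f t = f t'"
  shows "(\<Sum>l\<in>{l. 0 \<le> l \<and> l < \<bar>\<Delta>\<bar> * c \<and> l_cong B \<alpha> \<beta> l}. f ((l - l0) div \<Delta>)) = (\<Sum>t\<in>{0..<c}. f t)"
proof (rule sum.reindex_bij_witness[where j = "\<lambda>l. ((l - l0) div \<Delta>) mod c" and i = "\<lambda>t. (l0 + \<Delta> * t) mod (\<bar>\<Delta>\<bar> * c)"])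
  let ?P = "\<bar>\<Delta>\<bar> * c"
  have P: "?P > 0" using c \<Delta>_nonzero by simp
  have P_dvd: "?P dvd \<Delta> * z \<longleftrightarrow> c dvd z" for z
  proof -
    have "?P dvd \<Delta> * z \<longleftrightarrow> \<Delta> * c dvd \<Delta> * z" by (cases "\<Delta> \<ge> 0") auto
    then show ?thesis using \<Delta>_nonzero by simp
  qed
  fix l assume "l \<in> {l. 0 \<le> l \<and> l < ?P \<and> l_cong B \<alpha> \<beta> l}"
  then have l: "0 \<le> l" "l < ?P" "\<Delta> dvd l - l0" by (auto simp: l_cong_iff)
  let ?t = "(l - l0) div \<Delta>"
  have lt: "l = l0 + \<Delta> * ?t" using l(3) by simp
  have "l0 + \<Delta> * (?t mod c) - l = \<Delta> * (?t mod c - ?t)" by (subst (2) lt) (simp add: algebra_simps)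
  then have "?P dvd l0 + \<Delta> * (?t mod c) - l" by (simp add: P_dvd)
  then show "(l0 + \<Delta> * (?t mod c)) mod ?P = l" using l by (intro mod_eqI)
  show "?t mod c \<in> {0..<c}" using c by simp
  show "f (?t mod c) = f ?t" by (rule f) simp
next
  let ?P = "\<bar>\<Delta>\<bar> * c"
  have P: "?P > 0" using c \<Delta>_nonzero by simp
  fix t assume t: "t \<in> {0..<c}"
  let ?l = "(l0 + \<Delta> * t) mod ?P"
  have "?P dvd ?l - (l0 + \<Delta> * t)" by simp
  then obtain k where "?l - (l0 + \<Delta> * t) = ?P * k" by (elim dvdE)
  \<comment> \<open>The period involves the absolute value of \<Delta>, the progression \<Delta>
    itself; the sign mediates.\<close>
  moreover have "?P * k = \<Delta> * (sgn \<Delta> * c * k)" by (simp add: abs_sgn mult_ac)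
  ultimately have l: "?l - l0 = \<Delta> * (t + c * (sgn \<Delta> * k))" by (simp add: algebra_simps)
  then have "\<Delta> dvd ?l - l0" by simp
  then show "?l \<in> {l. 0 \<le> l \<and> l < ?P \<and> l_cong B \<alpha> \<beta> l}" using P by (simp add: l_cong_iff)
  have "(?l - l0) div \<Delta> = t + c * (sgn \<Delta> * k)" unfolding l using \<Delta>_nonzero by simp
  then show "((?l - l0) div \<Delta>) mod c = t" using t by simp
qed

text \<open>The phase of \<open>l0\<close> in the exponential on the right is that of every
  Kloosterman sum on the left, since \<open>(v / u) / (c / u) = v / c\<close>; it factors out of
  both sides, and the rest is \<open>sum_T_character\<close> for each divisor
  \<open>u\<close>.\<close>

theorem main_identity:
  assumes c: "c > 0"
    and sign: "b_plus B + b_minus B = CARD('n)"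
    and card: "card (disc_group B) = nat \<bar>\<Delta>\<bar>"
  shows "(\<Sum>u\<in>{u. u > 0 \<and> u dvd gcd v c}.
       of_int (kronecker (m_L B m) u) * of_real (sqrt (of_int u / of_int c)) *
       kloosterman B k (of_int (v div u) *s \<alpha>) \<beta> (m * (v div u)\<^sup>2) n (c div u))
    = i_pow (- sigma_wt B k) / of_real (sqrt \<bar>\<Delta>\<bar>) *
      (\<Sum>l\<in>{l. 0 \<le> l \<and> l < \<bar>\<Delta>\<bar> * c \<and> l_cong B \<alpha> \<beta> l}.
         of_real (xi B \<alpha> \<beta> l m n c) * e_frac (\<Delta> * c) (of_int (l * v)))"
proof -
  let ?\<chi> = "\<lambda>u. of_int (kronecker (m_L B m) u) :: complex"
  let ?h = "(CARD('n) + 1) div 2"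
  let ?ab = "ext_form B \<alpha> \<beta>"
  define X where "X t = (\<Sum>u\<in>divs c. ?\<chi> u * (\<T> t (c div u) / of_int (c div u) ^ ?h)) / of_int c" for t
  have Xcong: "X t = X t'" if "c dvd t - t'" for t t'
  proof -
    have "\<T> t (c div u) = \<T> t' (c div u)" if u: "u \<in> divs c" for u
    proof (rule T_cong)
      have "c div u dvd c" using divs_quotient(1)[OF u] by (metis dvd_triv_right)
      then show "c div u dvd t - t'" using \<open>c dvd t - t'\<close> by (rule dvd_trans)
    qed
    then show ?thesis unfolding X_def by simp
  qed
  have "(\<Sum>l\<in>{l. 0 \<le> l \<and> l < \<bar>\<Delta>\<bar> * c \<and> l_cong B \<alpha> \<beta> l}. of_real (xi B \<alpha> \<beta> l m n c) * e_frac (\<Delta> * c) (of_int (l * v)))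
    = (\<Sum>l\<in>{l. 0 \<le> l \<and> l < \<bar>\<Delta>\<bar> * c \<and> l_cong B \<alpha> \<beta> l}. ee (of_int v * ?ab / of_int c) * (X ((l - l0) div \<Delta>) * ec c ((l - l0) div \<Delta> * v)))"
  proof (rule sum.cong[OF HOL.refl])
    fix l assume "l \<in> {l. 0 \<le> l \<and> l < \<bar>\<Delta>\<bar> * c \<and> l_cong B \<alpha> \<beta> l}"
    then have "\<Delta> dvd l - l0" by (simp add: l_cong_iff)
    then have l: "l = l0 + \<Delta> * ((l - l0) div \<Delta>)" by simp
    define t where "t = (l - l0) div \<Delta>"
    have lt: "l = l0 + \<Delta> * t" using l by (simp only: t_def [symmetric])
    have "of_real (xi B \<alpha> \<beta> l m n c) = X t"
      unfolding lt X_def by (rule lat_fundamental.xi_eq_Tsum[OF lat_fundamental c])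
    moreover have "e_frac (\<Delta> * c) (of_int (l * v)) = ee (of_int v * ?ab / of_int c) * ec c (t * v)"
    proof -
      have "rat_of_int (l * v) / of_int (\<Delta> * c) = of_int v * ?ab / of_int c + of_int (t * v) / of_int c"
        unfolding lt using \<Delta>_nonzero c by (simp add: hl0 field_simps)
      then show ?thesis by (simp add: e_frac_ee ec_def ee_add)
    qed
    ultimately show "of_real (xi B \<alpha> \<beta> l m n c) * e_frac (\<Delta> * c) (of_int (l * v)) =
        ee (of_int v * ?ab / of_int c) * (X ((l - l0) div \<Delta>) * ec c ((l - l0) div \<Delta> * v))"
      unfolding t_def [symmetric] by (simp only: mult_ac)
  qed
  also have "\<dots> = ee (of_int v * ?ab / of_int c) * (\<Sum>t\<in>{0..<c}. X t * ec c (t * v))"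
  proof -
    have cong: "X t * ec c (t * v) = X t' * ec c (t' * v)" if "c dvd t - t'" for t t'
      using Xcong[OF that] ec_dvd_diff[of c "t * v" "t' * v"] that by (simp flip: left_diff_distrib)
    show ?thesis unfolding sum_distrib_left [symmetric]
      using sum_l_cong[OF c, of "\<lambda>t. X t * ec c (t * v)", OF cong] by simp
  qed
  also have "(\<Sum>t\<in>{0..<c}. X t * ec c (t * v)) =
      (\<Sum>u\<in>divs c. ?\<chi> u / of_int (c div u) ^ ?h / of_int c * (\<Sum>t\<in>{0..<c}. \<T> t (c div u) * ec c (t * v)))"
  proof -
    have "(\<Sum>t\<in>{0..<c}. X t * ec c (t * v)) = (\<Sum>t\<in>{0..<c}. \<Sum>u\<in>divs c. ?\<chi> u / of_int (c div u) ^ ?h / of_int c * (\<T> t (c div u) * ec c (t * v)))"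
      unfolding X_def sum_divide_distrib sum_distrib_right by (intro sum.cong HOL.refl) simp
    then show ?thesis by (subst (asm) sum.swap) (simp only: sum_distrib_left)
  qed
  also have "\<dots> = (\<Sum>u\<in>divs c. if u dvd v then ?\<chi> u / of_int (c div u) ^ ?h * Ksum \<alpha> mt \<beta> nt (v div u) (c div u) else 0)"
  proof (rule sum.cong[OF HOL.refl])
    fix u assume u: "u \<in> divs c"
    have u0: "u > 0" using u by (simp add: divs_def)
    have cu: "c = u * (c div u)" "c div u > 0" using divs_quotient[OF u] c by blast+
    have "(\<Sum>t\<in>{0..<c}. \<T> t (c div u) * ec c (t * v)) = (if u dvd v then of_int c * Ksum \<alpha> mt \<beta> nt (v div u) (c div u) else 0)"
      using sum_T_character[OF u0 cu(2), of v] unfolding cu(1) [symmetric] .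
    then show "?\<chi> u / of_int (c div u) ^ ?h / of_int c * (\<Sum>t\<in>{0..<c}. \<T> t (c div u) * ec c (t * v)) =
      (if u dvd v then ?\<chi> u / of_int (c div u) ^ ?h * Ksum \<alpha> mt \<beta> nt (v div u) (c div u) else 0)"
      using c by simp
  qed
  also have "\<dots> = (\<Sum>u\<in>{u. u > 0 \<and> u dvd gcd v c}. ?\<chi> u / of_int (c div u) ^ ?h * Ksum \<alpha> mt \<beta> nt (v div u) (c div u))"
  proof -
    have "{u. u > 0 \<and> u dvd gcd v c} = {u\<in>divs c. u dvd v}" by (auto simp: divs_def)
    then show ?thesis using c by (subst sum.inter_filter [symmetric]) simp_all
  qed
  finally have R: "(\<Sum>l\<in>{l. 0 \<le> l \<and> l < \<bar>\<Delta>\<bar> * c \<and> l_cong B \<alpha> \<beta> l}. of_real (xi B \<alpha> \<beta> l m n c) * e_frac (\<Delta> * c) (of_int (l * v)))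
    = ee (of_int v * ?ab / of_int c) * (\<Sum>u\<in>{u. u > 0 \<and> u dvd gcd v c}. ?\<chi> u / of_int (c div u) ^ ?h * Ksum \<alpha> mt \<beta> nt (v div u) (c div u))" .
  show ?thesis unfolding R sum_distrib_left
  proof (rule sum.cong[OF HOL.refl])
    fix u assume "u \<in> {u. u > 0 \<and> u dvd gcd v c}"
    then have u: "u > 0" "u dvd v" "u \<in> divs c" by (auto simp: divs_def)
    define C w where "C = c div u" and "w = v div u"
    have cu: "c = u * C" "C > 0" unfolding C_def using divs_quotient[OF u(3)] c by blast+
    have vw: "v = u * w" unfolding w_def using u by simp
    have sq: "sqrt (of_int u / of_int c) = 1 / sqrt (of_int C)"
      using u cu by (simp add: real_sqrt_divide real_sqrt_mult)
    \<comment> \<open>The weight \<open>sqrt (u / c)\<close> supplies the half power that completes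
      \<open>C ^ (g / 2)\<close> to \<open>C ^ h\<close>.\<close>
    have pw: "of_int C powr (real CARD('n) / 2) * sqrt (of_int C) = of_int C ^ ?h"
    proof -
      have "of_int C powr (real CARD('n) / 2) * sqrt (of_int C) = of_int C powr (real CARD('n) / 2 + 1 / 2)"
        using cu(2) by (simp add: powr_add powr_half_sqrt)
      also have "real CARD('n) / 2 + 1 / 2 = real ?h" using odd_rank by (auto simp: field_simps elim!: oddE)
      finally show ?thesis using cu(2) by (simp add: powr_realpow)
    qed
    have ph: "of_int w * ?ab / of_int C = of_int v * ?ab / (of_int c :: rat)"
      using u cu by (simp add: vw)
    let ?I = "i_pow (- sigma_wt B k)" and ?e = "ee (of_int v * ?ab / of_int c)" and ?K = "Ksum \<alpha> mt \<beta> nt w C"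
    have kl: "kloosterman B k (of_int w *s \<alpha>) \<beta> (m * w\<^sup>2) n C =
        ?I / of_real (of_int C powr (real CARD('n) / 2) * sqrt \<bar>\<Delta>\<bar>) * ?e * ?K"
      unfolding kloosterman_eq[OF \<alpha> \<beta> hm hn cu(2) sign card] ph ..
    have Z: "complex_of_real (1 / sqrt (of_int C)) / of_real (of_int C powr (real CARD('n) / 2) * sqrt \<bar>\<Delta>\<bar>)
        = 1 / of_int C ^ ?h / of_real (sqrt \<bar>\<Delta>\<bar>)"
    proof -
      have "1 / sqrt (of_int C) / (of_int C powr (real CARD('n) / 2) * sqrt \<bar>\<Delta>\<bar>) = 1 / of_int C ^ ?h / sqrt \<bar>\<Delta>\<bar>"
        unfolding pw [symmetric] by simp
      then have "complex_of_real (1 / sqrt (of_int C) / (of_int C powr (real CARD('n) / 2) * sqrt \<bar>\<Delta>\<bar>)) = of_real (1 / of_int C ^ ?h / sqrt \<bar>\<Delta>\<bar>)"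
        by (simp only:)
      then show ?thesis by simp
    qed
    have rearrange: "x * a * (i / r * e * K) = x * i * e * K * (a / r)" "x * i * e * K * (1 / p / s) = i / s * (e * (x / p * K))"
      for x a i r e K p s :: complex
      by (simp_all add: divide_inverse)
    show "?\<chi> u * of_real (sqrt (of_int u / of_int c)) * kloosterman B k (of_int (v div u) *s \<alpha>) \<beta> (m * (v div u)\<^sup>2) n (c div u)
      = ?I / of_real (sqrt \<bar>\<Delta>\<bar>) * (?e * (?\<chi> u / of_int (c div u) ^ ?h * Ksum \<alpha> mt \<beta> nt (v div u) (c div u)))"
      unfolding C_def [symmetric] w_def [symmetric] sq kl rearrange(1) Z rearrange(2) ..
  qed
qed

end

section \<open>The signature\<close>

context even_lat
begin

definition rgram :: "real ^ 'n ^ 'n" where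
  "rgram = (\<chi> i j. of_int (B (axis i 1) (axis j 1)))"

abbreviation "rform \<equiv> ext_form B :: real ^ 'n \<Rightarrow> real ^ 'n \<Rightarrow> real"

lemma det_rgram: "det rgram = of_int \<Delta>"
  by (simp add: rgram_def lat_det_def of_int_det)

lemma rform_inner: "rform x y = (rgram *v x) \<bullet> y"
proof -
  have "rform x y = (\<Sum>j\<in>UNIV. \<Sum>i\<in>UNIV. x $ i * y $ j * of_int (B (axis i 1) (axis j 1)))"
    unfolding ext_form_def by (rule sum.swap)
  also have "\<dots> = (\<Sum>j\<in>UNIV. \<Sum>i\<in>UNIV. of_int (B (axis j 1) (axis i 1)) * x $ i * y $ j)"
    by (rule sum.cong[OF HOL.refl], rule sum.cong[OF HOL.refl]) (subst B_sym, simp only: mult_ac)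
  finally show ?thesis
    by (simp add: rgram_def matrix_vector_mult_def inner_vec_def sum_distrib_right)
qed

lemma rform_sym: "rform x y = rform y x"
proof -
  have "rform x y = (\<Sum>j\<in>UNIV. \<Sum>i\<in>UNIV. x $ i * y $ j * of_int (B (axis i 1) (axis j 1)))"
    unfolding ext_form_def by (rule sum.swap)
  also have "\<dots> = rform y x" unfolding ext_form_def
    by (rule sum.cong[OF HOL.refl], rule sum.cong[OF HOL.refl]) (subst B_sym, simp only: mult_ac)
  finally show ?thesis .
qed

lemma rform_scaleR: "rform (c *\<^sub>R x) y = c * rform x y" "rform x (c *\<^sub>R y) = c * rform x y"
  using ext_form_smult_left[of B c x y] ext_form_smult_right[of B x c y] by (simp_all add: scalar_mult_eq_scaleR)

lemma rform_nondegenerate: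
  assumes "\<And>y. rform x y = 0"
  shows "x = 0"
proof -
  have "(rgram *v x) \<bullet> (rgram *v x) = 0" using assms by (simp add: rform_inner [symmetric])
  then have "rgram *v x = 0" by simp
  moreover have "invertible rgram" using \<Delta>_nonzero by (simp add: invertible_det_nz det_rgram)
  ultimately show "x = 0"
    by (metis invertible_left_inverse matrix_left_invertible_ker)
qed

definition pos_def :: "(real ^ 'n) set \<Rightarrow> bool" where
  "pos_def V \<longleftrightarrow> subspace V \<and> (\<forall>x\<in>V. x \<noteq> 0 \<longrightarrow> rform x x > 0)"

definition neg_def :: "(real ^ 'n) set \<Rightarrow> bool" where
  "neg_def V \<longleftrightarrow> subspace V \<and> (\<forall>x\<in>V. x \<noteq> 0 \<longrightarrow> rform x x < 0)"

lemma finite_dims: "finite {dim V | V :: (real ^ 'n) set. P V}"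
  by (rule finite_subset[of _ "{..CARD('n)}"]) (auto simp: dim_subset_UNIV_cart_gen intro: order_trans[OF dim_subset_UNIV])

lemma b_plus_obtain: obtains V where "pos_def V" "dim V = b_plus B"
proof -
  have "pos_def {0}" by (simp add: pos_def_def)
  then have "{dim V | V. pos_def V} \<noteq> {}" by blast
  then have "Max {dim V | V. pos_def V} \<in> {dim V | V. pos_def V}" by (intro Max_in finite_dims)
  then obtain V where "pos_def V" "dim V = Max {dim V | V. pos_def V}" by (elim CollectE exE conjE) simp
  moreover have "b_plus B = Max {dim V | V. pos_def V}" unfolding b_plus_def pos_def_def ..
  ultimately show ?thesis using that by simp
qed

lemma b_minus_obtain: obtains V where "neg_def V" "dim V = b_minus B"
proof -
  have "neg_def {0}" by (simp add: neg_def_def)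
  then have "{dim V | V. neg_def V} \<noteq> {}" by blast
  then have "Max {dim V | V. neg_def V} \<in> {dim V | V. neg_def V}" by (intro Max_in finite_dims)
  then obtain V where "neg_def V" "dim V = Max {dim V | V. neg_def V}" by (elim CollectE exE conjE) simp
  moreover have "b_minus B = Max {dim V | V. neg_def V}" unfolding b_minus_def neg_def_def ..
  ultimately show ?thesis using that by simp
qed

lemma b_plus_ge: "pos_def V \<Longrightarrow> dim V \<le> b_plus B"
  unfolding b_plus_def by (rule Max_ge[OF finite_dims], unfold pos_def_def) blast

lemma b_minus_ge: "neg_def V \<Longrightarrow> dim V \<le> b_minus B"
  unfolding b_minus_def by (rule Max_ge[OF finite_dims], unfold neg_def_def) blast

text \<open>The orthogonal complement of a maximal positive definite subspace is negative definite.\<close>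

lemma signature: "b_plus B + b_minus B = CARD('n)"
proof (rule antisym)
  obtain V where V: "pos_def V" "dim V = b_plus B" by (rule b_plus_obtain)
  obtain W where W: "neg_def W" "dim W = b_minus B" by (rule b_minus_obtain)
  have "V \<inter> W \<subseteq> {0}" using V(1) W(1) by (force simp: pos_def_def neg_def_def)
  then have d0: "dim (V \<inter> W) = 0" by simp
  have "dim {x + y |x y. x \<in> V \<and> y \<in> W} + dim (V \<inter> W) = dim V + dim W"
    using V(1) W(1) by (intro dim_sums_Int) (auto simp: pos_def_def neg_def_def)
  then show "b_plus B + b_minus B \<le> CARD('n)"
    using V(2) W(2) d0 dim_subset_UNIV[of "{x + y |x y. x \<in> V \<and> y \<in> W}"]
    unfolding DIM_cart DIM_real by linarith
next
  obtain V where V: "pos_def V" "dim V = b_plus B" by (rule b_plus_obtain)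
  have sV: "subspace V" using V by (simp add: pos_def_def)
  define W where "W = {x. \<forall>v\<in>V. rform x v = 0}"
  have sW: "subspace W" unfolding W_def
    by (rule subspaceI) (simp_all add: ext_form_simps rform_scaleR)
  have inv: "invertible rgram" using \<Delta>_nonzero by (simp add: invertible_det_nz det_rgram)
  have dimW: "dim W + dim V = CARD('n)"
  proof -
    have "(\<lambda>x. rgram *v x) ` W = {y \<in> UNIV. \<forall>x\<in>V. orthogonal x y}"
    proof (intro equalityI subsetI)
      fix y assume "y \<in> {y \<in> UNIV. \<forall>x\<in>V. orthogonal x y}"
      moreover obtain x where x: "y = rgram *v x"
        using inv by (metis invertible_def matrix_vector_mul_assoc matrix_vector_mul_lid)
      ultimately have "x \<in> W" by (auto simp: W_def rform_inner orthogonal_def inner_commute)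
      then show "y \<in> (\<lambda>x. rgram *v x) ` W" using x by blast
    qed (auto simp: W_def rform_inner orthogonal_def inner_commute)
    moreover have "inj ((*v) rgram)" using inv inj_matrix_vector_mult by blast
    then have "dim ((\<lambda>x. rgram *v x) ` W) = dim W"
      by (intro dim_image_eq) (auto simp: inj_on_def)
    ultimately show ?thesis
      using dim_subspace_orthogonal_to_vectors[OF sV subspace_UNIV] by simp
  qed
  \<comment> \<open>A vector of positive norm in the orthogonal complement could be added to
    \<open>V\<close>, against maximality.\<close>
  have semi: "rform x x \<le> 0" if x: "x \<in> W" for x
  proof (rule ccontr)
    assume "\<not> rform x x \<le> 0"
    then have pos: "rform x x > 0" by simp
    have "x \<notin> V" using x pos by (auto simp: W_def)
    then have nx: "x \<notin> span V" using sV span_eq_iff by blast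
    have "pos_def (span (insert x V))"
      unfolding pos_def_def
    proof (intro conjI ballI impI)
      fix y assume "y \<in> span (insert x V)" and y0: "y \<noteq> 0"
      then obtain k where k: "y - k *\<^sub>R x \<in> V" using sV span_breakdown_eq[of y x V] span_eq_iff by metis
      define v where "v = y - k *\<^sub>R x"
      have y: "y = k *\<^sub>R x + v" and v: "v \<in> V" using k by (simp_all add: v_def)
      have "rform x v = 0" using x v by (simp add: W_def)
      then have "rform y y = k\<^sup>2 * rform x x + rform v v"
        unfolding y using rform_sym[of v x] by (simp add: ext_form_simps rform_scaleR power2_eq_square)
      moreover have "rform v v \<ge> 0" using v V(1) by (cases "v = 0") (auto simp: pos_def_def less_imp_le)
      moreover have "rform v v > 0" if "k = 0" using v V(1) y0 that y by (auto simp: pos_def_def)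
      ultimately show "rform y y > 0"
        using pos by (cases "k = 0") (auto intro: add_pos_nonneg)
    qed simp
    then have "dim (insert x V) \<le> dim V" using b_plus_ge[of "span (insert x V)"] V by simp
    then show False using nx by (simp add: dim_insert)
  qed
  have "V \<inter> W \<subseteq> {0}" using V(1) by (force simp: pos_def_def W_def)
  then have d0: "dim (V \<inter> W) = 0" by simp
  then have "dim {x + y |x y. x \<in> V \<and> y \<in> W} = CARD('n)"
    using dim_sums_Int[OF sV sW] dimW by linarith
  moreover have "subspace {x + y |x y. x \<in> V \<and> y \<in> W}" using sV sW by (rule subspace_sums)
  ultimately have all: "{x + y |x y. x \<in> V \<and> y \<in> W} = UNIV"
    using dim_eq_full[of "{x + y |x y. x \<in> V \<and> y \<in> W}"] span_eq_iff[of "{x + y |x y. x \<in> V \<and> y \<in> W}"] by simp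
  have "neg_def W"
    unfolding neg_def_def
  proof (intro conjI ballI impI sW)
    fix x assume x: "x \<in> W" and x0: "x \<noteq> 0"
    show "rform x x < 0"
    proof (rule ccontr)
      assume "\<not> rform x x < 0"
      then have xx: "rform x x = 0" using semi[OF x] by simp
      \<comment> \<open>A nonzero isotropic \<open>x\<close> in a semidefinite space is orthogonal
        to the space; being orthogonal to \<open>V\<close> as well, it would lie in the
        radical.\<close>
      have orth: "rform x y = 0" if y: "y \<in> W" for y
      proof (rule ccontr)
        assume ne: "rform x y \<noteq> 0"
        \<comment> \<open>Chosen so that \<open>y + s x\<close> has norm exactly 1, in conflict with
          \<open>semi\<close>.\<close>
        define s where "s = (1 - rform y y) / (2 * rform x y)"
        have "y + s *\<^sub>R x \<in> W" using x y sW by (simp add: subspace_add subspace_scale)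
        then have "rform (y + s *\<^sub>R x) (y + s *\<^sub>R x) \<le> 0" by (rule semi)
        moreover have "rform (y + s *\<^sub>R x) (y + s *\<^sub>R x) = rform y y + 2 * s * rform x y"
          using xx rform_sym[of y x] by (simp add: ext_form_simps rform_scaleR)
        moreover have "2 * s * rform x y = 1 - rform y y" using ne by (simp add: s_def)
        ultimately show False by simp
      qed
      have "rform x z = 0" for z
      proof -
        obtain v w where "z = v + w" "v \<in> V" "w \<in> W" using all by blast
        then show ?thesis using x orth by (simp add: ext_form_simps W_def)
      qed
      then show False using rform_nondegenerate x0 by blast
    qed
  qed
  then have "dim W \<le> b_minus B" by (rule b_minus_ge)
  then show "CARD('n) \<le> b_plus B + b_minus B" using dimW V by simp
qed

end

section \<open>The index of a lattice\<close>

text \<open>\<open>f\<close> need not be injective: as it preserves and reflects the relations,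
  taking images of classes is a bijection of the quotients.\<close>

lemma card_quotient_eq:
  assumes R: "equiv X R" and S: "equiv Y S" and surj: "f ` X = Y"
    and rel: "\<And>x y. x \<in> X \<Longrightarrow> y \<in> X \<Longrightarrow> (f x, f y) \<in> S \<longleftrightarrow> (x, y) \<in> R"
  shows "card (X // R) = card (Y // S)"
proof -
  have RX: "R \<subseteq> X \<times> X" and SY: "S \<subseteq> Y \<times> Y" using R S by (auto simp: equiv_def)
  have img: "f ` (R `` {x}) = S `` {f x}" if x: "x \<in> X" for x
  proof (intro equalityI subsetI)
    fix z assume "z \<in> f ` (R `` {x})"
    then obtain y where y: "z = f y" "(x, y) \<in> R" by blast
    then show "z \<in> S `` {f x}" using rel[OF x] RX by blast
  next
    fix z assume z: "z \<in> S `` {f x}"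
    then obtain y where y: "y \<in> X" "f y = z" using SY surj by blast
    then have "(x, y) \<in> R" using z rel[OF x y(1)] by blast
    then show "z \<in> f ` (R `` {x})" using y by blast
  qed
  have "bij_betw (\<lambda>K. f ` K) (X // R) (Y // S)"
    unfolding bij_betw_def
  proof
    show "inj_on (\<lambda>K. f ` K) (X // R)"
    proof (rule inj_onI)
      fix K L assume "K \<in> X // R" "L \<in> X // R" and e: "f ` K = f ` L"
      then obtain x y where x: "x \<in> X" "K = R `` {x}" and y: "y \<in> X" "L = R `` {y}"
        by (elim quotientE)
      have "S `` {f x} = S `` {f y}" using e img x y by metis
      moreover have "f y \<in> Y" using y surj by blast
      ultimately have "(f x, f y) \<in> S" by (rule eq_equiv_class[OF _ S])
      then have "(x, y) \<in> R" using rel x y by blast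
      then show "K = L" using equiv_class_eq[OF R] x y by metis
    qed
    show "(\<lambda>K. f ` K) ` (X // R) = Y // S"
    proof (intro equalityI subsetI)
      fix K assume "K \<in> (\<lambda>K. f ` K) ` (X // R)"
      then obtain x where "x \<in> X" "K = f ` (R `` {x})" by (auto elim: quotientE)
      then show "K \<in> Y // S" using img surj by (auto intro: quotientI)
    next
      fix K assume "K \<in> Y // S"
      then obtain z where z: "z \<in> Y" "K = S `` {z}" by (rule quotientE)
      obtain x where x: "x \<in> X" "f x = z" using z surj by blast
      then have "K = f ` (R `` {x})" using img z by metis
      then show "K \<in> (\<lambda>K. f ` K) ` (X // R)" using x by (auto intro: quotientI)
    qed
  qed
  then show ?thesis by (rule bij_betw_same_card)
qed

text \<open>Congruence modulo the lattice spanned by the columns of \<open>A\<close>; the classes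
  form the cokernel of \<open>A\<close>.\<close>

definition lat_rel :: "int ^ 'n ^ 'n \<Rightarrow> ((int ^ 'n) \<times> (int ^ 'n)) set" where
  "lat_rel A = {(x, y). \<exists>z. x - y = A *v z}"

lemma matrix_vector_mult_uminus: "(A :: int ^ 'n ^ 'n) *v (- z) = - (A *v z)"
  by (simp add: matrix_vector_mult_def vec_eq_iff sum_negf)

lemma equiv_lat_rel: "equiv UNIV (lat_rel A)"
proof (rule equivI)
  show "refl_on UNIV (lat_rel A)"
    by (auto simp: refl_on_def lat_rel_def intro: exI[of _ 0])
  show "sym (lat_rel A)"
  proof (rule symI)
    fix x y assume "(x, y) \<in> lat_rel A"
    then obtain z where "x - y = A *v z" by (auto simp: lat_rel_def)
    then have "y - x = A *v (- z)" by (simp add: matrix_vector_mult_uminus) (metis minus_diff_eq)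
    then show "(y, x) \<in> lat_rel A" by (auto simp: lat_rel_def)
  qed
  show "trans (lat_rel A)"
  proof (rule transI)
    fix x y z assume "(x, y) \<in> lat_rel A" "(y, z) \<in> lat_rel A"
    then obtain a b where "x - y = A *v a" "y - z = A *v b" by (auto simp: lat_rel_def)
    then have "(x - y) + (y - z) = A *v (a + b)" by (simp only: matrix_vector_right_distrib)
    then have "x - z = A *v (a + b)" by simp
    then show "(x, z) \<in> lat_rel A" by (auto simp: lat_rel_def)
  qed
qed simp

section \<open>Diagonalisation over the integers by elementary operations\<close>

definition rowop :: "'n \<Rightarrow> 'n \<Rightarrow> int \<Rightarrow> int ^ 'n ^ 'n \<Rightarrow> int ^ 'n ^ 'n" where
  "rowop i j c A = (\<chi> k l. A $ k $ l + (if k = i then c * A $ j $ l else 0))"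

definition colop :: "'n \<Rightarrow> 'n \<Rightarrow> int \<Rightarrow> int ^ 'n ^ 'n \<Rightarrow> int ^ 'n ^ 'n" where
  "colop i j c A = (\<chi> k l. A $ k $ l + (if l = i then c * A $ k $ j else 0))"

lemma det_rowop: "i \<noteq> j \<Longrightarrow> det (rowop i j c A) = det A"
proof -
  assume "i \<noteq> j"
  moreover have "rowop i j c A = (\<chi> k. if k = i then row i A + c *s row j A else row k A)"
    by (simp add: rowop_def row_def vec_eq_iff)
  ultimately show ?thesis using det_row_operation[where i = i and j = j and c = c and A = A] by simp
qed

lemma det_colop: "i \<noteq> j \<Longrightarrow> det (colop i j c A) = det A"
proof -
  assume "i \<noteq> j"
  then have "det (rowop i j c (transpose A)) = det A" by (simp add: det_rowop)
  moreover have "colop i j c A = transpose (rowop i j c (transpose A))"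
    by (simp add: rowop_def colop_def transpose_def vec_eq_iff)
  ultimately show ?thesis by simp
qed

text \<open>A column operation is an invertible substitution in the coefficient vector
  \<open>z\<close>, so the column lattice itself does not change.\<close>

lemma lat_rel_colop:
  assumes "i \<noteq> j"
  shows "lat_rel (colop i j c A) = lat_rel A"
proof -
  have 1: "colop i j c A *v z = A *v (z + axis j (c * z $ i))" for z c
    by (simp add: colop_def matrix_vector_mult_def vec_eq_iff axis_def algebra_simps sum.distrib if_distrib[of "\<lambda>x. x * _"] if_distrib[of "\<lambda>x. _ * x"] cong: if_cong)
  have 2: "A *v z = colop i j c A *v (z - axis j (c * z $ i))" for z
    unfolding 1 using assms by (simp add: axis_def)
  show ?thesis unfolding lat_rel_def using 1 2 by metis
qed

text \<open>A row operation moves the column lattice by an automorphism of the ambient lattice: the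
  relation changes, the number of classes does not.\<close>

lemma card_lat_rel_rowop:
  assumes "i \<noteq> j"
  shows "card (UNIV // lat_rel (rowop i j c A)) = card (UNIV // lat_rel A)"
proof (rule card_quotient_eq[symmetric])
  let ?f = "\<lambda>x :: int ^ 'a. x + axis i (c * x $ j)"
  have inj: "?f x = ?f y \<longleftrightarrow> x = y" for x y
  proof
    assume e: "?f x = ?f y"
    then have "?f x $ j = ?f y $ j" by simp
    then have "x $ j = y $ j" using assms by (simp add: axis_def)
    then show "x = y" using e by simp
  qed simp
  show "?f ` UNIV = UNIV"
  proof -
    have "y = ?f (y - axis i (c * y $ j))" for y using assms by (simp add: axis_def)
    then show ?thesis by blast
  qed
  have mult: "rowop i j c A *v z = ?f (A *v z)" for z
    by (simp add: rowop_def matrix_vector_mult_def vec_eq_iff axis_def distrib_right sum.distrib sum_distrib_left mult.assoc)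
  have diff: "?f x - ?f y = ?f (x - y)" for x y
    by (simp add: vec_eq_iff axis_def algebra_simps)
  show "(?f x, ?f y) \<in> lat_rel (rowop i j c A) \<longleftrightarrow> (x, y) \<in> lat_rel A" for x y
    unfolding lat_rel_def by (simp only: mem_Collect_eq prod.case mult diff inj)
qed (rule equiv_lat_rel)+

text \<open>All generators have determinant 1, so the determinant is preserved with its sign; swaps
  are avoided by \<open>smaller_pivot\<close>.\<close>

inductive unimod_equiv :: "int ^ 'n ^ 'n \<Rightarrow> int ^ 'n ^ 'n \<Rightarrow> bool" for A where
  base: "unimod_equiv A A"
| row: "unimod_equiv A A' \<Longrightarrow> i \<noteq> j \<Longrightarrow> unimod_equiv A (rowop i j c A')"
| col: "unimod_equiv A A' \<Longrightarrow> i \<noteq> j \<Longrightarrow> unimod_equiv A (colop i j c A')"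

lemma unimod_equiv_trans: "unimod_equiv A' A'' \<Longrightarrow> unimod_equiv A A' \<Longrightarrow> unimod_equiv A A''"
  by (induction rule: unimod_equiv.induct) (auto intro: unimod_equiv.intros)

lemma unimod_equiv_det: "unimod_equiv A A' \<Longrightarrow> det A' = det A"
  by (induction rule: unimod_equiv.induct) (auto simp: det_rowop det_colop)

lemma unimod_equiv_card: "unimod_equiv A A' \<Longrightarrow> card (UNIV // lat_rel A') = card (UNIV // lat_rel A)"
  by (induction rule: unimod_equiv.induct) (auto simp: card_lat_rel_rowop lat_rel_colop)

definition split_off :: "'n set \<Rightarrow> int ^ 'n ^ 'n \<Rightarrow> bool" where
  "split_off S A \<longleftrightarrow> (\<forall>k\<in>S. \<forall>l. l \<noteq> k \<longrightarrow> A $ k $ l = 0 \<and> A $ l $ k = 0)"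

lemma split_off_rowop:
  assumes "split_off S A" "i \<notin> S" "j \<notin> S"
  shows "split_off S (rowop i j c A)"
  unfolding split_off_def
proof (intro ballI allI impI)
  fix k l assume k: "k \<in> S" "l \<noteq> k"
  then have "A $ k $ l = 0" "A $ l $ k = 0" "A $ j $ k = 0" "k \<noteq> i"
    using assms by (auto simp: split_off_def)
  then show "rowop i j c A $ k $ l = 0 \<and> rowop i j c A $ l $ k = 0" by (simp add: rowop_def)
qed

lemma split_off_colop:
  assumes "split_off S A" "i \<notin> S" "j \<notin> S"
  shows "split_off S (colop i j c A)"
  unfolding split_off_def
proof (intro ballI allI impI)
  fix k l assume k: "k \<in> S" "l \<noteq> k"
  then have "A $ k $ l = 0" "A $ l $ k = 0" "A $ k $ j = 0" "k \<noteq> i"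
    using assms by (auto simp: split_off_def)
  then show "colop i j c A $ k $ l = 0 \<and> colop i j c A $ l $ k = 0" by (simp add: colop_def)
qed

text \<open>A Euclidean step without a swap: \<open>b\<close> is reduced to the remainder
  \<open>r\<close> modulo \<open>a\<close>, and a multiple of \<open>r\<close> is added to
  \<open>a\<close>, leaving \<open>a mod r\<close>, or \<open>r\<close> itself when \<open>r\<close>
  divides \<open>a\<close>. Either way the new pivot is nonzero and strictly smaller.\<close>

lemma smaller_pivot:
  fixes a b :: int
  assumes a: "a \<noteq> 0" and b: "\<not> a dvd b"
  obtains q c where "a + c * (b + q * a) \<noteq> 0" "\<bar>a + c * (b + q * a)\<bar> < \<bar>a\<bar>"
proof -
  have r: "b + - (b div a) * a = b mod a" by (simp add: minus_mult_div_eq_mod[symmetric] mult.commute)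
  let ?r = "b mod a"
  have r0: "?r \<noteq> 0" using b by (simp add: dvd_eq_mod_eq_0)
  have ra: "\<bar>?r\<bar> < \<bar>a\<bar>" using a by (rule abs_mod_less)
  show ?thesis
  proof (cases "?r dvd a")
    case True
    then have "a + (1 - a div ?r) * ?r = ?r" by (simp add: algebra_simps)
    then show ?thesis using that[of "1 - a div ?r" "- (b div a)"] r0 ra unfolding r by metis
  next
    case False
    have "a + - (a div ?r) * ?r = a mod ?r" by (simp add: minus_mult_div_eq_mod[symmetric] mult.commute)
    moreover have "a mod ?r \<noteq> 0" using False by (simp add: dvd_eq_mod_eq_0)
    moreover have "\<bar>a mod ?r\<bar> < \<bar>a\<bar>" using abs_mod_less[OF r0, of a] ra by linarith
    ultimately show ?thesis using that[of "- (a div ?r)" "- (b div a)"] unfolding r by metis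
  qed
qed

lemma clear_row:
  assumes "finite R" "split_off S A" "i \<notin> S" "\<And>l. A $ i $ i dvd A $ i $ l" "i \<notin> R" "R \<inter> S = {}"
  shows "\<exists>A'. unimod_equiv A A' \<and> split_off S A' \<and> (\<forall>k. A' $ k $ i = A $ k $ i) \<and>
    (\<forall>l. A $ i $ i dvd A' $ i $ l) \<and> (\<forall>l\<in>R. A' $ i $ l = 0)"
  using assms(1,5,6)
proof (induction R rule: finite_induct)
  case empty
  then show ?case using assms by (intro exI[of _ A]) (auto intro: unimod_equiv.base)
next
  case (insert l R)
  then obtain A' where A': "unimod_equiv A A'" "split_off S A'" "\<forall>k. A' $ k $ i = A $ k $ i"
    "\<forall>l. A $ i $ i dvd A' $ i $ l" "\<forall>l\<in>R. A' $ i $ l = 0" by auto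
  obtain t where t: "A' $ i $ l = A $ i $ i * t" using A'(4) by blast
  let ?A = "colop l i (- t) A'"
  have li: "l \<noteq> i" "l \<notin> S" using insert.prems by auto
  have eq: "?A $ i $ k = (if k = l then 0 else A' $ i $ k)" for k
    using A'(3) t by (simp add: colop_def)
  have "unimod_equiv A ?A" using A'(1) li(1) by (rule unimod_equiv.col)
  moreover have "split_off S ?A" using A'(2) li(2) assms(3) by (rule split_off_colop)
  moreover have "?A $ k $ i = A $ k $ i" for k using A'(3) li by (simp add: colop_def)
  ultimately show ?case using A'(4,5) unfolding eq[symmetric]
    by (intro exI[of _ ?A]) (auto simp: eq)
qed

lemma clear_column:
  assumes "finite R" "split_off S A" "i \<notin> S" "\<And>l. A $ i $ i dvd A $ l $ i" "i \<notin> R" "R \<inter> S = {}"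
  shows "\<exists>A'. unimod_equiv A A' \<and> split_off S A' \<and> (\<forall>k. A' $ i $ k = A $ i $ k) \<and>
    (\<forall>l. A $ i $ i dvd A' $ l $ i) \<and> (\<forall>l\<in>R. A' $ l $ i = 0)"
  using assms(1,5,6)
proof (induction R rule: finite_induct)
  case empty
  then show ?case using assms by (intro exI[of _ A]) (auto intro: unimod_equiv.base)
next
  case (insert l R)
  then obtain A' where A': "unimod_equiv A A'" "split_off S A'" "\<forall>k. A' $ i $ k = A $ i $ k"
    "\<forall>l. A $ i $ i dvd A' $ l $ i" "\<forall>l\<in>R. A' $ l $ i = 0" by auto
  obtain t where t: "A' $ l $ i = A $ i $ i * t" using A'(4) by blast
  let ?A = "rowop l i (- t) A'"
  have li: "l \<noteq> i" "l \<notin> S" using insert.prems by auto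
  have eq: "?A $ k $ i = (if k = l then 0 else A' $ k $ i)" for k
    using A'(3) t by (simp add: rowop_def)
  have "unimod_equiv A ?A" using A'(1) li(1) by (rule unimod_equiv.row)
  moreover have "split_off S ?A" using A'(2) li(2) assms(3) by (rule split_off_rowop)
  moreover have "?A $ i $ k = A $ i $ k" for k using A'(3) li by (simp add: rowop_def)
  ultimately show ?case using A'(4,5)
    by (intro exI[of _ ?A]) (auto simp: eq)
qed

text \<open>Descent on the absolute value of the pivot until it divides its row and column. These
  can then be cleared; clearing the column leaves the pivot row untouched, so the zeros made there
  persist.\<close>

lemma split_off_pivot:
  assumes "split_off S A" "i \<notin> S" "A $ i $ i \<noteq> 0"
  shows "\<exists>A'. unimod_equiv A A' \<and> split_off (insert i S) A'"
  using assms
proof (induction "nat \<bar>A $ i $ i\<bar>" arbitrary: A rule: less_induct)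
  case less
  let ?a = "A $ i $ i"
  consider (row) l where "\<not> ?a dvd A $ i $ l" | (col) l where "\<not> ?a dvd A $ l $ i"
    | (divides) "\<And>l. ?a dvd A $ i $ l" "\<And>l. ?a dvd A $ l $ i" by blast
  then show ?case
  proof cases
    case row
    have li: "l \<noteq> i" using row by auto
    have lS: "l \<notin> S" using row less.prems(1) li by (auto simp: split_off_def)
    obtain q c where qc: "?a + c * (A $ i $ l + q * ?a) \<noteq> 0" "\<bar>?a + c * (A $ i $ l + q * ?a)\<bar> < \<bar>?a\<bar>"
      using smaller_pivot[OF less.prems(3) row] by blast
    let ?A = "colop i l c (colop l i q A)"
    have p: "?A $ i $ i = ?a + c * (A $ i $ l + q * ?a)" using li by (simp add: colop_def)
    have "split_off S ?A" using less.prems lS by (intro split_off_colop)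
    moreover have "?A $ i $ i \<noteq> 0" unfolding p by (rule qc(1))
    moreover have "nat \<bar>?A $ i $ i\<bar> < nat \<bar>?a\<bar>" unfolding p using qc(2) by simp
    ultimately obtain A' where "unimod_equiv ?A A'" "split_off (insert i S) A'"
      using less.hyps less.prems(2) by blast
    moreover have "unimod_equiv A ?A" using li by (intro unimod_equiv.intros) auto
    ultimately show ?thesis using unimod_equiv_trans by blast
  next
    case col
    have li: "l \<noteq> i" using col by auto
    have lS: "l \<notin> S" using col less.prems(1) li by (auto simp: split_off_def)
    obtain q c where qc: "?a + c * (A $ l $ i + q * ?a) \<noteq> 0" "\<bar>?a + c * (A $ l $ i + q * ?a)\<bar> < \<bar>?a\<bar>"
      using smaller_pivot[OF less.prems(3) col] by blast
    let ?A = "rowop i l c (rowop l i q A)"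
    have p: "?A $ i $ i = ?a + c * (A $ l $ i + q * ?a)" using li by (simp add: rowop_def)
    have "split_off S ?A" using less.prems lS by (intro split_off_rowop)
    moreover have "?A $ i $ i \<noteq> 0" unfolding p by (rule qc(1))
    moreover have "nat \<bar>?A $ i $ i\<bar> < nat \<bar>?a\<bar>" unfolding p using qc(2) by simp
    ultimately obtain A' where "unimod_equiv ?A A'" "split_off (insert i S) A'"
      using less.hyps less.prems(2) by blast
    moreover have "unimod_equiv A ?A" using li by (intro unimod_equiv.intros) auto
    ultimately show ?thesis using unimod_equiv_trans by blast
  next
    case divides
    let ?R = "- insert i S"
    have R: "finite ?R" "i \<notin> ?R" "?R \<inter> S = {}" by auto
    obtain A1 where A1: "unimod_equiv A A1" "split_off S A1" "\<forall>k. A1 $ k $ i = A $ k $ i" "\<forall>l\<in>?R. A1 $ i $ l = 0"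
      using clear_row[OF R(1) less.prems(1,2) divides(1) R(2,3)] by blast
    have "A1 $ i $ i dvd A1 $ l $ i" for l using A1(3) divides(2) by simp
    then obtain A2 where A2: "unimod_equiv A1 A2" "split_off S A2" "\<forall>k. A2 $ i $ k = A1 $ i $ k" "\<forall>l\<in>?R. A2 $ l $ i = 0"
      using clear_column[OF R(1) A1(2) less.prems(2) _ R(2,3)] by blast
    have "A2 $ i $ l = 0 \<and> A2 $ l $ i = 0" if "l \<noteq> i" for l
    proof (cases "l \<in> S")
      case True
      then show ?thesis using A2(2) that by (auto simp: split_off_def)
    next
      case False
      then show ?thesis using A1(4) A2(3,4) that by simp
    qed
    then have "split_off (insert i S) A2" using A2(2) by (auto simp: split_off_def)
    then show ?thesis using A1(1) A2(1) unimod_equiv_trans by blast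
  qed
qed

lemma unimod_diagonalize:
  fixes A :: "int ^ 'n ^ 'n"
  assumes "det A \<noteq> 0"
  obtains D where "unimod_equiv A D" "split_off UNIV D"
proof -
  have "\<exists>D. unimod_equiv A D \<and> split_off UNIV D" if "split_off S A" "det A \<noteq> 0" for S and A :: "int ^ 'n ^ 'n"
    using that
  proof (induction "card (- S)" arbitrary: S A rule: less_induct)
    case less
    show ?case
    proof (cases "S = UNIV")
      case True
      then show ?thesis using less.prems by (intro exI[of _ A]) (auto intro: unimod_equiv.base)
    next
      case False
      then obtain i where i: "i \<notin> S" by auto
      \<comment> \<open>\<open>dvd_det_row\<close> at the modulus 0 says that a zero row forces the
        determinant to vanish.\<close>
      have "\<exists>l. A $ i $ l \<noteq> 0"
        using dvd_det_row[of 0 A i] less.prems(2) by auto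
      then obtain l where l: "A $ i $ l \<noteq> 0" by blast
      obtain A1 where A1: "unimod_equiv A A1" "split_off S A1" "A1 $ i $ i \<noteq> 0"
      proof (cases "A $ i $ i = 0")
        case True
        have li: "l \<noteq> i" using l True by auto
        have lS: "l \<notin> S" using l less.prems(1) li by (auto simp: split_off_def)
        let ?A = "colop i l 1 A"
        have "unimod_equiv A ?A" using li by (intro unimod_equiv.intros) auto
        moreover have "split_off S ?A" using less.prems(1) i lS by (rule split_off_colop)
        moreover have "?A $ i $ i \<noteq> 0" using True l by (simp add: colop_def)
        ultimately show ?thesis by (rule that)
      qed (use that less.prems(1) unimod_equiv.base in blast)
      obtain A2 where A2: "unimod_equiv A1 A2" "split_off (insert i S) A2"
        using split_off_pivot[OF A1(2) i A1(3)] by blast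
      have A12: "unimod_equiv A A2" using A2(1) A1(1) by (rule unimod_equiv_trans)
      have "card (- insert i S) < card (- S)" using i by (intro psubset_card_mono) auto
      then obtain D where "unimod_equiv A2 D" "split_off UNIV D"
        using less.hyps[of "insert i S" A2] A2(2) less.prems(2) unimod_equiv_det[OF A12] by auto
      then show ?thesis using A12 unimod_equiv_trans by blast
    qed
  qed
  from this[of "{}" A] show ?thesis using that assms by (auto simp: split_off_def)
qed

text \<open>The quotient is a product of cyclic groups, counted by tuples of residues. The tuples
  carry the identity relation so that \<open>card_quotient_eq\<close> applies to the reduction
  map.\<close>

lemma card_lat_quotient_diagonal:
  fixes D :: "int ^ 'n ^ 'n"
  assumes D: "split_off UNIV D" and det: "det D \<noteq> 0"
  shows "card (UNIV // lat_rel D) = nat \<bar>det D\<bar>"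
proof -
  let ?d = "\<lambda>i. D $ i $ i"
  have off: "D $ i $ j = 0" if "i \<noteq> j" for i j using D that by (auto simp: split_off_def)
  have detD: "det D = (\<Prod>i\<in>UNIV. ?d i)" using off by (rule det_diagonal)
  then have d0: "?d i \<noteq> 0" for i using det by auto
  have mult: "(D *v z) $ i = ?d i * z $ i" for z i
  proof -
    have "(D *v z) $ i = (\<Sum>j\<in>UNIV. if j = i then ?d i * z $ i else 0)"
      unfolding matrix_vector_mult_def vec_lambda_beta
    proof (rule sum.cong)
      fix j
      show "D $ i $ j * z $ j = (if j = i then ?d i * z $ i else 0)" using off[of i j] by auto
    qed simp
    then show ?thesis by simp
  qed
  have rel: "(x, y) \<in> lat_rel D \<longleftrightarrow> (\<forall>i. ?d i dvd x $ i - y $ i)" for x y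
  proof
    assume "(x, y) \<in> lat_rel D"
    then obtain z where z: "x - y = D *v z" by (auto simp: lat_rel_def)
    have "x $ i - y $ i = ?d i * z $ i" for i using arg_cong[OF z, of "\<lambda>v. v $ i"] by (simp add: mult)
    then show "\<forall>i. ?d i dvd x $ i - y $ i" by simp
  next
    assume "\<forall>i. ?d i dvd x $ i - y $ i"
    then have "x - y = D *v (\<chi> i. (x $ i - y $ i) div ?d i)" by (simp add: vec_eq_iff mult)
    then show "(x, y) \<in> lat_rel D" by (auto simp: lat_rel_def)
  qed
  define Y where "Y = PiE (UNIV :: 'n set) (\<lambda>i. {0..<\<bar>?d i\<bar>})"
  define f where "f x = (\<lambda>i. x $ i mod \<bar>?d i\<bar>)" for x :: "int ^ 'n"
  have "card (UNIV // lat_rel D) = card (Y // Id_on Y)"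
  proof (rule card_quotient_eq)
    show "equiv Y (Id_on Y)" by (rule equivI) (auto simp: refl_on_def sym_def trans_def)
    show "f ` UNIV = Y"
    proof (intro equalityI subsetI)
      fix g assume g: "g \<in> Y"
      have "g = f (vec_lambda g)" using g by (auto simp: f_def Y_def PiE_iff fun_eq_iff)
      then show "g \<in> f ` UNIV" by blast
    qed (use d0 in \<open>auto simp: f_def Y_def PiE_iff\<close>)
    then have fY: "f x \<in> Y" for x by blast
    have "f x = f y \<longleftrightarrow> (\<forall>i. ?d i dvd x $ i - y $ i)" for x y
      by (simp add: f_def fun_eq_iff mod_eq_dvd_iff)
    then show "(f x, f y) \<in> Id_on Y \<longleftrightarrow> (x, y) \<in> lat_rel D" for x y
      using fY unfolding rel by (auto simp: Id_on_iff)
  qed (rule equiv_lat_rel)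
  also have "Y // Id_on Y = (\<lambda>y. {y}) ` Y"
    by (auto simp: quotient_def Id_on_def)
  also have "card \<dots> = card Y" by (simp add: card_image)
  also have "\<dots> = (\<Prod>i\<in>UNIV. nat \<bar>?d i\<bar>)" by (simp add: Y_def card_PiE)
  also have "\<dots> = nat \<bar>det D\<bar>"
  proof -
    have "int (\<Prod>i\<in>UNIV. nat \<bar>?d i\<bar>) = \<bar>det D\<bar>" unfolding detD by (simp add: abs_prod)
    then show ?thesis by linarith
  qed
  finally show ?thesis .
qed

lemma card_lat_quotient:
  assumes "det A \<noteq> 0"
  shows "card (UNIV // lat_rel A) = nat \<bar>det A\<bar>"
proof -
  obtain D where D: "unimod_equiv A D" "split_off UNIV D" using unimod_diagonalize[OF assms] by blast
  then show ?thesis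
    using card_lat_quotient_diagonal[OF D(2)] unimod_equiv_card[OF D(1)] unimod_equiv_det[OF D(1)] assms by simp
qed

section \<open>The order of the discriminant group\<close>

context even_lat
begin

text \<open>The Gram matrix maps the dual lattice, in coordinates, isomorphically onto the integral
  vectors (\<open>\<Phi>\<close> lists the products with the basis) and the lattice onto the column
  lattice of the Gram matrix, whose index is the absolute value of its determinant.\<close>

lemma card_disc_group: "card (disc_group B) = nat \<bar>\<Delta>\<bar>"
proof -
  define A :: "int ^ 'n ^ 'n" where "A = (\<chi> i j. B (axis i 1) (axis j 1))"
  have detA: "det A = \<Delta>" by (simp add: A_def lat_det_def)
  have d0: "det A \<noteq> 0" using \<Delta>_nonzero by (simp add: detA)
  let ?R = "{(x, y). x \<in> dual_lattice B \<and> y \<in> dual_lattice B \<and> x - y \<in> range emb}"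
  let ?S = "lat_rel A"
  define \<Phi> :: "rat ^ 'n \<Rightarrow> int ^ 'n" where "\<Phi> x = (\<chi> i. pair x (axis i 1))" for x
  have inv: "invertible gram" using \<Delta>_nonzero by (simp add: invertible_det_nz det_gram)
  have emb\<Phi>: "emb (\<Phi> x) = gram *v x" if "x \<in> dual_lattice B" for x
    by (simp add: emb_def \<Phi>_def vec_eq_iff of_int_pair[OF that] gram_mult)
  have gram_emb: "gram *v emb z = emb (A *v z)" for z
    by (simp add: gram_def A_def emb_def matrix_vector_mult_def vec_eq_iff)
  have emb_inj: "emb x = emb y \<longleftrightarrow> x = y" for x y :: "int ^ 'n"
    by (simp add: emb_def vec_eq_iff)
  have gram_inj: "gram *v x = gram *v y \<longleftrightarrow> x = y" for x y
    using inv by (metis invertible_def matrix_vector_mul_assoc matrix_vector_mul_lid)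
  have \<Phi>_surj: "\<exists>x\<in>dual_lattice B. \<Phi> x = z" for z
  proof -
    obtain x where x: "gram *v x = emb z"
      using inv by (metis invertible_def matrix_vector_mul_assoc matrix_vector_mul_lid)
    have "x \<in> dual_lattice B"
      unfolding dual_lattice_def
    proof clarify
      fix y :: "int ^ 'n"
      have "ext_form B x (emb y) = (\<Sum>i\<in>UNIV. of_int (y $ i) * of_int (z $ i))"
      proof -
        have "ext_form B x (emb y) = (\<Sum>j\<in>UNIV. \<Sum>i\<in>UNIV. x $ i * emb y $ j * of_int (B (axis i 1) (axis j 1)))"
          unfolding ext_form_def by (rule sum.swap)
        also have "\<dots> = (\<Sum>j\<in>UNIV. of_int (y $ j) * (gram *v x) $ j)"
        proof (rule sum.cong[OF HOL.refl])
          fix j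
          have "(gram *v x) $ j = (\<Sum>i\<in>UNIV. of_int (B (axis j 1) (axis i 1)) * x $ i)"
            by (simp add: gram_def matrix_vector_mult_def)
          also have "\<dots> = (\<Sum>i\<in>UNIV. of_int (B (axis i 1) (axis j 1)) * x $ i)"
            by (rule sum.cong[OF HOL.refl]) (subst B_sym, rule HOL.refl)
          finally show "(\<Sum>i\<in>UNIV. x $ i * emb y $ j * of_int (B (axis i 1) (axis j 1))) = of_int (y $ j) * (gram *v x) $ j"
            by (simp add: sum_distrib_left emb_def mult_ac)
        qed
        finally show ?thesis by (simp add: x emb_def)
      qed
      then have "ext_form B x (emb y) = of_int (\<Sum>i\<in>UNIV. y $ i * z $ i)" by simp
      then show "ext_form B x (emb y) \<in> \<int>" by (simp only: Ints_of_int)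
    qed
    moreover from this have "\<Phi> x = z" using emb\<Phi> x emb_inj by metis
    ultimately show ?thesis by blast
  qed
  have rel: "(\<Phi> x, \<Phi> y) \<in> ?S \<longleftrightarrow> (x, y) \<in> ?R" if xy: "x \<in> dual_lattice B" "y \<in> dual_lattice B" for x y
  proof -
    have "\<Phi> x - \<Phi> y = A *v z \<longleftrightarrow> x - y = emb z" for z
    proof -
      have "\<Phi> x - \<Phi> y = A *v z \<longleftrightarrow> emb (\<Phi> x) - emb (\<Phi> y) = emb (A *v z)"
        by (simp only: emb_inj flip: emb_diff)
      also have "\<dots> \<longleftrightarrow> gram *v (x - y) = gram *v emb z"
        by (simp only: emb\<Phi>[OF xy(1)] emb\<Phi>[OF xy(2)] gram_emb matrix_vector_mult_diff_distrib)
      finally show ?thesis by (simp only: gram_inj)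
    qed
    then show ?thesis using xy by (auto simp: lat_rel_def)
  qed
  have eqR: "equiv (dual_lattice B) ?R"
  proof (rule equivI)
    show "?R \<subseteq> dual_lattice B \<times> dual_lattice B" by auto
    show "refl_on (dual_lattice B) ?R"
      by (auto simp: refl_on_def intro: range_eqI[of _ _ 0])
    show "sym ?R"
    proof (rule symI)
      fix x y assume "(x, y) \<in> ?R"
      then have xy: "x \<in> dual_lattice B" "y \<in> dual_lattice B" and "(\<Phi> x, \<Phi> y) \<in> ?S" using rel by auto
      then have "(\<Phi> y, \<Phi> x) \<in> ?S" using equiv_lat_rel by (meson equivE symD)
      then show "(y, x) \<in> ?R" using rel xy by blast
    qed
    show "trans ?R"
    proof (rule transI)
      fix x y z assume "(x, y) \<in> ?R" "(y, z) \<in> ?R"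
      then have xy: "x \<in> dual_lattice B" "y \<in> dual_lattice B" "z \<in> dual_lattice B"
        and "(\<Phi> x, \<Phi> y) \<in> ?S" "(\<Phi> y, \<Phi> z) \<in> ?S" using rel by auto
      then have "(\<Phi> x, \<Phi> z) \<in> ?S" using equiv_lat_rel by (meson equivE transD)
      then show "(x, z) \<in> ?R" using rel xy by blast
    qed
  qed
  have "z \<in> \<Phi> ` dual_lattice B" for z using \<Phi>_surj[of z] by blast
  then have "\<Phi> ` dual_lattice B = UNIV" by blast
  then have "card (dual_lattice B // ?R) = card (UNIV // ?S)"
    by (rule card_quotient_eq[OF eqR equiv_lat_rel]) (rule rel)
  then show ?thesis unfolding disc_group_def card_lat_quotient[OF d0] detA .
qed

lemma Ints_mult_\<Delta>:
  assumes "of_int m / of_int (2 * \<Delta>) - x \<in> \<int>"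
  obtains k where "rat_of_int m = 2 * of_int \<Delta> * (of_int k + x)"
proof -
  obtain k where "of_int m / of_int (2 * \<Delta>) - x = of_int k" using assms by (auto elim: Ints_cases)
  then have "rat_of_int m = of_int (2 * \<Delta>) * (of_int k + x)" using \<Delta>_nonzero by (simp add: field_simps)
  then show ?thesis using that[of k] by (simp only: of_int_mult of_int_numeral)
qed

end

lemma fundamental_nonzero: "fundamental_discriminant D \<Longrightarrow> D \<noteq> 0"
  by (auto simp: fundamental_discriminant_def)

theorem theorem2p2:
  fixes B :: "int ^ 'n \<Rightarrow> int ^ 'n \<Rightarrow> int" and N :: int
  assumes "even_lattice B"
    and "odd CARD('n)" and "CARD('n) > 1"
    and "\<bar>lat_det B\<bar> = 2 * N"
  shows
    "(\<forall>(\<alpha> :: rat ^ 'n) (\<beta> :: rat ^ 'n) (m :: int) (n :: int) (k :: real) (v :: int) (c :: int).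
        admissible B \<alpha> \<beta> m n \<and> 2 * k \<in> \<int> \<and> sigma_wt B k \<in> \<int> \<and> c \<ge> 1 \<longrightarrow>
        (\<Sum>u\<in>{u. u > 0 \<and> u dvd gcd v c}.
           of_int (kronecker (m_L B m) u) * of_real (sqrt (of_int u / of_int c)) *
           kloosterman B k (of_int (v div u) *s \<alpha>) \<beta> (m * (v div u)\<^sup>2) n (c div u))
        = i_pow (- sigma_wt B k) / of_real (sqrt (of_int (2 * N))) *
          (\<Sum>l\<in>{l. 0 \<le> l \<and> l < 2 * N * c \<and> l_cong B \<alpha> \<beta> l}.
             of_real (xi B \<alpha> \<beta> l m n c) * e_frac (lat_det B * c) (of_int (l * v))))
     \<and>
     (\<exists>C :: real. \<forall>(\<alpha> :: rat ^ 'n) (\<beta> :: rat ^ 'n) (m :: int) (n :: int) (l :: int) (c :: int).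
        admissible B \<alpha> \<beta> m n \<and> l_cong B \<alpha> \<beta> l \<and> c \<ge> 1 \<longrightarrow>
        \<bar>xi B \<alpha> \<beta> l m n c\<bar> \<le> C)"
proof -
  interpret even_lat B using assms(1) by unfold_locales
  have alpha: "lat_alpha B \<alpha> m mt"
    if "admissible B \<alpha> \<beta> m n" "rat_of_int m = 2 * of_int \<Delta> * (of_int mt + ext_quad B \<alpha>)" for \<alpha> \<beta> m n mt
  proof -
    have a: "\<alpha> \<in> dual_lattice B" and f: "fundamental_discriminant ((- 1) ^ ((CARD('n) - 1) div 2) * m)"
      using that(1) unfolding admissible_def by blast+
    have "m \<noteq> 0" using fundamental_nonzero[OF f] by auto
    then show ?thesis using a that(2) assms(2) by (intro lat_alpha.intro lat_alpha_axioms.intro even_lat_axioms)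
  qed
  show ?thesis
  proof (intro conjI allI impI)
    fix \<alpha> \<beta> :: "rat ^ 'n" and m n v c :: int and k :: real
    assume *: "admissible B \<alpha> \<beta> m n \<and> 2 * k \<in> \<int> \<and> sigma_wt B k \<in> \<int> \<and> c \<ge> 1"
    then have adm: "admissible B \<alpha> \<beta> m n" and c: "c > 0" by auto
    note adm' = adm[unfolded admissible_def]
    obtain mt where hm: "rat_of_int m = 2 * of_int \<Delta> * (of_int mt + ext_quad B \<alpha>)" using adm' Ints_mult_\<Delta> by blast
    obtain nt where hn: "rat_of_int n = 2 * of_int \<Delta> * (of_int nt + ext_quad B \<beta>)" using adm' Ints_mult_\<Delta> by blast
    obtain l0 where hl0: "rat_of_int l0 = of_int \<Delta> * ext_form B \<alpha> \<beta>" using adm' \<Delta>_pair_Ints by (metis Ints_cases)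
    interpret lat_alpha B \<alpha> m mt using adm hm by (rule alpha)
    interpret lat_global B \<alpha> m mt \<beta> n nt l0
      using adm' hn hl0 assms(3) by unfold_locales auto
    show "(\<Sum>u\<in>{u. u > 0 \<and> u dvd gcd v c}.
           of_int (kronecker (m_L B m) u) * of_real (sqrt (of_int u / of_int c)) *
           kloosterman B k (of_int (v div u) *s \<alpha>) \<beta> (m * (v div u)\<^sup>2) n (c div u))
        = i_pow (- sigma_wt B k) / of_real (sqrt (of_int (2 * N))) *
          (\<Sum>l\<in>{l. 0 \<le> l \<and> l < 2 * N * c \<and> l_cong B \<alpha> \<beta> l}.
             of_real (xi B \<alpha> \<beta> l m n c) * e_frac (lat_det B * c) (of_int (l * v)))"
      using main_identity[where k = k and v = v, OF c signature card_disc_group] unfolding assms(4) .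
  next
    show "\<exists>C :: real. \<forall>(\<alpha> :: rat ^ 'n) (\<beta> :: rat ^ 'n) (m :: int) (n :: int) (l :: int) (c :: int).
        admissible B \<alpha> \<beta> m n \<and> l_cong B \<alpha> \<beta> l \<and> c \<ge> 1 \<longrightarrow> \<bar>xi B \<alpha> \<beta> l m n c\<bar> \<le> C"
    proof (intro exI allI impI)
      fix \<alpha> \<beta> :: "rat ^ 'n" and m n l c :: int
      assume *: "admissible B \<alpha> \<beta> m n \<and> l_cong B \<alpha> \<beta> l \<and> c \<ge> 1"
      then have adm: "admissible B \<alpha> \<beta> m n" and c: "c \<ge> 1" and lc: "l_cong B \<alpha> \<beta> l" by auto
      note adm' = adm[unfolded admissible_def]
      obtain mt where hm: "rat_of_int m = 2 * of_int \<Delta> * (of_int mt + ext_quad B \<alpha>)" using adm' Ints_mult_\<Delta> by blast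
      obtain nt where hn: "rat_of_int n = 2 * of_int \<Delta> * (of_int nt + ext_quad B \<beta>)" using adm' Ints_mult_\<Delta> by blast
      obtain lt where "of_int l / of_int \<Delta> - ext_form B \<alpha> \<beta> = of_int lt"
        using lc unfolding l_cong_def by (auto elim: Ints_cases)
      then have hl: "rat_of_int l = of_int \<Delta> * (of_int lt + ext_form B \<alpha> \<beta>)"
        using \<Delta>_nonzero by (simp add: field_simps)
      interpret lat_alpha B \<alpha> m mt using adm hm by (rule alpha)
      interpret lat_fundamental B \<alpha> m mt \<beta> n l nt lt
        using adm' hn hl assms(3) by unfold_locales auto
      \<comment> \<open>The witness for \<open>C\<close> is determined here; it involves only
        \<Delta> and the rank, hence is uniform in \<alpha>, \<beta>, \<open>m\<close>,
        \<open>n\<close>, \<open>l\<close> and \<open>c\<close>.\<close>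
      show "\<bar>xi B \<alpha> \<beta> l m n c\<bar> \<le> (\<Prod>p\<in>prime_factors (2 * lat_det B). of_int p ^ (3 * ((CARD('n) + 1) div 2)))"
        using xi_bound[OF c] unfolding h_def .
    qed
  qed
qed

end
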